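(* Let $G$ be a finitely generated solvable group and let $d\ge 2$. Let $Y$ be a Cayley graph (for a finite generating set) of a uniform lattice in the isometry group of the $d$-dimensional hyperbolic space $\mathbb{H}^d$. If there exists a regular map from a Cayley graph of $G$ (for a finite generating set) to $Y$, then $G$ is virtually nilpotent.
   Context: Let $X$ and $Y$ be two graphs of uniformly bounded degrees, with combinatorial distances $d$. A map $f\colon X\to Y$ between their vertex sets is regular if there exists a constant $\kappa>0$ such that: for all $x_1,x_2\in X$, $d(f(x_1),f(x_2))\le\kappa(d(x_1,x_2)+1)$; and for all $y\in Y$, $|f^{-1}(\{y\})|\le\kappa$. *)

theory Defs
  imports "HOL-Analysis.Analysis" "HOL-Algebra.Solvable_Groups" "HOL-Algebra.Coset"
begin

section \<open>Graphs, Cayley graphs and regular maps\<close>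

text \<open>
  A graph is given by its vertex set and a symmetric adjacency relation on it.  Loops are
  harmless: only the vertices and the combinatorial distance are used.
\<close>

type_synonym 'v graph = "'v set \<times> ('v \<times> 'v) set"

abbreviation vertices :: "'v graph \<Rightarrow> 'v set" where "vertices \<equiv> fst"
abbreviation edges :: "'v graph \<Rightarrow> ('v \<times> 'v) set" where "edges \<equiv> snd"

text \<open>Only meaningful for vertices in the same connected component.\<close>

definition graph_dist :: "'v graph \<Rightarrow> 'v \<Rightarrow> 'v \<Rightarrow> nat" where
  "graph_dist X x y = (LEAST n. (x, y) \<in> edges X ^^ n)"

definition regular_map :: "'v graph \<Rightarrow> 'w graph \<Rightarrow> ('v \<Rightarrow> 'w) \<Rightarrow> bool" where
  "regular_map X Y f \<longleftrightarrow>
     f \<in> vertices X \<rightarrow> vertices Y \<and>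
     (\<exists>\<kappa>::real. \<kappa> > 0 \<and>
        (\<forall>x1\<in>vertices X. \<forall>x2\<in>vertices X.
           real (graph_dist Y (f x1) (f x2)) \<le> \<kappa> * (real (graph_dist X x1 x2) + 1)) \<and>
        (\<forall>y\<in>vertices Y. finite {x \<in> vertices X. f x = y} \<and>
           real (card {x \<in> vertices X. f x = y}) \<le> \<kappa>))"

definition finite_generating_set :: "('a, 'b) monoid_scheme \<Rightarrow> 'a set \<Rightarrow> bool" where
  "finite_generating_set G S \<longleftrightarrow> finite S \<and> S \<subseteq> carrier G \<and> generate G S = carrier G"

definition cayley_graph :: "('a, 'b) monoid_scheme \<Rightarrow> 'a set \<Rightarrow> 'a graph" where
  "cayley_graph G S =
     (carrier G, {(g, g \<otimes>\<^bsub>G\<^esub> s) | g s. g \<in> carrier G \<and> s \<in> S \<union> m_inv G ` S})"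

lemma (in group) sym_cayley_graph:
  assumes "S \<subseteq> carrier G"
  shows "sym (edges (cayley_graph G S))"
proof (rule symI)
  fix x y assume "(x, y) \<in> edges (cayley_graph G S)"
  then obtain s where s: "x \<in> carrier G" "s \<in> S \<union> m_inv G ` S" "y = x \<otimes> s"
    by (auto simp: cayley_graph_def)
  have sc: "s \<in> carrier G" using s(2) assms by auto
  have "inv s \<in> S \<union> m_inv G ` S"
    using s(2) assms by auto
  moreover have "x = y \<otimes> inv s"
    using s sc by (simp add: m_assoc)
  moreover have "y \<in> carrier G" using s sc by simp
  ultimately show "(y, x) \<in> edges (cayley_graph G S)"
    unfolding cayley_graph_def by auto
qed

lemma (in group) cayley_graph_connected:
  assumes "S \<subseteq> carrier G" "generate G S = carrier G"
    and "x \<in> carrier G" "y \<in> carrier G"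
  shows "(x, y) \<in> (edges (cayley_graph G S))\<^sup>*"
proof -
  let ?E = "edges (cayley_graph G S)"
  have step: "(x, x \<otimes> h) \<in> ?E\<^sup>*" if "h \<in> generate G S" "x \<in> carrier G" for x h
    using that
  proof (induction h arbitrary: x rule: generate.induct)
    case (incl h)
    then have "(x, x \<otimes> h) \<in> ?E" by (auto simp: cayley_graph_def)
    then show ?case by blast
  next
    case (inv h)
    then have "(x, x \<otimes> inv h) \<in> ?E" by (auto simp: cayley_graph_def)
    then show ?case by blast
  next
    case (eng h1 h2)
    have c: "h1 \<in> carrier G" "h2 \<in> carrier G"
      using eng.hyps assms(2) by auto
    have "(x \<otimes> h1, x \<otimes> h1 \<otimes> h2) \<in> ?E\<^sup>*"
      using eng c by simp
    then show ?case
      using eng.IH(1)[OF eng.prems] eng.prems c by (auto simp: m_assoc)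
  qed auto
  have "inv x \<otimes> y \<in> generate G S" using assms by simp
  from step[OF this assms(3)] show ?thesis
    using assms(3,4) by (simp add: m_assoc[symmetric])
qed


section \<open>Virtually nilpotent groups\<close>

primrec lower_central :: "('a, 'b) monoid_scheme \<Rightarrow> nat \<Rightarrow> 'a set" where
  "lower_central G 0 = carrier G"
| "lower_central G (Suc n) =
     generate G (\<Union>g\<in>carrier G. \<Union>h\<in>lower_central G n.
       {g \<otimes>\<^bsub>G\<^esub> h \<otimes>\<^bsub>G\<^esub> inv\<^bsub>G\<^esub> g \<otimes>\<^bsub>G\<^esub> inv\<^bsub>G\<^esub> h})"

definition nilpotent :: "('a, 'b) monoid_scheme \<Rightarrow> bool" where
  "nilpotent G \<longleftrightarrow> (\<exists>n. lower_central G n = {\<one>\<^bsub>G\<^esub>})"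

definition virtually_nilpotent :: "('a, 'b) monoid_scheme \<Rightarrow> bool" where
  "virtually_nilpotent G \<longleftrightarrow>
     (\<exists>H. subgroup H G \<and> finite (rcosets\<^bsub>G\<^esub> H) \<and> nilpotent (G\<lparr>carrier := H\<rparr>))"


section \<open>Hyperbolic space\<close>

text \<open>
  The upper half-space model: for an index type \<open>'n\<close>, the points of \<open>'n hyperbolic_space\<close> are
  the pairs \<open>(x, t)\<close> with \<open>x\<close> in \<open>real ^ 'n\<close> and \<open>t > 0\<close>.  The dimension is \<open>CARD('n) + 1\<close>.
\<close>

typedef (overloaded) 'n hyperbolic_space = "{p :: (real ^ 'n::finite) \<times> real. snd p > 0}"
  morphisms coords Abs_hyperbolic_space
  by (rule exI[of _ "(0, 1)"]) simp

abbreviation height :: "'n::finite hyperbolic_space \<Rightarrow> real" where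
  "height p \<equiv> snd (coords p)"

lemma height_pos [simp]: "height p > 0"
  using coords[of p] by simp

lemma height_nonzero [simp]: "height p \<noteq> 0"
  using height_pos[of p] by (metis less_irrefl)

lemma ptolemy_inequality:
  fixes a b c :: "'a::real_inner"
  shows "norm a * norm (b - c) \<le> norm b * norm (a - c) + norm c * norm (a - b)"
proof (cases "a = 0 \<or> b = 0 \<or> c = 0")
  case True
  then show ?thesis by (auto simp: mult.commute norm_minus_commute)
next
  case False
  define i where "i x = x /\<^sub>R (norm x)\<^sup>2" for x :: 'a
  have i: "norm (i x - i y) = norm (x - y) / (norm x * norm y)" if "x \<noteq> 0" "y \<noteq> 0" for x y
  proof -
    have "(norm (i x - i y))\<^sup>2 = (norm (x - y) / (norm x * norm y))\<^sup>2"
      using that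
      by (simp add: i_def power2_norm_eq_inner inner_diff power_divide power_mult_distrib
          inner_commute field_simps)
    then show ?thesis by (simp add: power2_eq_iff_nonneg)
  qed
  have "norm (i b - i c) \<le> norm (i a - i c) + norm (i a - i b)"
    using norm_triangle_ineq4[of "i a - i c" "i a - i b"] by (simp add: norm_minus_commute)
  then have "norm (b - c) / (norm b * norm c)
      \<le> norm (a - c) / (norm a * norm c) + norm (a - b) / (norm a * norm b)"
    using False i by simp
  then have "(norm (b - c) / (norm b * norm c)) * (norm a * norm b * norm c)
      \<le> (norm (a - c) / (norm a * norm c) + norm (a - b) / (norm a * norm b))
         * (norm a * norm b * norm c)"
    by (rule mult_right_mono) simp
  then show ?thesis using False by (simp add: field_simps)
qed

text \<open>
  The distance is \<open>2 arsinh (\<bar>p - q\<bar> / (2 sqrt (s t)))\<close>, where \<open>s\<close> and \<open>t\<close> are the heights of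
  \<open>p\<close> and \<open>q\<close>; the lemma \<open>cosh_hyperbolic_dist\<close> gives the equivalent form
  \<open>cosh (dist p q) = 1 + \<bar>p - q\<bar>\<^sup>2 / (2 s t)\<close>.
\<close>

instantiation hyperbolic_space :: (finite) metric_space
begin

definition dist_hyperbolic_space :: "'a hyperbolic_space \<Rightarrow> 'a hyperbolic_space \<Rightarrow> real" where
  "dist_hyperbolic_space p q =
     2 * arsinh (norm (coords p - coords q) / (2 * sqrt (height p * height q)))"

definition uniformity_hyperbolic_space ::
    "('a hyperbolic_space \<times> 'a hyperbolic_space) filter" where
  "uniformity_hyperbolic_space = (INF e\<in>{0<..}. principal {(x, y). dist x y < e})"

definition open_hyperbolic_space :: "'a hyperbolic_space set \<Rightarrow> bool" where
  "open_hyperbolic_space U \<longleftrightarrow>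
     (\<forall>x\<in>U. eventually (\<lambda>(x', y). x' = x \<longrightarrow> y \<in> U) uniformity)"

lemma sinh_half_hyperbolic_dist:
  fixes p q :: "'a hyperbolic_space"
  shows "sinh (dist p q / 2) = norm (coords p - coords q) / (2 * sqrt (height p * height q))"
  by (simp add: dist_hyperbolic_space_def)

lemma norm_diff_reflection:
  fixes p q :: "(real ^ 'a) \<times> real"
  shows "(norm (p - (fst q, - snd q)))\<^sup>2 = (norm (p - q))\<^sup>2 + 4 * (snd p * snd q)"
proof -
  have *: "(norm z)\<^sup>2 = (norm (fst z))\<^sup>2 + (snd z)\<^sup>2" for z :: "(real ^ 'a) \<times> real"
    by (simp add: norm_prod_def)
  show ?thesis
    unfolding * by (simp add: power2_eq_square algebra_simps)
qed

lemma cosh_half_hyperbolic_dist: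
  fixes p q :: "'a hyperbolic_space"
  shows "cosh (dist p q / 2)
    = norm (coords p - (fst (coords q), - height q)) / (2 * sqrt (height p * height q))"
proof -
  have "(cosh (dist p q / 2))\<^sup>2
      = (norm (coords p - (fst (coords q), - height q)) / (2 * sqrt (height p * height q)))\<^sup>2"
    unfolding cosh_square_eq sinh_half_hyperbolic_dist
    by (simp add: power_divide power_mult_distrib norm_diff_reflection less_imp_le
        add_divide_distrib)
  then show ?thesis
    by (simp add: power2_eq_iff_nonneg less_imp_le)
qed

instance
proof
  fix p q r :: "'a hyperbolic_space"
  show "dist p q = 0 \<longleftrightarrow> p = q"
    by (auto simp: dist_hyperbolic_space_def coords_inject)
  let ?r' = "(fst (coords r), - height r)"
  have "norm (coords r - ?r') = 2 * height r"
    by (simp add: minus_prod_def norm_Pair less_imp_le real_sqrt_mult)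
  moreover have "norm (coords r - ?r') * norm (coords p - coords q)
      \<le> norm (coords p - coords r) * norm (coords q - ?r')
       + norm (coords p - ?r') * norm (coords q - coords r)"
    using ptolemy_inequality[of "coords r - ?r'" "coords p - ?r'" "coords q - ?r'"]
    by (simp add: norm_minus_commute algebra_simps)
  ultimately have pt: "2 * height r * norm (coords p - coords q)
      \<le> norm (coords p - coords r) * norm (coords q - ?r')
       + norm (coords p - ?r') * norm (coords q - coords r)"
    by simp
  have "sinh (dist p q / 2)
      = (2 * height r * norm (coords p - coords q))
          / ((2 * sqrt (height p * height r)) * (2 * sqrt (height q * height r)))"
    unfolding sinh_half_hyperbolic_dist by (simp add: real_sqrt_mult less_imp_le)
  also have "\<dots> \<le> (norm (coords p - coords r) * norm (coords q - ?r')
       + norm (coords p - ?r') * norm (coords q - coords r))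
          / ((2 * sqrt (height p * height r)) * (2 * sqrt (height q * height r)))"
    by (rule divide_right_mono[OF pt]) (simp add: less_imp_le)
  also have "\<dots> = sinh (dist p r / 2) * cosh (dist q r / 2)
                + cosh (dist p r / 2) * sinh (dist q r / 2)"
    unfolding sinh_half_hyperbolic_dist cosh_half_hyperbolic_dist
    by (simp add: add_divide_distrib)
  also have "\<dots> = sinh (dist p r / 2 + dist q r / 2)"
    by (simp add: sinh_add)
  finally show "dist p q \<le> dist p r + dist q r"
    by simp
qed (simp_all add: uniformity_hyperbolic_space_def open_hyperbolic_space_def)

end

lemma cosh_hyperbolic_dist:
  fixes p q :: "'n::finite hyperbolic_space"
  shows "cosh (dist p q) = 1 + (norm (coords p - coords q))\<^sup>2 / (2 * height p * height q)"
proof -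
  have "cosh (2 * (dist p q / 2)) = 1 + 2 * (sinh (dist p q / 2))\<^sup>2"
    unfolding cosh_double_cosh cosh_square_eq by simp
  then show ?thesis
    unfolding sinh_half_hyperbolic_dist
    by (simp add: power_divide power_mult_distrib less_imp_le field_simps)
qed


section \<open>Isometry groups and uniform lattices\<close>

definition isometry_group :: "('a::metric_space \<Rightarrow> 'a) monoid" where
  "isometry_group =
     \<lparr>carrier = {\<phi>. bij \<phi> \<and> (\<forall>x y. dist (\<phi> x) (\<phi> y) = dist x y)}, mult = (\<circ>), one = id\<rparr>"

lemma group_isometry_group: "group isometry_group"
proof (rule groupI)
  fix \<phi> :: "'a \<Rightarrow> 'a" assume "\<phi> \<in> carrier isometry_group"
  then have b: "bij \<phi>" and d: "\<And>x y. dist (\<phi> x) (\<phi> y) = dist x y"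
    by (auto simp: isometry_group_def)
  have "dist (inv_into UNIV \<phi> x) (inv_into UNIV \<phi> y) = dist x y" for x y
    using d[of "inv_into UNIV \<phi> x" "inv_into UNIV \<phi> y"] b
    by (simp add: bij_is_surj surj_f_inv_f)
  then show "\<exists>\<psi>\<in>carrier isometry_group. \<psi> \<otimes>\<^bsub>isometry_group\<^esub> \<phi> = \<one>\<^bsub>isometry_group\<^esub>"
    using b by (intro bexI[of _ "inv_into UNIV \<phi>"])
      (auto simp: isometry_group_def bij_imp_bij_inv bij_is_inj)
qed (auto simp: isometry_group_def bij_comp comp_assoc)

text \<open>
  The topology of a function type is the product topology, so this is the topology of pointwise
  convergence on the isometry group.  On isometries of a metric space it coincides with the
  compact-open topology.
\<close>

definition isometry_topology :: "('a::metric_space \<Rightarrow> 'a) topology" where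
  "isometry_topology = top_of_set (carrier isometry_group)"

text \<open>
  Discrete cocompact subgroups of a group \<open>L\<close> with topology \<open>T\<close>.  The quotient is the space of
  cosets \<open>\<Gamma> g\<close>; being a quotient map along the projection determines its topology \<open>Q\<close>.
\<close>

definition uniform_lattice ::
    "('a, 'b) monoid_scheme \<Rightarrow> 'a topology \<Rightarrow> 'a set \<Rightarrow> bool" where
  "uniform_lattice L T \<Gamma> \<longleftrightarrow>
     subgroup \<Gamma> L \<and>
     subtopology T \<Gamma> = discrete_topology \<Gamma> \<and>
     (\<exists>Q. quotient_map T Q (\<lambda>g. \<Gamma> #>\<^bsub>L\<^esub> g) \<and> compact_space Q)"

end

theory Submission
  imports Defs "HOL-Computational_Algebra.Computational_Algebra" "HOL-Real_Asymp.Real_Asymp"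
begin

text \<open>
  A regular map from \<open>G\<close> to a lattice, followed by an orbit map, sends \<open>G\<close> to hyperbolic space with
  bounded multiplicity and bounded displacement of edges.  In the upper half-space, a finite set of \<open>n\<close>
  such points is cut in a balanced way by a box, along at most \<open>C n\<^sup>1\<^sup>-\<^sup>\<epsilon>\<close> edges.  Being amenable, \<open>G\<close> has
  Folner sets; cutting one repeatedly and keeping the better part yields sets of size about \<open>N\<close> with
  boundary ratio at most \<open>C N\<^sup>-\<^sup>\<epsilon>\<close> for every \<open>N\<close>.  If \<open>G\<close> contained a free subsemigroup, its exponential
  growth would force this ratio to be at least \<open>c / log N\<close>.

  Finally, a finitely generated solvable group without free subsemigroups is virtually nilpotent
  (Milnor, Wolf, Rosenblatt): it is polycyclic by Milnor's lemma, and by induction on a cyclic series it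
  suffices to extend a nilpotent group by one element \<open>t\<close>, some power of which acts unipotently on every
  factor of the lower central series.
\<close>

section \<open>Conjugation and cyclic extensions\<close>

text \<open>A regular map may identify points and bring distant points together, so the geometry of
  \<open>G\<close> cannot be read off its image. What it does transport is an upper bound for the
  cost of cutting finite sets in two. Half-space has cheap cuts at every scale because edges are
  short compared with a large box, except for those between high points, and high points are few.
  The saving \<open>n powr (- \<epsilon>)\<close> obtained here is weaker than the best one for
  hyperbolic space, but any positive power defeats the factor \<open>1 / log N\<close> forced by a
  free subsemigroup. A Folner set alone contradicts nothing, since its size is not under control;
  the point of the repeated cutting is to carry its small boundary ratio down to a prescribed size,
  where exponential growth can be confronted with it. On the algebraic side, two words of equal
  length with the same value become, on each factor of a central series, a polynomial relation with
  coefficients in \<open>{-1, 0, 1}\<close>; this is the only information available about the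
  eigenvalues of \<open>t\<close>.\<close>

definition conj_by :: "('a, 'b) monoid_scheme \<Rightarrow> 'a \<Rightarrow> 'a \<Rightarrow> 'a" where
  "conj_by G t x = t \<otimes>\<^bsub>G\<^esub> x \<otimes>\<^bsub>G\<^esub> inv\<^bsub>G\<^esub> t"

context group
begin

lemma inv_mult_cancel [simp]:
  "x \<in> carrier G \<Longrightarrow> y \<in> carrier G \<Longrightarrow> inv x \<otimes> (x \<otimes> y) = y"
  "x \<in> carrier G \<Longrightarrow> y \<in> carrier G \<Longrightarrow> x \<otimes> (inv x \<otimes> y) = y"
  by (simp_all add: m_assoc[symmetric])

lemma conj_by_closed [simp]:
  "t \<in> carrier G \<Longrightarrow> x \<in> carrier G \<Longrightarrow> conj_by G t x \<in> carrier G"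
  by (simp add: conj_by_def)

lemma conj_by_one [simp]: "t \<in> carrier G \<Longrightarrow> conj_by G t \<one> = \<one>"
  by (simp add: conj_by_def)

lemma conj_by_one_left [simp]: "x \<in> carrier G \<Longrightarrow> conj_by G \<one> x = x"
  by (simp add: conj_by_def)

lemma conj_by_mult:
  "t \<in> carrier G \<Longrightarrow> x \<in> carrier G \<Longrightarrow> y \<in> carrier G \<Longrightarrow>
     conj_by G t (x \<otimes> y) = conj_by G t x \<otimes> conj_by G t y"
  by (simp add: conj_by_def m_assoc)

lemma conj_by_inv:
  "t \<in> carrier G \<Longrightarrow> x \<in> carrier G \<Longrightarrow> conj_by G t (inv x) = inv (conj_by G t x)"
  by (simp add: conj_by_def m_assoc inv_mult_group)

lemma conj_by_conj_by:
  "s \<in> carrier G \<Longrightarrow> t \<in> carrier G \<Longrightarrow> x \<in> carrier G \<Longrightarrow>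
     conj_by G s (conj_by G t x) = conj_by G (s \<otimes> t) x"
  by (simp add: conj_by_def m_assoc inv_mult_group)

lemma conj_by_eq_iff:
  "t \<in> carrier G \<Longrightarrow> x \<in> carrier G \<Longrightarrow> y \<in> carrier G \<Longrightarrow>
     conj_by G t x = conj_by G t y \<longleftrightarrow> x = y"
  by (simp add: conj_by_def)

lemma conj_by_generate:
  assumes "S \<subseteq> carrier G" "t \<in> carrier G" "y \<in> generate G S"
  shows "conj_by G t y \<in> generate G (conj_by G t ` S)"
  using assms(3)
proof induction
  case (inv h)
  then have "conj_by G t (inv h) = inv (conj_by G t h)"
    using assms conj_by_inv by blast
  then show ?case using inv by (simp add: generate.inv)
next
  case (eng h1 h2)
  then have "conj_by G t (h1 \<otimes> h2) = conj_by G t h1 \<otimes> conj_by G t h2"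
    using assms conj_by_mult generate_in_carrier by blast
  then show ?case using eng by (simp add: generate.eng)
qed (use assms in \<open>auto intro: generate.intros\<close>)

lemma conj_by_subgroup:
  assumes "subgroup H G" "t \<in> H" "x \<in> H"
  shows "conj_by G t x \<in> H"
  using assms by (simp add: conj_by_def subgroup.m_closed subgroup.m_inv_closed)

lemma conj_by_pow_closed:
  assumes "t \<in> carrier G" "N \<subseteq> carrier G"
    and "\<And>n. n \<in> N \<Longrightarrow> conj_by G t n \<in> N" "n \<in> N"
  shows "conj_by G (t [^] (k::nat)) n \<in> N"
proof (induction k)
  case 0 then show ?case using assms by auto
next
  case (Suc k)
  have "conj_by G (t [^] Suc k) n = conj_by G t (conj_by G (t [^] k) n)"
    using assms nat_pow_Suc2[OF assms(1), of k] by (subst conj_by_conj_by) auto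
  then show ?case using Suc assms by simp
qed

lemma conj_by_int_pow_closed:
  assumes "t \<in> carrier G" "N \<subseteq> carrier G"
    and "\<And>n. n \<in> N \<Longrightarrow> conj_by G t n \<in> N" "\<And>n. n \<in> N \<Longrightarrow> conj_by G (inv t) n \<in> N" "n \<in> N"
  shows "conj_by G (t [^] (k::int)) n \<in> N"
proof (cases k rule: int_cases2)
  case (nonneg m)
  then show ?thesis using conj_by_pow_closed[OF assms(1,2,3,5)] by (simp add: int_pow_int)
next
  case (nonpos m)
  have "t [^] k = (inv t) [^] m"
    using assms(1) nonpos by (simp add: int_pow_neg_int nat_pow_inv)
  then show ?thesis using conj_by_pow_closed[OF _ assms(2,4,5)] assms(1) by simp
qed

lemma conj_by_pow:
  assumes "t \<in> carrier G" "x \<in> carrier G"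
  shows "conj_by G t (x [^] (k::nat)) = conj_by G t x [^] k"
  using assms by (induction k) (auto simp: conj_by_mult)

end

text \<open>Conjugation by \<open>t\<close> and by \<open>inv t\<close> must both be controlled: one
  of them alone may map \<open>N\<close> onto a proper subgroup of itself. Powers of
  \<open>t\<close> may lie in \<open>N\<close>, so the cyclic quotient can be finite or
  infinite.\<close>

definition cyc_ext :: "('a, 'b) monoid_scheme \<Rightarrow> 'a set \<Rightarrow> 'a \<Rightarrow> 'a set \<Rightarrow> bool" where
  "cyc_ext G N t H \<longleftrightarrow> subgroup N G \<and> t \<in> carrier G \<and>
     (\<forall>n\<in>N. conj_by G t n \<in> N \<and> conj_by G (inv\<^bsub>G\<^esub> t) n \<in> N) \<and>
     H = {n \<otimes>\<^bsub>G\<^esub> t [^]\<^bsub>G\<^esub> i | n (i::int). n \<in> N}"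

context group
begin

lemma cyc_extD:
  assumes "cyc_ext G N t H"
  shows "subgroup N G" "t \<in> carrier G" "N \<subseteq> carrier G"
    "\<And>n. n \<in> N \<Longrightarrow> conj_by G t n \<in> N" "\<And>n. n \<in> N \<Longrightarrow> conj_by G (inv t) n \<in> N"
  using assms subgroup.subset by (auto simp: cyc_ext_def)

lemma cyc_ext_elem:
  assumes "cyc_ext G N t H" "h \<in> H"
  obtains n and i::int where "n \<in> N" "h = n \<otimes> t [^] i"
  using assms by (auto simp: cyc_ext_def)

lemma cyc_ext_memI:
  assumes "cyc_ext G N t H" "n \<in> N"
  shows "n \<otimes> t [^] (i::int) \<in> H"
  using assms by (auto simp: cyc_ext_def)

lemma cyc_ext_conj_pow:
  assumes "cyc_ext G N t H" "n \<in> N"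
  shows "conj_by G (t [^] (i::int)) n \<in> N"
  using conj_by_int_pow_closed[OF cyc_extD(2)[OF assms(1)] cyc_extD(3)[OF assms(1)]]
    cyc_extD(4,5)[OF assms(1)] assms(2) by blast

lemma cyc_ext_mult:
  assumes "cyc_ext G N t H" "n \<in> N" "n' \<in> N"
  shows "(n \<otimes> t [^] (i::int)) \<otimes> (n' \<otimes> t [^] (j::int)) = (n \<otimes> conj_by G (t [^] i) n') \<otimes> t [^] (i + j)"
proof -
  have "n \<in> carrier G" "n' \<in> carrier G" "t \<in> carrier G" using cyc_extD(2,3)[OF assms(1)] assms by auto
  then show ?thesis by (simp add: conj_by_def int_pow_mult m_assoc)
qed

lemma cyc_ext_subset:
  assumes "cyc_ext G N t H"
  shows "N \<subseteq> H" "t \<in> H" "H \<subseteq> carrier G"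
proof -
  note D = cyc_extD[OF assms]
  show "N \<subseteq> H"
  proof
    fix n assume n: "n \<in> N"
    then show "n \<in> H" using cyc_ext_memI[OF assms n, of 0] D by auto
  qed
  show "t \<in> H" using cyc_ext_memI[OF assms subgroup.one_closed[OF D(1)], of 1] D by simp
  show "H \<subseteq> carrier G" using assms D unfolding cyc_ext_def by auto
qed

lemma cyc_ext_subgroup:
  assumes "cyc_ext G N t H"
  shows "subgroup H G"
proof
  note D = cyc_extD[OF assms]
  show "H \<subseteq> carrier G" using cyc_ext_subset[OF assms] by blast
  show "\<one> \<in> H" using cyc_ext_subset[OF assms] subgroup.one_closed[OF D(1)] by blast
  fix x y assume "x \<in> H"
  then obtain n i where x: "n \<in> N" "x = n \<otimes> t [^] (i::int)" using cyc_ext_elem[OF assms] by blast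
  show "inv x \<in> H"
  proof -
    have c: "n \<in> carrier G" using x D by auto
    have "inv x = conj_by G (t [^] (-i)) (inv n) \<otimes> t [^] (-i)"
      using c D by (simp add: x conj_by_def m_assoc inv_mult_group int_pow_neg)
    then show ?thesis
      using cyc_ext_memI[OF assms] cyc_ext_conj_pow[OF assms] subgroup.m_inv_closed[OF D(1)] x by metis
  qed
  assume "y \<in> H"
  then obtain n' j where y: "n' \<in> N" "y = n' \<otimes> t [^] (j::int)" using cyc_ext_elem[OF assms] by blast
  show "x \<otimes> y \<in> H"
    unfolding x y cyc_ext_mult[OF assms x(1) y(1)]
    using cyc_ext_memI[OF assms] cyc_ext_conj_pow[OF assms] subgroup.m_closed[OF D(1)] x y by metis
qed

lemma cyc_ext_normal:
  assumes "cyc_ext G N t H" "h \<in> H" "n \<in> N"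
  shows "conj_by G h n \<in> N"
proof -
  note D = cyc_extD[OF assms(1)]
  obtain m i where h: "m \<in> N" "h = m \<otimes> t [^] (i::int)" using cyc_ext_elem[OF assms(1,2)] by blast
  have "conj_by G h n = conj_by G m (conj_by G (t [^] i) n)"
    using h D assms(3) by (subst conj_by_conj_by) auto
  then show ?thesis
    using conj_by_subgroup[OF D(1) h(1)] cyc_ext_conj_pow[OF assms(1,3)] by simp
qed

lemma cyc_ext_least:
  assumes "cyc_ext G N t H" "subgroup K G" "N \<subseteq> K" "t \<in> K"
  shows "H \<subseteq> K"
proof
  fix h assume "h \<in> H"
  then obtain n i where "n \<in> N" "h = n \<otimes> t [^] (i::int)" using cyc_ext_elem[OF assms(1)] by blast
  then show "h \<in> K"
    using assms by (auto intro!: subgroup.m_closed subgroup_int_pow_closed)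
qed

lemma cyc_extI:
  assumes "subgroup N G" "t \<in> carrier G"
    and "\<And>n. n \<in> N \<Longrightarrow> conj_by G t n \<in> N" "\<And>n. n \<in> N \<Longrightarrow> conj_by G (inv t) n \<in> N"
  shows "cyc_ext G N t {n \<otimes> t [^] i | n (i::int). n \<in> N}"
  using assms by (simp add: cyc_ext_def)

lemma cyc_ext_generate:
  assumes "S \<subseteq> carrier G" "t \<in> carrier G"
    and "\<And>n. n \<in> generate G S \<Longrightarrow> conj_by G t n \<in> generate G S"
    and "\<And>n. n \<in> generate G S \<Longrightarrow> conj_by G (inv t) n \<in> generate G S"
  shows "cyc_ext G (generate G S) t (generate G (insert t S))"
proof -
  let ?H = "{n \<otimes> t [^] i | n (i::int). n \<in> generate G S}"
  have c: "cyc_ext G (generate G S) t ?H"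
    using cyc_extI[OF generate_is_subgroup[OF assms(1)] assms(2-)] .
  have "?H \<subseteq> generate G (insert t S)"
    using assms mono_generate[OF subset_insertI, of S t]
    by (intro cyc_ext_least[OF c]) (simp_all add: generate_is_subgroup generate.incl)
  moreover have "generate G (insert t S) \<subseteq> ?H"
    using cyc_ext_subset[OF c] by (intro generate_subgroup_incl cyc_ext_subgroup[OF c]) (auto intro: generate.incl)
  ultimately show ?thesis using c by auto
qed

end

lemma int_subgroup_cyclic:
  fixes J :: "int set"
  assumes "0 \<in> J" "\<And>i j. i \<in> J \<Longrightarrow> j \<in> J \<Longrightarrow> i - j \<in> J"
  obtains m where "J = {m * k | k. True}"
proof -
  have neg: "- i \<in> J" if "i \<in> J" for i using assms(2)[OF assms(1) that] by simp
  have add: "i + j \<in> J" if "i \<in> J" "j \<in> J" for i j using assms(2)[OF that(1) neg[OF that(2)]] by simp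
  have mult: "m * k \<in> J" if "m \<in> J" for m k
  proof (induction k rule: int_induct[of _ 0])
    case base show ?case using assms(1) by simp
  next
    case (step1 i) then show ?case using add[OF step1(2) that] by (simp add: distrib_left)
  next
    case (step2 i) then show ?case using assms(2)[OF step2(2) that] by (simp add: right_diff_distrib)
  qed
  show thesis
  proof (cases "J = {0}")
    case True then show ?thesis using that[of 0] by auto
  next
    case False
    then obtain j where "j \<in> J" "j \<noteq> 0" using assms(1) by auto
    then have "\<exists>n::nat. n > 0 \<and> int n \<in> J"
      using neg[of j] by (intro exI[of _ "nat \<bar>j\<bar>"]) (auto simp: abs_if)
    then obtain n where n: "n > 0" "int n \<in> J" "\<And>k. k < n \<Longrightarrow> k > 0 \<Longrightarrow> int k \<notin> J"
      using exists_least_iff[of "\<lambda>n. n > 0 \<and> int n \<in> J"] by auto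
    have "i \<in> {int n * k | k. True}" if i: "i \<in> J" for i
    proof -
      have "i mod int n = i - int n * (i div int n)" by (simp add: minus_mult_div_eq_mod)
      then have r: "i mod int n \<in> J" using assms(2)[OF i mult[OF n(2)]] by simp
      have b: "0 \<le> i mod int n" "i mod int n < int n" using n(1) by auto
      have "i mod int n = 0"
      proof (rule ccontr)
        assume "i mod int n \<noteq> 0"
        then have "0 < i mod int n" using b by linarith
        then show False using n(3)[of "nat (i mod int n)"] r b by (simp add: nat_less_iff)
      qed
      then show ?thesis by (auto simp: mod_eq_0_iff_dvd dvd_def)
    qed
    then show ?thesis using mult[OF n(2)] that[of "int n"] by blast
  qed
qed

text \<open>The value \<open>m = 0\<close> covers the case in which no nonzero power of
  \<open>t\<close> lies in \<open>N\<close>, since \<open>0 dvd i\<close> means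
  \<open>i = 0\<close>. Finite and infinite cyclic quotients thus share one statement.\<close>

lemma (in group) int_pow_mem_subgroup:
  assumes "subgroup N G" "t \<in> carrier G"
  obtains m where "\<And>i::int. t [^] i \<in> N \<longleftrightarrow> m dvd i"
proof -
  obtain m where m: "{i::int. t [^] i \<in> N} = {m * k | k. True}"
  proof (rule int_subgroup_cyclic[of "{i::int. t [^] i \<in> N}"])
    show "0 \<in> {i::int. t [^] i \<in> N}" using subgroup.one_closed[OF assms(1)] by simp
    show "i - j \<in> {i::int. t [^] i \<in> N}" if "i \<in> {i. t [^] i \<in> N}" "j \<in> {i. t [^] i \<in> N}" for i j
      using that subgroup.m_closed[OF assms(1)] subgroup.m_inv_closed[OF assms(1)] int_pow_diff[OF assms(2)]
      by simp
  qed auto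
  have "t [^] i \<in> N \<longleftrightarrow> m dvd i" for i :: int using m unfolding dvd_def by blast
  then show thesis by (rule that)
qed

section \<open>Groups without free subsemigroups\<close>

primrec word :: "('a, 'b) monoid_scheme \<Rightarrow> 'a \<Rightarrow> 'a \<Rightarrow> bool list \<Rightarrow> 'a" where
  "word G a b [] = \<one>\<^bsub>G\<^esub>"
| "word G a b (c # u) = (if c then a else b) \<otimes>\<^bsub>G\<^esub> word G a b u"

text \<open>If this fails, some \<open>a\<close> and \<open>b\<close> give \<open>2 ^ k\<close>
  different values on the words of length \<open>k\<close>, for every \<open>k\<close>; this is the
  growth used later. Equality of lengths also makes the powers of \<open>t\<close> cancel when words
  in \<open>x \<otimes> t\<close> and \<open>t\<close> are compared.\<close>

definition no_free_semigroup :: "('a, 'b) monoid_scheme \<Rightarrow> 'a set \<Rightarrow> bool" where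
  "no_free_semigroup G H \<longleftrightarrow> (\<forall>a\<in>H. \<forall>b\<in>H. \<exists>u v. length u = length v \<and> u \<noteq> v \<and>
     word G a b u = word G a b v)"

definition fin_gen :: "('a, 'b) monoid_scheme \<Rightarrow> 'a set \<Rightarrow> bool" where
  "fin_gen G H \<longleftrightarrow> (\<exists>S. finite S \<and> S \<subseteq> carrier G \<and> H = generate G S)"

lemma no_free_semigroup_mono: "no_free_semigroup G H \<Longrightarrow> K \<subseteq> H \<Longrightarrow> no_free_semigroup G K"
  unfolding no_free_semigroup_def by blast

context group
begin

lemma word_closed [simp]: "a \<in> carrier G \<Longrightarrow> b \<in> carrier G \<Longrightarrow> word G a b u \<in> carrier G"
  by (induction u) auto

lemma word_append:
  "a \<in> carrier G \<Longrightarrow> b \<in> carrier G \<Longrightarrow> word G a b (u @ v) = word G a b u \<otimes> word G a b v"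
  by (induction u) (auto simp: m_assoc)

text \<open>Pushing every \<open>t\<close> to the right turns a letter \<open>x \<otimes> t\<close>
  in position \<open>i\<close>, counted from 0, into the factor
  \<open>conj_by G (t [^] i) x\<close>, and a letter \<open>t\<close> into nothing.\<close>

lemma word_eq_conj_pow:
  assumes "x \<in> carrier G" "t \<in> carrier G"
  shows "\<exists>h \<in> generate G ((\<lambda>i. conj_by G (t [^] i) x) ` {..<length u}).
           word G (x \<otimes> t) t u = h \<otimes> t [^] length u"
proof (induction u rule: rev_induct)
  case Nil then show ?case using generate.one by force
next
  case (snoc c u)
  let ?S = "\<lambda>n. (\<lambda>i. conj_by G (t [^] i) x) ` {..<n::nat}"
  let ?n = "length u"
  obtain h where h: "h \<in> generate G (?S ?n)" "word G (x \<otimes> t) t u = h \<otimes> t [^] ?n"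
    using snoc by blast
  have hc: "h \<in> carrier G" using assms by (intro generate_in_carrier[OF _ h(1)]) auto
  have h': "h \<in> generate G (?S (Suc ?n))" using h(1) mono_generate[OF image_mono, of "{..<?n}" "{..<Suc ?n}"] by auto
  show ?case
  proof (cases c)
    case True
    have "word G (x \<otimes> t) t (u @ [c]) = (h \<otimes> conj_by G (t [^] ?n) x) \<otimes> t [^] Suc ?n"
      using assms hc h(2) True by (simp add: word_append conj_by_def m_assoc)
    moreover have "h \<otimes> conj_by G (t [^] ?n) x \<in> generate G (?S (Suc ?n))"
      using h' by (intro generate.eng) (auto intro: generate.incl)
    ultimately show ?thesis by auto
  next
    case False
    then have "word G (x \<otimes> t) t (u @ [c]) = h \<otimes> t [^] Suc ?n"
      using assms hc h(2) by (simp add: word_append m_assoc)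
    then show ?thesis using h' by auto
  qed
qed

text \<open>
  Milnor's lemma.  Two different words in \<open>xt\<close> and \<open>t\<close> with the same value, stripped of their common
  suffix, express some \<open>t\<^sup>k x t\<^sup>-\<^sup>k\<close> through the earlier conjugates; conjugation by \<open>t\<close> propagates this
  to all later ones.
\<close>

lemma conj_pow_in_generate_nat:
  assumes C: "no_free_semigroup G H" and H: "subgroup H G" and "x \<in> H" "t \<in> H"
  obtains k where "\<And>n::nat. conj_by G (t [^] n) x \<in> generate G ((\<lambda>i. conj_by G (t [^] i) x) ` {..<k::nat})"
proof -
  have c: "x \<in> carrier G" "t \<in> carrier G" using subgroup.mem_carrier[OF H] assms(3,4) by auto
  let ?S = "\<lambda>n. (\<lambda>i. conj_by G (t [^] i) x) ` {..<n::nat}"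
  have sc: "?S n \<subseteq> carrier G" for n using c by auto
  \<comment> \<open>Since \<open>p\<close> and \<open>q\<close> have equal length, both sides end in
    the same power of \<open>t\<close>. After cancelling it, the conjugate with index
    \<open>length p\<close> is a quotient of products of conjugates with smaller index.\<close>
  have key: "conj_by G (t [^] length p) x \<in> generate G (?S (length p))"
    if len: "length p = length q"
      and eq: "word G (x \<otimes> t) t (p @ True # r) = word G (x \<otimes> t) t (q @ False # r)" for p q r
  proof -
    let ?n = "length p"
    obtain h where h: "h \<in> generate G (?S ?n)" "word G (x \<otimes> t) t p = h \<otimes> t [^] ?n"
      using word_eq_conj_pow[OF c] by blast
    obtain h' where h': "h' \<in> generate G (?S ?n)" "word G (x \<otimes> t) t q = h' \<otimes> t [^] ?n"
      using word_eq_conj_pow[OF c, of q] unfolding len[symmetric] by blast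
    have hc: "h \<in> carrier G" "h' \<in> carrier G" using h h' generate_in_carrier[OF sc] by auto
    have "word G (x \<otimes> t) t p \<otimes> (x \<otimes> t) = word G (x \<otimes> t) t q \<otimes> t"
      using eq c by (simp add: word_append m_assoc[symmetric])
    then have "h \<otimes> (t [^] ?n \<otimes> x) = h' \<otimes> t [^] ?n"
      using c hc by (simp add: h h' m_assoc[symmetric])
    moreover have "h \<otimes> conj_by G (t [^] ?n) x = (h \<otimes> (t [^] ?n \<otimes> x)) \<otimes> inv (t [^] ?n)"
      using c hc by (simp add: conj_by_def m_assoc)
    ultimately have "h \<otimes> conj_by G (t [^] ?n) x = h'"
      using c hc by (simp add: m_assoc)
    then have "conj_by G (t [^] ?n) x = inv h \<otimes> h'"
      using c hc by auto
    then show ?thesis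
      using h h' by (auto intro!: generate.eng generate_m_inv_closed[OF sc])
  qed
  obtain u v where uv: "length u = length v" "u \<noteq> v" "word G (x \<otimes> t) t u = word G (x \<otimes> t) t v"
    using C assms(3,4) subgroup.m_closed[OF H] unfolding no_free_semigroup_def by blast
  \<comment> \<open>Reversal turns the common prefix found by \<open>same_length_different\<close>
    into a common suffix, which can be cancelled. The parts before the differing letters are
    unrelated except for their length.\<close>
  obtain pre a us b vs where d: "a \<noteq> b" "rev u = pre @ [a] @ us" "rev v = pre @ [b] @ vs"
    using same_length_different[of "rev u" "rev v"] uv by auto
  have u: "u = rev us @ a # rev pre" and v: "v = rev vs @ b # rev pre"
    using d(2,3) by (metis append.assoc append_Cons append_Nil rev_append rev_rev_ident rev_singleton_conv)+
  have l: "length (rev us) = length (rev vs)" using uv(1) u v by simp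
  have "\<exists>k. conj_by G (t [^] k) x \<in> generate G (?S k)"
  proof (cases a)
    case True
    then show ?thesis using key[OF l, of "rev pre"] uv(3) u v d(1) by auto
  next
    case False
    then show ?thesis using key[OF l[symmetric], of "rev pre"] uv(3) u v d(1) by auto
  qed
  then obtain k where k: "conj_by G (t [^] k) x \<in> generate G (?S k)" by blast
  have sub: "generate G (?S (Suc k)) \<subseteq> generate G (?S k)"
  proof (intro generate_subgroup_incl generate_is_subgroup sc subsetI)
    fix y assume "y \<in> ?S (Suc k)"
    then have "y \<in> ?S k \<or> y = conj_by G (t [^] k) x" by (auto simp: less_Suc_eq)
    then show "y \<in> generate G (?S k)" using k generate.incl by metis
  qed
  \<comment> \<open>Conjugation by \<open>t\<close> raises all indices by one, so the only new
    generator is the one with index \<open>k\<close>, which \<open>sub\<close> absorbs.\<close>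
  have "conj_by G (t [^] n) x \<in> generate G (?S k)" for n :: nat
  proof (induction n)
    case 0
    have "x \<in> generate G (?S (Suc k))"
      using c by (intro generate.incl image_eqI[of _ _ 0]) auto
    then show ?case using sub c by auto
  next
    case (Suc n)
    have s: "conj_by G (t [^] Suc i) x = conj_by G t (conj_by G (t [^] i) x)" for i
      using c nat_pow_Suc2[OF c(2), of i] by (subst conj_by_conj_by) auto
    have "conj_by G (t [^] Suc n) x \<in> generate G (conj_by G t ` ?S k)"
      using conj_by_generate[OF sc c(2) Suc] s by simp
    also have "conj_by G t ` ?S k \<subseteq> ?S (Suc k)"
    proof
      fix y assume "y \<in> conj_by G t ` ?S k"
      then obtain i where "i < k" "y = conj_by G t (conj_by G (t [^] i) x)" by auto
      then show "y \<in> ?S (Suc k)" using s[of i] by (intro image_eqI[of _ _ "Suc i"]) auto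
    qed
    ultimately show ?case using sub mono_generate by blast
  qed
  then show thesis using that by blast
qed

lemma conj_int_pow_in_generate:
  assumes C: "no_free_semigroup G H" and H: "subgroup H G" and "x \<in> H" "t \<in> H"
  obtains F where "finite F" "F \<subseteq> range (\<lambda>i::int. conj_by G (t [^] i) x)"
    "\<And>i::int. conj_by G (t [^] i) x \<in> generate G F"
proof -
  have c: "x \<in> carrier G" "t \<in> carrier G" using subgroup.mem_carrier[OF H] assms(3,4) by auto
  obtain k where k: "\<And>n::nat. conj_by G (t [^] n) x \<in> generate G ((\<lambda>i. conj_by G (t [^] i) x) ` {..<k::nat})"
    using conj_pow_in_generate_nat[OF assms] by blast
  obtain l where l: "\<And>n::nat. conj_by G (inv t [^] n) x \<in> generate G ((\<lambda>i. conj_by G (inv t [^] i) x) ` {..<l::nat})"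
    using conj_pow_in_generate_nat[OF assms(1-3) subgroup.m_inv_closed[OF H assms(4)]] by blast
  have p: "t [^] n = t [^] (int n)" "inv t [^] n = t [^] (- int n)" for n :: nat
    using c by (simp_all add: int_pow_int int_pow_neg_int nat_pow_inv)
  let ?F1 = "(\<lambda>i. conj_by G (t [^] i) x) ` {..<k}" and ?F2 = "(\<lambda>i. conj_by G (inv t [^] i) x) ` {..<l::nat}"
  show thesis
  proof (rule that[of "?F1 \<union> ?F2"])
    show "?F1 \<union> ?F2 \<subseteq> range (\<lambda>i::int. conj_by G (t [^] i) x)"
    proof -
      have "conj_by G (t [^] n) x \<in> range (\<lambda>i::int. conj_by G (t [^] i) x)"
        "conj_by G (inv t [^] n) x \<in> range (\<lambda>i::int. conj_by G (t [^] i) x)" for n :: nat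
        by (subst p, rule rangeI)+
      then show ?thesis by (intro Un_least image_subsetI)
    qed
    fix i :: int
    show "conj_by G (t [^] i) x \<in> generate G (?F1 \<union> ?F2)"
    proof (cases i rule: int_cases2)
      case (nonneg n)
      then show ?thesis using k[of n] mono_generate[of ?F1 "?F1 \<union> ?F2"] by (auto simp: p)
    next
      case (nonpos n)
      then show ?thesis using l[of n] mono_generate[of ?F2 "?F1 \<union> ?F2"] by (auto simp: p)
    qed
  qed auto
qed

text \<open>\<open>N\<close> is generated by the conjugates, under powers of \<open>t\<close>, of
  the \<open>N\<close>-parts of generators of \<open>H\<close>, together with a generator
  \<open>t [^] m\<close> of the powers of \<open>t\<close> in \<open>N\<close>. Milnor's lemma,
  applied to \<open>t\<close> and \<open>inv t\<close>, reduces each infinite family of conjugates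
  to a finite one.\<close>

lemma cyc_ext_fin_gen:
  assumes ext: "cyc_ext G N t H" and C: "no_free_semigroup G H" and fg: "fin_gen G H"
  shows "fin_gen G N"
proof -
  note D = cyc_extD[OF ext]
  have sH: "subgroup H G" by (rule cyc_ext_subgroup[OF ext])
  have NH: "N \<subseteq> H" and tH: "t \<in> H" using cyc_ext_subset[OF ext] by auto
  obtain S where S: "finite S" "S \<subseteq> carrier G" "H = generate G S" using fg by (auto simp: fin_gen_def)
  have "\<forall>s\<in>S. \<exists>n. n \<in> N \<and> (\<exists>i::int. s = n \<otimes> t [^] i)"
    using S(3) generate.incl cyc_ext_elem[OF ext] by metis
  then obtain f where f: "\<And>s. s \<in> S \<Longrightarrow> f s \<in> N" "\<And>s. s \<in> S \<Longrightarrow> \<exists>i::int. s = f s \<otimes> t [^] i"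
    by metis
  have "\<forall>s\<in>S. \<exists>F. finite F \<and> F \<subseteq> range (\<lambda>i::int. conj_by G (t [^] i) (f s)) \<and>
      (\<forall>i::int. conj_by G (t [^] i) (f s) \<in> generate G F)"
    using conj_int_pow_in_generate[OF C sH _ tH] f(1) NH by (metis subsetD)
  then obtain F where F: "\<And>s. s \<in> S \<Longrightarrow> finite (F s)"
      "\<And>s. s \<in> S \<Longrightarrow> F s \<subseteq> range (\<lambda>i::int. conj_by G (t [^] i) (f s))"
      "\<And>s i. s \<in> S \<Longrightarrow> conj_by G (t [^] (i::int)) (f s) \<in> generate G (F s)"
    by metis
  obtain m where m: "\<And>i::int. t [^] i \<in> N \<longleftrightarrow> m dvd i"
    using int_pow_mem_subgroup[OF D(1,2)] by blast
  let ?U = "insert (t [^] m) (\<Union>s\<in>S. F s)"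
  let ?K = "generate G ?U"
  let ?V = "insert (t [^] m) (\<Union>s\<in>S. range (\<lambda>i::int. conj_by G (t [^] i) (f s)))"
  have tm: "t [^] m \<in> N" by (simp add: m)
  have UN: "?U \<subseteq> N"
    using tm F(2) f(1) cyc_ext_conj_pow[OF ext] by fastforce
  have Uc: "?U \<subseteq> carrier G" using UN D by blast
  have sK: "subgroup ?K G" by (rule generate_is_subgroup[OF Uc])
  have KN: "?K \<subseteq> N" by (rule generate_subgroup_incl[OF UN D(1)])
  have VK: "?V \<subseteq> ?K"
  proof
    fix y assume "y \<in> ?V"
    then consider "y = t [^] m" | s i where "s \<in> S" "y = conj_by G (t [^] (i::int)) (f s)" by blast
    then show "y \<in> ?K"
    proof cases
      case 1 then show ?thesis using generate.incl[of y ?U G] by simp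
    next
      case 2
      then have "generate G (F s) \<subseteq> ?K" by (intro mono_generate) blast
      then show ?thesis using F(3)[OF 2(1)] 2(2) by blast
    qed
  qed
  \<comment> \<open>\<open>?V\<close> generates the same subgroup as the finite set
    \<open>?U\<close>, and conjugation by \<open>t\<close> or \<open>inv t\<close> maps
    \<open>?V\<close> into itself.\<close>
  have conj: "conj_by G u y \<in> ?K" if u: "u = t \<or> u = inv t" and y: "y \<in> ?K" for u y
  proof -
    obtain e :: int where e: "u = t [^] e"
      using u D(2) by (metis int_pow_1 int_pow_neg)
    have uc: "u \<in> carrier G" using u D by auto
    have "conj_by G u y \<in> generate G (conj_by G u ` ?U)"
      by (rule conj_by_generate[OF Uc uc y])
    moreover have "conj_by G u ` ?U \<subseteq> ?V"
    proof
      fix z assume "z \<in> conj_by G u ` ?U"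
      then consider "z = conj_by G u (t [^] m)"
        | s and i::int where "s \<in> S" "z = conj_by G u (conj_by G (t [^] i) (f s))"
        using F(2) by blast
      then show "z \<in> ?V"
      proof cases
        case 1
        have "z = t [^] (e + m + (- e))"
          unfolding 1 e conj_by_def using D by (simp only: int_pow_mult int_pow_neg int_pow_closed)
        then show ?thesis by simp
      next
        case 2
        then have "z = conj_by G (t [^] (e + i)) (f s)"
          using D f(1) unfolding e by (subst (asm) conj_by_conj_by) (auto simp: int_pow_mult)
        then show ?thesis using 2 by blast
      qed
    qed
    ultimately show ?thesis
      using generate_subgroup_incl[OF VK sK] mono_generate[of "conj_by G u ` ?U" ?V] by blast
  qed
  have ext': "cyc_ext G ?K t (generate G (insert t ?U))"
    using conj by (intro cyc_ext_generate Uc D) auto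
  have Ssub: "S \<subseteq> generate G (insert t ?U)"
  proof
    fix s assume s: "s \<in> S"
    have "f s = conj_by G (t [^] (0::int)) (f s)" using f(1)[OF s] D by auto
    then have "f s \<in> ?K" using VK s by blast
    then show "s \<in> generate G (insert t ?U)" using f(2)[OF s] cyc_ext_memI[OF ext'] by metis
  qed
  \<comment> \<open>Writing \<open>n = y \<otimes> t [^] i\<close> with \<open>y\<close> in
    \<open>?K\<close> puts \<open>t [^] i\<close> into \<open>N\<close>, hence among the powers of
    \<open>t [^] m\<close>, which lie in \<open>?K\<close>.\<close>
  have "N \<subseteq> ?K"
  proof
    fix n assume n: "n \<in> N"
    then have "n \<in> generate G (insert t ?U)"
      using NH S(3) generate_subgroup_incl[OF Ssub cyc_ext_subgroup[OF ext']] by blast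
    then obtain y i where y: "y \<in> ?K" "n = y \<otimes> t [^] (i::int)" using cyc_ext_elem[OF ext'] by blast
    have yN: "y \<in> N" using y KN by blast
    then have "t [^] i = inv y \<otimes> n" using y D by auto
    then have "t [^] i \<in> N" using yN n by (simp add: subgroup.m_closed[OF D(1)] subgroup.m_inv_closed[OF D(1)])
    then obtain k where "i = m * k" unfolding m by (elim dvdE)
    then have "t [^] i = (t [^] m) [^] k" using D by (simp add: int_pow_pow)
    then have "t [^] i \<in> ?K" using VK subgroup_int_pow_closed[OF sK] by simp
    then show "n \<in> ?K" using y subgroup.m_closed[OF sK] by simp
  qed
  then show ?thesis unfolding fin_gen_def using Uc S(1) F(1) KN by (intro exI[of _ ?U]) auto
qed

end

section \<open>Polycyclic groups\<close>

inductive cyc_chain :: "('a, 'b) monoid_scheme \<Rightarrow> 'a set \<Rightarrow> 'a set \<Rightarrow> bool"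
  for G N where
  base: "subgroup N G \<Longrightarrow> cyc_chain G N N"
| step: "cyc_chain G N H \<Longrightarrow> cyc_ext G H t H' \<Longrightarrow> cyc_chain G N H'"

abbreviation polycyclic :: "('a, 'b) monoid_scheme \<Rightarrow> 'a set \<Rightarrow> bool" where
  "polycyclic G H \<equiv> cyc_chain G {\<one>\<^bsub>G\<^esub>} H"

text \<open>\<open>H\<close> is covered by finitely many left cosets of \<open>K\<close>.
  Representatives are used instead of a set of cosets, so that the notion passes easily between
  \<open>G\<close> and a subgroup taken as a group of its own.\<close>

definition fin_index :: "('a, 'b) monoid_scheme \<Rightarrow> 'a set \<Rightarrow> 'a set \<Rightarrow> bool" where
  "fin_index G K H \<longleftrightarrow> (\<exists>R. finite R \<and> R \<subseteq> H \<and> (\<forall>h\<in>H. \<exists>r\<in>R. inv\<^bsub>G\<^esub> r \<otimes>\<^bsub>G\<^esub> h \<in> K))"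

lemma cyc_chain_trans:
  assumes "cyc_chain G N K" "cyc_chain G K H"
  shows "cyc_chain G N H"
  using assms(2,1) by induction (auto intro: cyc_chain.intros)

context group
begin

lemma cyc_chain_fin_gen:
  assumes "cyc_chain G N H" "no_free_semigroup G H" "fin_gen G H"
  shows "fin_gen G N"
  using assms
proof induction
  case (step H t H')
  have "H \<subseteq> H'" using cyc_ext_subset[OF step(2)] by simp
  then show ?case using step cyc_ext_fin_gen no_free_semigroup_mono by blast
qed auto

text \<open>The commutator of \<open>t\<close> and \<open>y\<close> already lies in
  \<open>B\<close>; so every subgroup between \<open>derived G L\<close> and \<open>L\<close> is
  normal in \<open>L\<close>.\<close>

lemma derived_conj_by:
  assumes L: "subgroup L G" and B: "subgroup B G" "derived G L \<subseteq> B" "B \<subseteq> L" and "t \<in> L" "y \<in> B"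
  shows "conj_by G t y \<in> B"
proof -
  have c: "t \<in> carrier G" "y \<in> carrier G" "y \<in> L" using assms subgroup.subset[OF L] by auto
  have "t \<otimes> y \<otimes> inv t \<otimes> inv y \<in> derived G L"
    unfolding derived_def using assms(5) c by (intro generate.incl) auto
  then have "(t \<otimes> y \<otimes> inv t \<otimes> inv y) \<otimes> y \<in> B" using B(2) assms(6) subgroup.m_closed[OF B(1)] by auto
  then show ?thesis using c by (simp add: conj_by_def m_assoc)
qed

text \<open>The elements of \<open>S\<close> are adjoined one at a time, and every intermediate
  subgroup is normal in \<open>L\<close> because it contains the derived subgroup. \<open>S\<close>
  need not generate \<open>L\<close>: the proof of amenability uses arbitrary finite
  subsets.\<close>

lemma cyc_chain_derived:
  assumes L: "subgroup L G" and "finite S" "S \<subseteq> L"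
  shows "cyc_chain G (derived G L) (generate G (derived G L \<union> S))"
  using assms(2,3)
proof induction
  case empty
  have "subgroup (derived G L) G" using derived_is_subgroup[OF subgroup.subset[OF L]] .
  then show ?case
    using generateI[of "derived G L" "derived G L"] by (simp add: cyc_chain.base)
next
  case (insert t S)
  let ?S = "derived G L \<union> S"
  have SL: "?S \<subseteq> L" using insert derived_incl[OF subset_refl L] by blast
  then have Sc: "?S \<subseteq> carrier G" using subgroup.subset[OF L] by blast
  have g: "subgroup (generate G ?S) G" "derived G L \<subseteq> generate G ?S" "generate G ?S \<subseteq> L"
    using generate_is_subgroup[OF Sc] generate_subgroup_incl[OF SL L] by (auto intro: generate.incl)
  have "t \<in> L" "inv t \<in> L" using insert subgroup.m_inv_closed[OF L] by auto
  then have "cyc_ext G (generate G ?S) t (generate G (insert t ?S))"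
    using subgroup.subset[OF L] by (intro cyc_ext_generate Sc derived_conj_by[OF L g]) auto
  then show ?case using insert cyc_chain.step by fastforce
qed

text \<open>Induction on the derived length. A finitely generated \<open>L\<close> is reached from
  its derived subgroup by finitely many cyclic extensions, and descending them with
  \<open>cyc_ext_fin_gen\<close> shows that the derived subgroup is finitely generated too.\<close>

theorem solvable_polycyclic:
  assumes "subgroup L G" "(derived G ^^ n) L = {\<one>}" "no_free_semigroup G L" "fin_gen G L"
  shows "polycyclic G L"
  using assms
proof (induction n arbitrary: L)
  case 0
  then show ?case using cyc_chain.base[of L G] by simp
next
  case (Suc n)
  let ?D = "derived G L"
  obtain S where S: "finite S" "S \<subseteq> carrier G" "L = generate G S" using Suc(5) by (auto simp: fin_gen_def)
  have D: "subgroup ?D G" "?D \<subseteq> L" using derived_is_subgroup[OF subgroup.subset[OF Suc(2)]] derived_incl[OF subset_refl Suc(2)] by auto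
  have SL: "S \<subseteq> L" using S by (auto intro: generate.incl)
  have "generate G (?D \<union> S) = L"
  proof
    show "generate G (?D \<union> S) \<subseteq> L" using D SL Suc(2) by (intro generate_subgroup_incl) auto
    show "L \<subseteq> generate G (?D \<union> S)" unfolding S(3) by (intro mono_generate) auto
  qed
  then have ch: "cyc_chain G ?D L" using cyc_chain_derived[OF Suc(2) S(1) SL] by simp
  have "polycyclic G ?D"
  proof (rule Suc.IH[OF D(1)])
    show "(derived G ^^ n) ?D = {\<one>}" using Suc(3) by (simp add: funpow_swap1)
    show "no_free_semigroup G ?D" using no_free_semigroup_mono[OF Suc(4) D(2)] .
    show "fin_gen G ?D" using cyc_chain_fin_gen[OF ch Suc(4,5)] .
  qed
  then show ?case using cyc_chain_trans[OF _ ch] by blast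
qed

section \<open>Subgroups and finite index in polycyclic groups\<close>

lemma cyc_ext_pow:
  assumes ext: "cyc_ext G N t H" and "n \<in> N"
  shows "\<exists>n'\<in>N. (n \<otimes> t [^] (m::int)) [^] (k::int) = n' \<otimes> t [^] (m * k)"
proof -
  note D = cyc_extD[OF ext]
  let ?h = "n \<otimes> t [^] m"
  have c: "n \<in> carrier G" "?h \<in> carrier G" using D assms(2) by auto
  have inv: "inv ?h = conj_by G (t [^] (-m)) (inv n) \<otimes> t [^] (-m)"
    using c D by (simp add: conj_by_def m_assoc inv_mult_group int_pow_neg)
  have inv': "conj_by G (t [^] (-m)) (inv n) \<in> N"
    using cyc_ext_conj_pow[OF ext] subgroup.m_inv_closed[OF D(1)] assms(2) by blast
  show ?thesis
  proof (induction k rule: int_induct[of _ 0])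
    case base
    then show ?case using subgroup.one_closed[OF D(1)] by (intro bexI[of _ \<one>]) auto
  next
    case (step1 k)
    then obtain n' where n': "n' \<in> N" "?h [^] k = n' \<otimes> t [^] (m * k)" by auto
    have "?h [^] (k + 1) = (n' \<otimes> t [^] (m * k)) \<otimes> (n \<otimes> t [^] m)"
      using c n' by (simp add: int_pow_mult)
    then show ?case
      unfolding cyc_ext_mult[OF ext n'(1) assms(2)] using n' assms(2) cyc_ext_conj_pow[OF ext] subgroup.m_closed[OF D(1)]
      by (auto simp: distrib_left)
  next
    case (step2 k)
    then obtain n' where n': "n' \<in> N" "?h [^] k = n' \<otimes> t [^] (m * k)" by auto
    have "?h [^] (k - 1) = ?h [^] k \<otimes> inv ?h"
      using int_pow_diff[OF c(2), of k 1] c(2) by simp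
    then have "?h [^] (k - 1) = (n' \<otimes> t [^] (m * k)) \<otimes> (conj_by G (t [^] (-m)) (inv n) \<otimes> t [^] (-m))"
      using inv n' by simp
    then show ?case
      unfolding cyc_ext_mult[OF ext n'(1) inv'] using n' inv' cyc_ext_conj_pow[OF ext] subgroup.m_closed[OF D(1)]
      by (auto simp: right_diff_distrib)
  qed
qed

text \<open>The exponents of \<open>t\<close> occurring in elements of \<open>L\<close> form a
  subgroup generated by some \<open>m\<close>. An element \<open>n0 \<otimes> t [^] m\<close> of
  \<open>L\<close> then generates \<open>L\<close> modulo \<open>L \<inter> H\<close>, so
  intersecting the series with \<open>L\<close> gives a series of the same kind.\<close>

lemma polycyclic_subgroup:
  assumes "polycyclic G H" "subgroup L G" "L \<subseteq> H"
  shows "polycyclic G L"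
  using assms
proof (induction arbitrary: L)
  case base
  then have "L = {\<one>}" using subgroup.one_closed[OF base(2)] by blast
  then show ?case using cyc_chain.base[OF base(1)] by simp
next
  case (step H t H')
  note ext = step(2)
  note D = cyc_extD[OF ext]
  have sM: "subgroup (L \<inter> H) G" using subgroups_Inter_pair[OF step(4) D(1)] .
  have pM: "polycyclic G (L \<inter> H)" using step.IH[OF sM] by blast
  obtain m where m: "{i::int. \<exists>n\<in>H. n \<otimes> t [^] i \<in> L} = {m * k | k. True}"
  proof (rule int_subgroup_cyclic[of "{i::int. \<exists>n\<in>H. n \<otimes> t [^] i \<in> L}"])
    show "0 \<in> {i::int. \<exists>n\<in>H. n \<otimes> t [^] i \<in> L}"
      using subgroup.one_closed[OF D(1)] subgroup.one_closed[OF step(4)]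
      by (intro CollectI bexI[of _ \<one>]) auto
    fix i j :: int assume "i \<in> {i. \<exists>n\<in>H. n \<otimes> t [^] i \<in> L}" "j \<in> {i. \<exists>n\<in>H. n \<otimes> t [^] i \<in> L}"
    then obtain n n' where n: "n \<in> H" "n \<otimes> t [^] i \<in> L" and n': "n' \<in> H" "n' \<otimes> t [^] j \<in> L" by blast
    have c: "n \<in> carrier G" "n' \<in> carrier G" using n n' D by auto
    have i': "inv n' \<in> H" using n' subgroup.m_inv_closed[OF D(1)] by auto
    have "(n \<otimes> t [^] i) \<otimes> inv (n' \<otimes> t [^] j) = (n \<otimes> conj_by G (t [^] (i - j)) (inv n')) \<otimes> t [^] (i - j)"
      using c D by (simp add: conj_by_def m_assoc inv_mult_group int_pow_diff)
    moreover have "(n \<otimes> t [^] i) \<otimes> inv (n' \<otimes> t [^] j) \<in> L"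
      using n n' subgroup.m_closed[OF step(4)] subgroup.m_inv_closed[OF step(4)] by auto
    moreover have "n \<otimes> conj_by G (t [^] (i - j)) (inv n') \<in> H"
      using n i' cyc_ext_conj_pow[OF ext] subgroup.m_closed[OF D(1)] by blast
    ultimately show "i - j \<in> {i. \<exists>n\<in>H. n \<otimes> t [^] i \<in> L}" by auto
  qed
  have "m \<in> {i::int. \<exists>n\<in>H. n \<otimes> t [^] i \<in> L}" unfolding m by (auto intro: exI[of _ 1])
  then obtain n0 where n0: "n0 \<in> H" "n0 \<otimes> t [^] m \<in> L" by blast
  define h where "h = n0 \<otimes> t [^] m"
  have hL: "h \<in> L" "inv h \<in> L" using n0 subgroup.m_inv_closed[OF step(4)] by (auto simp: h_def)
  then have hH: "h \<in> H'" "inv h \<in> H'" "h \<in> carrier G" using step(5) subgroup.subset[OF step(4)] by auto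
  have "cyc_ext G (L \<inter> H) h L"
    unfolding cyc_ext_def
  proof (intro conjI ballI sM)
    show "h \<in> carrier G" by fact
    fix n assume "n \<in> L \<inter> H"
    then show "conj_by G h n \<in> L \<inter> H" "conj_by G (inv h) n \<in> L \<inter> H"
      using hL hH cyc_ext_normal[OF ext] conj_by_subgroup[OF step(4)] by auto
  next
    show "L = {n \<otimes> h [^] i |n (i::int). n \<in> L \<inter> H}"
    proof safe
      fix l assume l: "l \<in> L"
      then obtain n i where n: "n \<in> H" "l = n \<otimes> t [^] (i::int)" using step(5) cyc_ext_elem[OF ext] by blast
      then obtain k where k: "i = m * k" using l m by blast
      obtain n' where n': "n' \<in> H" "h [^] k = n' \<otimes> t [^] (m * k)"
        using cyc_ext_pow[OF ext n0(1)] unfolding h_def by blast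
      have c: "n \<in> carrier G" "n' \<in> carrier G" "l \<in> carrier G" using n n' D l subgroup.subset[OF step(4)] by auto
      have "l = (n \<otimes> inv n') \<otimes> h [^] k"
        using c D unfolding n(2) n'(2) k by (simp add: m_assoc)
      moreover from this have "n \<otimes> inv n' = l \<otimes> inv (h [^] k)"
        using c hH by (simp add: m_assoc)
      then have "n \<otimes> inv n' \<in> L"
        using l hL subgroup_int_pow_closed[OF step(4)] subgroup.m_closed[OF step(4)] subgroup.m_inv_closed[OF step(4)] by auto
      moreover have "n \<otimes> inv n' \<in> H" using n n' subgroup.m_closed[OF D(1)] subgroup.m_inv_closed[OF D(1)] by blast
      ultimately show "\<exists>n i. l = n \<otimes> h [^] (i::int) \<and> n \<in> L \<inter> H" by blast
    next
      fix n and i :: int assume "n \<in> L" "n \<in> H"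
      then show "n \<otimes> h [^] i \<in> L"
        using hL subgroup_int_pow_closed[OF step(4)] subgroup.m_closed[OF step(4)] by auto
    qed
  qed
  then show ?case by (rule cyc_chain.step[OF pM])
qed

lemma polycyclic_fin_gen:
  assumes "polycyclic G H"
  shows "fin_gen G H"
  using assms
proof induction
  case base
  have "generate G {} = {\<one>}" using generateI[OF base, of "{}"] subgroup.one_closed by fastforce
  then show ?case unfolding fin_gen_def by (intro exI[of _ "{}"]) auto
next
  case (step H t H')
  then obtain S where S: "finite S" "S \<subseteq> carrier G" "H = generate G S" by (auto simp: fin_gen_def)
  note D = cyc_extD[OF step(2)]
  have "cyc_ext G (generate G S) t (generate G (insert t S))"
    using D S by (intro cyc_ext_generate) auto
  then have "H' = generate G (insert t S)" using step(2) S by (simp add: cyc_ext_def)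
  then show ?case unfolding fin_gen_def using S D by (intro exI[of _ "insert t S"]) auto
qed

text \<open>The representatives are \<open>t [^] i \<otimes> r\<close> with
  \<open>0 \<le> i < m\<close>: the exponent of \<open>t\<close> is divided by \<open>m\<close>, the
  remainder is moved to the left past the \<open>H\<close>-part, and what is left on the right is a
  power of \<open>t [^] m\<close>.\<close>

lemma fin_index_cyc_ext:
  assumes ext: "cyc_ext G H t H'" and fi: "fin_index G N H" and m: "(m::nat) > 0"
    and K: "subgroup K G" "N \<subseteq> K" "t [^] m \<in> K"
  shows "fin_index G K H'"
proof -
  note D = cyc_extD[OF ext]
  obtain R where R: "finite R" "R \<subseteq> H" "\<And>h. h \<in> H \<Longrightarrow> \<exists>r\<in>R. inv r \<otimes> h \<in> N"
    using fi unfolding fin_index_def by blast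
  let ?R = "(\<lambda>(i, r). t [^] (i::int) \<otimes> r) ` ({0..<int m} \<times> R)"
  have "\<exists>r\<in>?R. inv r \<otimes> h \<in> K" if hH': "h \<in> H'" for h
  proof -
    obtain n i where n: "n \<in> H" "h = n \<otimes> t [^] (i::int)" using cyc_ext_elem[OF ext hH'] by blast
    define i0 q where "i0 = i mod int m" and "q = i div int m"
    have i: "i = i0 + int m * q" by (simp add: i0_def q_def)
    have i0: "i0 \<in> {0..<int m}" using m by (simp add: i0_def)
    define n' where "n' = conj_by G (t [^] (- i0)) n"
    have n': "n' \<in> H" using n cyc_ext_conj_pow[OF ext] by (simp add: n'_def)
    obtain r where r: "r \<in> R" "inv r \<otimes> n' \<in> N" using R(3)[OF n'] by blast
    have c: "n \<in> carrier G" "n' \<in> carrier G" "r \<in> carrier G" using n n' r R D by auto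
    have "inv (t [^] i0 \<otimes> r) \<otimes> h = (inv r \<otimes> n') \<otimes> t [^] (int m * q)"
      using c D unfolding n(2) n'_def i
      by (simp add: conj_by_def m_assoc inv_mult_group int_pow_neg int_pow_mult)
    also have "t [^] (int m * q) = (t [^] m) [^] q" using D by (simp add: int_pow_pow[symmetric] int_pow_int)
    finally have "inv (t [^] i0 \<otimes> r) \<otimes> h \<in> K" 
      using r(2) K(2) subgroup.m_closed[OF K(1)] subgroup_int_pow_closed[OF K(1,3)] by auto
    then show ?thesis using i0 r(1) by force
  qed
  moreover have "?R \<subseteq> H'"
    using R(2) cyc_ext_subset[OF ext] subgroup_int_pow_closed[OF cyc_ext_subgroup[OF ext], of t]
      subgroup.m_closed[OF cyc_ext_subgroup[OF ext]] by auto
  ultimately show ?thesis unfolding fin_index_def using R(1) by (intro exI[of _ ?R]) auto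
qed

text \<open>Containing all \<open>k\<close>-th powers is inherited by the intersection of
  \<open>K\<close> with each term of the series; in each cyclic step \<open>t [^] k \<in> K\<close>
  leaves only \<open>k\<close> exponents to represent.\<close>

lemma polycyclic_fin_index:
  assumes "polycyclic G H" "subgroup K G" "K \<subseteq> H" "(k::nat) > 0" "\<And>h. h \<in> H \<Longrightarrow> h [^] k \<in> K"
  shows "fin_index G K H"
  using assms
proof (induction arbitrary: K)
  case base
  then show ?case unfolding fin_index_def using subgroup.one_closed[OF base(2)]
    by (intro exI[of _ "{\<one>}"]) auto
next
  case (step H t H')
  note ext = step(2)
  note D = cyc_extD[OF ext]
  have "fin_index G (K \<inter> H) H"
  proof (rule step.IH)
    show "subgroup (K \<inter> H) G" using subgroups_Inter_pair[OF step(4) D(1)] .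
    fix h assume h: "h \<in> H"
    then have "h [^] k \<in> K" using step(7) cyc_ext_subset[OF ext] by blast
    moreover have "h [^] (int k) \<in> H" using subgroup_int_pow_closed[OF D(1) h] .
    then have "h [^] k \<in> H" by (simp add: int_pow_int)
    ultimately show "h [^] k \<in> K \<inter> H" by blast
  qed (use step in auto)
  then show ?case
    using step(7) cyc_ext_subset(2)[OF ext]
    by (intro fin_index_cyc_ext[OF ext _ step(6) step(4)]) auto
qed

end

section \<open>Homomorphic images\<close>

context group_hom
begin

lemma hom_conj_by:
  "t \<in> carrier G \<Longrightarrow> x \<in> carrier G \<Longrightarrow> h (conj_by G t x) = conj_by H (h t) (h x)"
  by (simp add: conj_by_def)

lemma cyc_ext_hom:
  assumes "cyc_ext G N t K"
  shows "cyc_ext H (h ` N) (h t) (h ` K)"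
proof -
  note D = G.cyc_extD[OF assms]
  have "h (conj_by G t n) = conj_by H (h t) (h n)" "h (conj_by G (inv t) n) = conj_by H (inv\<^bsub>H\<^esub> (h t)) (h n)"
    if "n \<in> N" for n using that D by (auto simp: hom_conj_by subset_iff)
  note c = this
  have K: "K = {n \<otimes> t [^] i | n (i::int). n \<in> N}" using assms by (simp add: cyc_ext_def)
  have m: "h (n \<otimes> t [^] (i::int)) = h n \<otimes>\<^bsub>H\<^esub> h t [^]\<^bsub>H\<^esub> i" if "n \<in> N" for n i
    using that D by (auto simp: hom_int_pow subset_iff)
  show ?thesis
    unfolding cyc_ext_def
  proof (intro conjI ballI)
    show "subgroup (h ` N) H" by (rule subgroup_img_is_subgroup[OF D(1)])
    show "h t \<in> carrier H" using D by simp
    fix y assume "y \<in> h ` N"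
    then obtain n where n: "n \<in> N" "y = h n" by blast
    show "conj_by H (h t) y \<in> h ` N"
      unfolding n(2) c(1)[OF n(1), symmetric] by (rule imageI) (rule D(4)[OF n(1)])
    show "conj_by H (inv\<^bsub>H\<^esub> h t) y \<in> h ` N"
      unfolding n(2) c(2)[OF n(1), symmetric] by (rule imageI) (rule D(5)[OF n(1)])
  next
    show "h ` K = {n \<otimes>\<^bsub>H\<^esub> h t [^]\<^bsub>H\<^esub> i | n (i::int). n \<in> h ` N}"
    proof (intro equalityI subsetI)
      fix y assume "y \<in> h ` K"
      then obtain n i where "n \<in> N" "y = h (n \<otimes> t [^] (i::int))" unfolding K by blast
      then show "y \<in> {n \<otimes>\<^bsub>H\<^esub> h t [^]\<^bsub>H\<^esub> i | n (i::int). n \<in> h ` N}" using m by blast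
    next
      fix y assume "y \<in> {n \<otimes>\<^bsub>H\<^esub> h t [^]\<^bsub>H\<^esub> i | n (i::int). n \<in> h ` N}"
      then obtain n i where "n \<in> N" "y = h n \<otimes>\<^bsub>H\<^esub> h t [^]\<^bsub>H\<^esub> (i::int)" by blast
      then show "y \<in> h ` K" using m unfolding K by (intro image_eqI[of _ _ "n \<otimes> t [^] i"]) auto
    qed
  qed
qed

lemma cyc_chain_hom:
  assumes "cyc_chain G N K"
  shows "cyc_chain H (h ` N) (h ` K)"
  using assms
proof induction
  case base
  then show ?case by (intro cyc_chain.base subgroup_img_is_subgroup)
next
  case (step K t K')
  then show ?case using cyc_chain.step cyc_ext_hom by metis
qed

lemma word_hom:
  "a \<in> carrier G \<Longrightarrow> b \<in> carrier G \<Longrightarrow> h (word G a b u) = word H (h a) (h b) u"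
  by (induction u) auto

lemma no_free_semigroup_hom:
  assumes "no_free_semigroup G K" "K \<subseteq> carrier G"
  shows "no_free_semigroup H (h ` K)"
  unfolding no_free_semigroup_def
proof safe
  fix a b assume "a \<in> K" "b \<in> K"
  then obtain u v where "length u = length v" "u \<noteq> v" "word G a b u = word G a b v"
    using assms(1) unfolding no_free_semigroup_def by blast
  moreover have "word H (h a) (h b) w = h (word G a b w)" for w
    using word_hom[of a b w] assms(2) \<open>a \<in> K\<close> \<open>b \<in> K\<close> by (simp add: subset_iff)
  ultimately show "\<exists>u v. length u = length v \<and> u \<noteq> v \<and> word H (h a) (h b) u = word H (h a) (h b) v"
    by (intro exI[of _ u] exI[of _ v]) simp
qed

end

section \<open>Integer polynomials\<close>

definition ceval :: "int poly \<Rightarrow> complex \<Rightarrow> complex" where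
  "ceval p = poly (map_poly of_int p)"

lemma ceval_0 [simp]: "ceval 0 z = 0"
  by (simp add: ceval_def)

lemma ceval_pCons [simp]: "ceval (pCons a p) z = of_int a + z * ceval p z"
  by (simp add: ceval_def map_poly_pCons)

lemma ceval_add [simp]: "ceval (p + q) z = ceval p z + ceval q z"
  by (induction p q rule: poly_induct2) (auto simp: algebra_simps)

lemma ceval_smult [simp]: "ceval (smult c p) z = of_int c * ceval p z"
  by (induction p) (auto simp: algebra_simps)

lemma ceval_mult [simp]: "ceval (p * q) z = ceval p z * ceval q z"
  by (induction p) (auto simp: algebra_simps)

lemma ceval_pcompose: "ceval (pcompose p q) z = ceval p (ceval q z)"
  by (induction p) (auto simp: pcompose_pCons)

text \<open>In Horner form the bound reproduces itself: if the inner value has norm at least 1, then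
  multiplying by \<open>z\<close> gives at least 2, and the coefficient takes away at most
  1.\<close>

lemma sign_poly_no_large_root:
  fixes p :: "int poly" and z :: complex
  assumes "p \<noteq> 0" "\<And>i. coeff p i \<in> {-1, 0, 1}" "norm z \<ge> 2"
  shows "norm (ceval p z) \<ge> 1"
  using assms(1,2)
proof (induction p)
  case (pCons a q)
  have a: "a \<in> {-1, 0, 1}" using pCons(4)[of 0] by simp
  have c: "coeff q i \<in> {-1, 0, 1}" for i using pCons(4)[of "Suc i"] by simp
  have e: "ceval (pCons a q) z = of_int a + z * ceval q z" by simp
  show ?case
  proof (cases "q = 0")
    case True then show ?thesis using a pCons(1) e by auto
  next
    case False
    then have "norm (ceval q z) \<ge> 1" using pCons c by blast
    then have "norm z * norm (ceval q z) \<ge> 2 * 1"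
      using assms(3) by (intro mult_mono) auto
    moreover have "norm (of_int a :: complex) \<le> 1" using a by auto
    ultimately show ?thesis
      unfolding e using norm_diff_ineq[of "z * ceval q z" "of_int a"]
      by (simp add: norm_mult add.commute)
  qed
qed auto

lemma norm_prod_mset:
  fixes f :: "'a \<Rightarrow> complex"
  shows "norm (\<Prod>x\<in>#A. f x) = (\<Prod>x\<in>#A. norm (f x))"
  by (induction A) (auto simp: norm_mult)

text \<open>The product of the roots has the absolute value of the constant coefficient, a nonzero
  integer, so the roots cannot all lie in the open unit disc.\<close>

lemma int_poly_large_root:
  fixes g :: "int poly"
  assumes "\<bar>lead_coeff g\<bar> = 1" "coeff g 0 \<noteq> 0" "degree g > 0"
  obtains z :: complex where "ceval g z = 0" "norm z \<ge> 1"
proof -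
  let ?g = "map_poly of_int g :: complex poly"
  have g0: "?g \<noteq> 0" using assms(2) by (auto simp: poly_eq_iff coeff_map_poly)
  obtain A where A: "size A = degree ?g" "?g = smult (lead_coeff ?g) (\<Prod>x\<in>#A. [:-x, 1:])"
    using alg_closed_imp_factorization[OF g0] by blast
  have deg: "degree ?g = degree g" by (rule degree_map_poly) auto
  then have l: "norm (lead_coeff ?g) = 1" using assms(1) by (simp add: coeff_map_poly)
  have eq: "norm (poly ?g 0) = (\<Prod>x\<in>#A. norm x)"
    by (subst A(2)) (use l in \<open>simp add: norm_mult poly_prod_mset norm_prod_mset\<close>)
  have "norm (poly ?g 0) = real_of_int \<bar>coeff g 0\<bar>" by (simp add: poly_0_coeff_0 coeff_map_poly)
  then have ge: "(\<Prod>x\<in>#A. norm x) \<ge> 1" using eq assms(2) by linarith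
  have "\<exists>x\<in>#A. norm x \<ge> 1"
  proof (rule ccontr)
    assume n: "\<not> (\<exists>x\<in>#A. norm x \<ge> 1)"
    have "B \<noteq> {#} \<Longrightarrow> (\<And>x. x \<in># B \<Longrightarrow> norm x < 1) \<Longrightarrow> (\<Prod>x\<in>#B. norm x) < 1" for B :: "complex multiset"
    proof (induction B)
      case (add x B)
      show ?case
      proof (cases "B = {#}")
        case False
        then have "(\<Prod>x\<in>#B. norm x) < 1" using add by auto
        then have "norm x * (\<Prod>x\<in>#B. norm x) \<le> norm x * 1" by (intro mult_left_mono) auto
        also have "\<dots> < 1" using add(3)[of x] by simp
        finally show ?thesis by simp
      qed (use add in auto)
    qed auto
    moreover have "A \<noteq> {#}" using A(1) assms(3) deg by auto
    ultimately show False using ge n by (metis not_less)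
  qed
  then obtain x where x: "x \<in># A" "norm x \<ge> 1" by blast
  have "poly ?g x = 0"
    by (subst A(2)) (use x(1) in \<open>auto simp: poly_prod_mset prod_mset_zero_iff\<close>)
  then show thesis using that x(2) by (simp add: ceval_def)
qed

lemma poly_strip_X:
  fixes p :: "'a::idom poly"
  assumes "p \<noteq> 0"
  obtains a q where "p = monom 1 a * q" "coeff q 0 \<noteq> 0"
  using assms
proof (induction p arbitrary: thesis)
  case (pCons c p)
  show ?case
  proof (cases "c = 0")
    case True
    then obtain a q where "p = monom 1 a * q" "coeff q 0 \<noteq> 0" using pCons by auto
    then show ?thesis using pCons(3)[of "Suc a" q] True by (simp add: monom_Suc)
  next
    case False then show ?thesis using pCons(3)[of 0 "pCons c p"] by (simp add: monom_0)
  qed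
qed auto

text \<open>Makes \<open>X\<close> invertible modulo \<open>I\<close>: cancelling \<open>X\<close>
  from the relation until the constant coefficient is \<open>1\<close> or \<open>-1\<close> leaves,
  up to sign, \<open>1\<close> minus a multiple of \<open>X\<close>.\<close>

lemma one_minus_X_mult_in_ideal:
  fixes I :: "int poly set"
  assumes mult: "\<And>p r. p \<in> I \<Longrightarrow> r * p \<in> I"
    and cancel: "\<And>p. pCons 0 p \<in> I \<Longrightarrow> p \<in> I"
    and "p \<in> I" "p \<noteq> 0" "\<And>i. coeff p i \<in> {-1, 0, 1}"
  shows "\<exists>s. 1 - pCons 0 s \<in> I"
  using assms(3-)
proof (induction p)
  case (pCons a q)
  have a: "a \<in> {-1, 0, 1}" using pCons(5)[of 0] by simp
  have c: "coeff q i \<in> {-1, 0, 1}" for i using pCons(5)[of "Suc i"] by simp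
  show ?case
  proof (cases "a = 0")
    case True
    then show ?thesis using pCons c cancel by auto
  next
    case False
    then have "[:a:] * pCons a q = 1 - pCons 0 (- smult a q)" using a by (auto simp: one_pCons)
    then show ?thesis using mult[OF pCons(3), of "[:a:]"] by metis
  qed
qed auto

lemma pcompose_diff_in_ideal:
  fixes I :: "'a::comm_ring_1 poly set"
  assumes add: "\<And>p q. p \<in> I \<Longrightarrow> q \<in> I \<Longrightarrow> p + q \<in> I"
    and mult: "\<And>p r. p \<in> I \<Longrightarrow> r * p \<in> I"
    and ab: "a - b \<in> I"
  shows "pcompose p a - pcompose p b \<in> I"
proof (induction p)
  case 0 then show ?case using mult[OF ab, of 0] by simp
next
  case (pCons c p)
  have "pcompose (pCons c p) a - pcompose (pCons c p) b
      = a * (pcompose p a - pcompose p b) + pcompose p b * (a - b)"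
    by (simp add: pcompose_pCons algebra_simps)
  then show ?case using add mult ab pCons by metis
qed

lemma pcompose_monom: "pcompose (monom c n) w = smult c (w ^ n)"
  by (induction n) (auto simp: monom_0 monom_Suc pcompose_pCons)

lemma diff_dvd_power_diff:
  fixes a b :: "'a::comm_ring_1"
  shows "a - b dvd a ^ n - b ^ n"
proof (induction n)
  case (Suc n)
  have "a ^ Suc n - b ^ Suc n = a * (a ^ n - b ^ n) + (a - b) * b ^ n" by (simp add: algebra_simps)
  then show ?case using Suc by (metis dvd_add dvd_mult dvd_triv_left)
qed auto

text \<open>
  The last three hypotheses say that \<open>X\<close> satisfies many relations with small coefficients modulo
  \<open>I\<close> (this bounds the size of its conjugates), that every element of \<open>\<int>[X]/I\<close> is integral,
  and that \<open>X\<close> has finite order modulo \<open>I\<close> and 3.  So \<open>X\<^sup>m = 1 + 3 w\<close> for some \<open>m > 0\<close>.  If \<open>w\<close> were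
  not nilpotent up to torsion, it would have a conjugate \<open>\<mu>\<close> with \<open>\<bar>\<mu>\<bar> \<ge> 1\<close>, and \<open>\<bar>1 + 3 \<mu>\<bar> \<ge> 2\<close> contradicts
  the small relations.
\<close>

lemma unipotent_mod_ideal:
  fixes I :: "int poly set"
  assumes add: "\<And>p q. p \<in> I \<Longrightarrow> q \<in> I \<Longrightarrow> p + q \<in> I"
    and mult: "\<And>p r. p \<in> I \<Longrightarrow> r * p \<in> I"
    and cancel: "\<And>p. pCons 0 p \<in> I \<Longrightarrow> p \<in> I"
    and small: "\<And>m::nat. m > 0 \<Longrightarrow>
      \<exists>p. p \<noteq> 0 \<and> (\<forall>i. coeff p i \<in> {-1, 0, 1}) \<and> pcompose p (monom 1 m) \<in> I"
    and integral: "\<And>w. \<exists>P. lead_coeff P = 1 \<and> pcompose P w \<in> I"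
    and mod3: "\<exists>i j w. i < j \<and> monom 1 i - monom 1 j - smult 3 w \<in> I"
  shows "\<exists>c m a. c \<noteq> 0 \<and> m > 0 \<and> smult c ((monom 1 m - 1) ^ a) \<in> I"
proof -
  have smult: "smult c p \<in> I" if "p \<in> I" for c p using mult[OF that, of "[:c:]"] by simp
  have diff: "p - q \<in> I" if "p \<in> I" "q \<in> I" for p q
    using add[OF that(1) smult[OF that(2), of "-1"]] by simp
  have dvd: "q \<in> I" if "p \<in> I" "p dvd q" for p q
    using mult[OF that(1)] that(2) by (metis dvdE mult.commute)
  obtain s where s: "1 - pCons 0 s \<in> I"
    using small[of 1] one_minus_X_mult_in_ideal[OF mult cancel] by (auto simp: monom_Suc monom_0)
  obtain i j w where ij: "i < j" "monom 1 i - monom 1 j - smult 3 w \<in> I" using mod3 by blast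
  define m where "m = j - i"
  have m: "m > 0" "monom (1::int) j = monom 1 i * monom 1 m" using ij(1) by (auto simp: m_def mult_monom)
  define u where "u = pCons 0 s"
  have X: "monom (1::int) i = [:0, 1:] ^ i" by (simp add: monom_altdef)
  have u: "u ^ i = s ^ i * monom 1 i"
    unfolding X power_mult_distrib[symmetric] by (simp add: u_def mult.commute)
  have ui: "1 - u ^ i \<in> I"
    using dvd[OF s] diff_dvd_power_diff[of 1 u i] by (simp add: u_def)
  \<comment> \<open>Modulo \<open>I\<close> the polynomial \<open>s\<close> is inverse to
    \<open>X\<close>; multiplying the relation between \<open>monom 1 i\<close> and
    \<open>monom 1 j\<close> by \<open>s ^ i\<close> gives \<open>X^m = 1 + 3 w'\<close>.\<close>
  define w' where "w' = - (s ^ i * w)"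
  have "s ^ i * (monom 1 i - monom 1 j - smult 3 w) + (1 - monom 1 m) * (1 - u ^ i) \<in> I"
    by (intro add mult ij ui)
  also have "s ^ i * (monom 1 i - monom 1 j - smult 3 w) + (1 - monom 1 m) * (1 - u ^ i)
      = smult (-1) (monom 1 m - (1 + smult 3 w'))"
    unfolding u m(2) w'_def by (simp add: algebra_simps)
  finally have "smult (-1) (smult (-1) (monom 1 m - (1 + smult 3 w'))) \<in> I" by (rule smult)
  then have w': "monom 1 m - (1 + smult 3 w') \<in> I" by simp
  \<comment> \<open>The annihilating polynomials of \<open>w'\<close>. This ideal need not be
    principal over the integers, so an element \<open>f\<close> of least degree is compared with the
    others by pseudo-division, up to powers of its leading coefficient.\<close>
  define J where "J = {P. pcompose P w' \<in> I}"
  obtain P where P: "lead_coeff P = 1" "P \<in> J" using integral[of w'] by (auto simp: J_def)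
  have "P \<in> J \<and> P \<noteq> 0" using P by auto
  then obtain f where f: "f \<in> J" "f \<noteq> 0" and fmin: "\<And>h. h \<in> J \<Longrightarrow> h \<noteq> 0 \<Longrightarrow> degree f \<le> degree h"
    using ex_has_least_nat[of "\<lambda>P. P \<in> J \<and> P \<noteq> 0" P degree] by blast
  have dvdf: "\<exists>k q. smult (lead_coeff f ^ k) h = f * q" if "h \<in> J" for h
  proof -
    obtain q r where qr: "pseudo_divmod h f = (q, r)" by fastforce
    obtain k where k: "smult (lead_coeff f ^ k) h = f * q + r" "r = 0 \<or> degree r < degree f"
      using pseudo_divmod[OF f(2) qr] by blast
    have "pcompose r w' = smult (lead_coeff f ^ k) (pcompose h w') - pcompose q w' * pcompose f w'"
      using arg_cong[OF k(1), of "\<lambda>p. pcompose p w'"]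
      by (simp add: pcompose_add pcompose_smult pcompose_mult mult.commute)
    then have "r \<in> J" using that f unfolding J_def by (auto intro!: diff smult mult)
    then have "r = 0" using fmin k(2) by fastforce
    then show ?thesis using k(1) by auto
  qed
  define g where "g = primitive_part f"
  have fg: "f = smult (content f) g" by (simp add: g_def)
  have g0: "g \<noteq> 0" using f(2) fg by auto
  \<comment> \<open>Gauss's lemma. In the relation between the monic \<open>P\<close> and
    \<open>f\<close>, contents give \<open>content f * content q\<close> as the absolute value of
    the power of \<open>lead_coeff f\<close>; leading coefficients give the same product times
    \<open>lead_coeff g * lead_coeff (primitive_part q)\<close>, up to sign. The extra factor is
    therefore a unit.\<close>
  have glead: "\<bar>lead_coeff g\<bar> = 1"
  proof -
    obtain k q where kq: "smult (lead_coeff f ^ k) P = f * q" using dvdf[OF P(2)] by blast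
    have cP: "content P = 1"
    proof -
      have "content P dvd lead_coeff P" by (rule content_dvd_coeff)
      then have "is_unit (content P)" using P(1) by (metis dvd_trans one_dvd)
      then show ?thesis by (simp only: is_unit_content_iff)
    qed
    have "content (smult (lead_coeff f ^ k) P) = content f * content q" unfolding kq content_mult ..
    then have c: "\<bar>lead_coeff f ^ k\<bar> = content f * content q" using cP by simp
    have "lead_coeff f ^ k = lead_coeff f * lead_coeff q"
      using arg_cong[OF kq, of lead_coeff] by (simp only: lead_coeff_smult lead_coeff_mult P(1) mult_1_right)
    also have "\<dots> = (content f * lead_coeff g) * (content q * lead_coeff (primitive_part q))"
      using arg_cong[OF fg, of lead_coeff] arg_cong[OF content_times_primitive_part[of q], of lead_coeff]
      unfolding lead_coeff_smult by metis
    finally have "\<bar>lead_coeff f ^ k\<bar> =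
        \<bar>content f * content q\<bar> * \<bar>lead_coeff g * lead_coeff (primitive_part q)\<bar>"
      by (simp add: abs_mult ac_simps)
    moreover have "lead_coeff f ^ k \<noteq> 0" using f(2) by simp
    ultimately have "\<bar>lead_coeff g * lead_coeff (primitive_part q)\<bar> = 1" using c by auto
    then show ?thesis by (metis abs_mult abs_zmult_eq_1)
  qed
  obtain a g' where g': "g = monom 1 a * g'" "coeff g' 0 \<noteq> 0" using poly_strip_X[OF g0] by blast
  have g'lead: "\<bar>lead_coeff g'\<bar> = 1" using glead by (simp add: g' lead_coeff_mult degree_monom_eq)
  \<comment> \<open>A root of \<open>g'\<close> is a root of every element of \<open>J\<close>. The
    small relation \<open>p\<close> for \<open>X^m\<close> yields the element
    \<open>pcompose p [:1, 3:]\<close> of \<open>J\<close>, so that \<open>1 + 3 * z\<close> would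
    be a root of \<open>p\<close>.\<close>
  have deg: "degree g' = 0"
  proof (rule ccontr)
    assume "degree g' \<noteq> 0"
    then obtain z :: complex where z: "ceval g' z = 0" "norm z \<ge> 1"
      using int_poly_large_root[OF g'lead g'(2)] by auto
    have root: "ceval h z = 0" if "h \<in> J" for h
    proof -
      obtain k q where kq: "smult (lead_coeff f ^ k) h = f * q" using dvdf[OF \<open>h \<in> J\<close>] by blast
      have "ceval f z = 0" by (subst fg) (simp add: g' z)
      then have "of_int (lead_coeff f ^ k) * ceval h z = 0"
        using arg_cong[OF kq, of "\<lambda>p. ceval p z"] by simp
      then show ?thesis using f(2) by simp
    qed
    obtain p where p: "p \<noteq> 0" "\<And>i. coeff p i \<in> {-1, 0, 1}" "pcompose p (monom 1 m) \<in> I"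
      using small[OF m(1)] by blast
    have "pcompose p (monom 1 m) - (pcompose p (monom 1 m) - pcompose p (1 + smult 3 w')) \<in> I"
      by (intro diff p pcompose_diff_in_ideal[OF add mult w'])
    moreover have "1 + smult 3 w' = pcompose [:1, 3:] w'" by (simp add: pcompose_pCons one_pCons)
    ultimately have "pcompose p [:1, 3:] \<in> J" by (simp add: J_def pcompose_assoc)
    then have "ceval p (1 + 3 * z) = 0" using root by (force simp: ceval_pcompose mult.commute)
    moreover have "norm (1 + 3 * z) \<ge> 2"
      using norm_diff_ineq[of "3 * z" 1] z(2) by (simp add: norm_mult add.commute)
    ultimately show False using sign_poly_no_large_root[OF p(1,2)] by force
  qed
  \<comment> \<open>Now \<open>f\<close> is an integer multiple of a power of \<open>X\<close>: some
    integer multiple of a power of \<open>w'\<close> lies in \<open>I\<close>, and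
    \<open>monom 1 m - 1\<close>, congruent to \<open>smult 3 w'\<close>, inherits this.\<close>
  then obtain e where "g' = [:e:]" by (metis degree_eq_zeroE)
  then have "f = smult (content f * e) (monom 1 a)" "e \<noteq> 0"
    using fg g' by (simp_all add: mult.commute smult_monom)
  then have "smult (content f * e) (w' ^ a) \<in> I"
    using f(1) unfolding J_def by (metis mem_Collect_eq pcompose_smult pcompose_monom smult_1_left)
  then have "smult (3 ^ a) (smult (content f * e) (w' ^ a)) \<in> I" by (rule smult)
  then have 1: "smult (content f * e) ((smult 3 w') ^ a) \<in> I" by (simp add: smult_power mult.commute)
  have "(monom 1 m - 1) ^ a - (smult 3 w') ^ a \<in> I"
    using dvd[OF w'] diff_dvd_power_diff[of "monom 1 m - 1" "smult 3 w'" a] by (simp add: algebra_simps)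
  then have "smult (content f * e) ((monom 1 m - 1) ^ a - (smult 3 w') ^ a) + smult (content f * e) ((smult 3 w') ^ a) \<in> I"
    by (intro add smult[of "_ - _"] 1)
  then have "smult (content f * e) ((monom 1 m - 1) ^ a) \<in> I" by (simp add: smult_diff_right)
  moreover have "content f * e \<noteq> 0" using f(2) \<open>e \<noteq> 0\<close> by simp
  ultimately show ?thesis using m(1) by blast
qed

section \<open>Automorphisms of abelian groups as modules over the integer polynomials\<close>

text \<open>The module structure over the integer polynomials on the multiplicatively written group
  \<open>V\<close>, with \<open>X\<close> acting as \<tau>, evaluated by Horner's rule; integer
  scalars act as powers.\<close>

definition poly_act :: "('a, 'b) monoid_scheme \<Rightarrow> ('a \<Rightarrow> 'a) \<Rightarrow> int poly \<Rightarrow> 'a \<Rightarrow> 'a" where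
  "poly_act V \<tau> p x = fold_coeffs (\<lambda>a z. x [^]\<^bsub>V\<^esub> a \<otimes>\<^bsub>V\<^esub> \<tau> z) p \<one>\<^bsub>V\<^esub>"

lemma nat_pigeonhole:
  assumes "finite S" "\<And>i::nat. f i \<in> S"
  obtains i j where "i < j" "f i = f j"
proof -
  have "\<not> inj f" using assms finite_imageD[of f UNIV] finite_subset[of "range f" S] by auto
  then obtain i j where "i \<noteq> j" "f i = f j" by (auto simp: inj_on_def)
  then show thesis using that[of i j] that[of j i] by (metis linorder_neq_iff)
qed

lemma monom_minus_one_dvd: "monom (1::int) k - 1 dvd monom 1 (k * l) - 1"
proof -
  have "monom (1::int) (k * l) = (monom 1 k) ^ l" by (simp add: monom_power)
  then show ?thesis using diff_dvd_power_diff[of "monom (1::int) k" 1 l] by simp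
qed

locale comm_group_endo = comm_group V for V (structure) +
  fixes \<tau> :: "'a \<Rightarrow> 'a"
  assumes tau_hom: "\<tau> \<in> hom V V"
begin

sublocale tau: group_hom V V \<tau>
  by unfold_locales (rule tau_hom)

lemma act_0 [simp]: "poly_act V \<tau> 0 x = \<one>"
  by (simp add: poly_act_def)

lemma act_pCons [simp]:
  "x \<in> carrier V \<Longrightarrow> poly_act V \<tau> (pCons a p) x = x [^] a \<otimes> \<tau> (poly_act V \<tau> p x)"
  by (cases "a = 0 \<and> p = 0") (auto simp: poly_act_def)

lemma act_closed [simp]: "x \<in> carrier V \<Longrightarrow> poly_act V \<tau> p x \<in> carrier V"
  by (induction p) auto

lemma act_one [simp]: "x \<in> carrier V \<Longrightarrow> poly_act V \<tau> 1 x = x"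
  by (simp add: one_pCons)

lemma act_add:
  "x \<in> carrier V \<Longrightarrow> poly_act V \<tau> (p + q) x = poly_act V \<tau> p x \<otimes> poly_act V \<tau> q x"
  by (induction p q rule: poly_induct2) (simp_all add: int_pow_mult m_ac)

lemma act_smult:
  "x \<in> carrier V \<Longrightarrow> poly_act V \<tau> (smult c p) x = poly_act V \<tau> p x [^] c"
  by (induction p) (simp_all add: int_pow_distrib int_pow_pow tau.hom_int_pow mult.commute)

lemma act_diff:
  assumes "x \<in> carrier V"
  shows "poly_act V \<tau> (p - q) x = poly_act V \<tau> p x \<otimes> inv (poly_act V \<tau> q x)"
  using act_add[OF assms, of p "smult (-1) q"] act_smult[OF assms, of "-1" q] assms
  by (simp add: int_pow_neg)

lemma act_mult:
  "x \<in> carrier V \<Longrightarrow> poly_act V \<tau> (p * q) x = poly_act V \<tau> p (poly_act V \<tau> q x)"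
  by (induction p) (simp_all add: act_add act_smult)

lemma tau_pow_closed [simp]: "x \<in> carrier V \<Longrightarrow> (\<tau> ^^ n) x \<in> carrier V"
  by (induction n) auto

lemma act_monom: "x \<in> carrier V \<Longrightarrow> poly_act V \<tau> (monom 1 n) x = (\<tau> ^^ n) x"
  by (induction n) (simp_all add: monom_0 monom_Suc)

lemma act_hom:
  "x \<in> carrier V \<Longrightarrow> y \<in> carrier V \<Longrightarrow>
     poly_act V \<tau> p (x \<otimes> y) = poly_act V \<tau> p x \<otimes> poly_act V \<tau> p y"
  by (induction p) (simp_all add: int_pow_distrib m_ac)

lemma act_group_hom: "group_hom V V (poly_act V \<tau> p)"
  by unfold_locales (auto simp: hom_def act_hom)

lemma funpow_endo: "comm_group_endo V (\<tau> ^^ m)"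
proof unfold_locales
  show "\<tau> ^^ m \<in> hom V V"
  proof (induction m)
    case 0 then show ?case by (auto simp: hom_def)
  next
    case (Suc m) then show ?case using tau_hom by (auto simp: hom_def)
  qed
qed

lemma act_funpow:
  assumes "x \<in> carrier V"
  shows "poly_act V (\<tau> ^^ m) p x = poly_act V \<tau> (pcompose p (monom 1 m)) x"
proof -
  interpret m: comm_group_endo V "\<tau> ^^ m" by (rule funpow_endo)
  show ?thesis
    using assms by (induction p) (simp_all add: pcompose_pCons act_add act_mult act_monom)
qed

lemma act_image_subgroup:
  assumes "x \<in> carrier V" "0 \<in> P" "\<And>p q. p \<in> P \<Longrightarrow> q \<in> P \<Longrightarrow> p + q \<in> P"
    and "\<And>p. p \<in> P \<Longrightarrow> smult (-1) p \<in> P"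
  shows "subgroup ((\<lambda>q. poly_act V \<tau> (pcompose q w) x) ` P) V" (is "subgroup ?W V")
proof
  show "?W \<subseteq> carrier V" using assms by auto
  show "\<one> \<in> ?W" using assms(2) by (intro image_eqI[of _ _ 0]) auto
  fix y z assume "y \<in> ?W"
  then obtain p where p: "y = poly_act V \<tau> (pcompose p w) x" "p \<in> P" by auto
  have "inv y = poly_act V \<tau> (pcompose (smult (-1) p) w) x"
    unfolding p(1) pcompose_smult using assms by (subst act_smult) (auto simp: int_pow_neg)
  then show "inv y \<in> ?W" using assms(4)[OF p(2)] by blast
  assume "z \<in> ?W"
  then obtain q where q: "z = poly_act V \<tau> (pcompose q w) x" "q \<in> P" by auto
  show "y \<otimes> z \<in> ?W"
    using p q assms(1,3) by (intro image_eqI[of _ _ "p + q"]) (auto simp: pcompose_add act_add)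
qed

lemma orbit_subgroup:
  assumes "x \<in> carrier V"
  shows "subgroup (range (\<lambda>q. poly_act V \<tau> (pcompose q w) x)) V"
  using assms by (intro act_image_subgroup) auto

lemma bounded_orbit_subgroup:
  assumes "x \<in> carrier V"
  shows "subgroup ((\<lambda>q. poly_act V \<tau> (pcompose q w) x) ` {q. q = 0 \<or> degree q < k}) V"
  using assms by (intro act_image_subgroup) (auto intro: degree_add_less)

text \<open>The orbit of \<open>x\<close> under all polynomials in \<open>w\<close> is finitely
  generated, and its generators involve only powers of \<open>w\<close> below some \<open>k\<close>.
  Expressing \<open>w^k\<close> applied to \<open>x\<close> through them gives a monic
  relation.\<close>

lemma integral_relation:
  assumes x: "x \<in> carrier V" and fg: "\<And>K. subgroup K V \<Longrightarrow> fin_gen V K"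
  shows "\<exists>P. lead_coeff P = 1 \<and> poly_act V \<tau> (pcompose P w) x = \<one>"
proof -
  let ?f = "\<lambda>q. poly_act V \<tau> (pcompose q w) x"
  obtain F where F: "finite F" "F \<subseteq> carrier V" "range ?f = generate V F"
    using fg[OF orbit_subgroup[OF x, of w]] unfolding fin_gen_def by blast
  have "y \<in> range ?f" if "y \<in> F" for y unfolding F(3) by (rule generate.incl[OF that])
  then have "\<forall>y\<in>F. \<exists>q. y = ?f q" by blast
  then obtain q where q: "\<And>y. y \<in> F \<Longrightarrow> y = ?f (q y)" by metis
  define k where "k = Suc (\<Sum>y\<in>F. degree (q y))"
  let ?W = "?f ` {q. q = 0 \<or> degree q < k}"
  have "F \<subseteq> ?W"
  proof
    fix y assume y: "y \<in> F"
    then have "degree (q y) < k"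
      using member_le_sum[of y F "\<lambda>y. degree (q y)"] F(1) by (simp add: k_def)
    then show "y \<in> ?W" using q[OF y] by blast
  qed
  then have "range ?f \<subseteq> ?W" unfolding F(3) by (intro generate_subgroup_incl bounded_orbit_subgroup x)
  then obtain p where p: "?f (monom 1 k) = ?f p" "p = 0 \<or> degree p < k" by blast
  have dp: "degree (- p) < degree (monom (1::int) k)"
    using p(2) by (auto simp: degree_monom_eq k_def)
  have "lead_coeff (- p + monom 1 k) = 1"
    using lead_coeff_add_le[OF dp] by (simp add: degree_monom_eq)
  moreover have "?f (monom 1 k - p) = \<one>"
    unfolding pcompose_diff using x p(1) by (simp add: act_diff)
  ultimately show ?thesis by (intro exI[of _ "monom 1 k - p"]) simp
qed

text \<open>The cubes form a subgroup of finite index in the orbit module \<open>R\<close> of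
  \<open>x\<close>, so two of the images of \<open>x\<close> under powers of \<tau> lie in the same
  coset. Their quotient is a cube, that is, 3 times a module element in additive terms.\<close>

lemma finite_order_mod_3:
  assumes x: "x \<in> carrier V"
    and fi: "\<And>K L k. subgroup K V \<Longrightarrow> subgroup L V \<Longrightarrow> K \<subseteq> L \<Longrightarrow> (k::nat) > 0 \<Longrightarrow>
      (\<And>h. h \<in> L \<Longrightarrow> h [^] k \<in> K) \<Longrightarrow> fin_index V K L"
  shows "\<exists>i j w. i < j \<and> poly_act V \<tau> (monom 1 i - monom 1 j - smult 3 w) x = \<one>"
proof -
  define R where "R = range (\<lambda>q. poly_act V \<tau> q x)"
  have sR: "subgroup R V" using orbit_subgroup[OF x, of "[:0, 1:]"] by (simp add: R_def)
  have Rc: "R \<subseteq> carrier V" using subgroup.subset[OF sR] .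
  define K where "K = (\<lambda>r. r [^] (3::int)) ` R"
  have KR: "K \<subseteq> R" using subgroup_int_pow_closed[OF sR] by (auto simp: K_def)
  have sK: "subgroup K V"
  proof
    show "K \<subseteq> carrier V" using KR Rc by blast
    show "\<one> \<in> K" using subgroup.one_closed[OF sR] by (auto simp: K_def intro!: image_eqI[of _ _ \<one>])
    fix y z assume "y \<in> K"
    then obtain r where r: "r \<in> R" "y = r [^] (3::int)" by (auto simp: K_def)
    have rc: "r \<in> carrier V" using r Rc by auto
    show "inv y \<in> K" unfolding K_def
      by (rule image_eqI[of _ _ "inv r"]) (use r rc subgroup.m_inv_closed[OF sR] in \<open>auto simp: int_pow_inv\<close>)
    assume "z \<in> K"
    then obtain s where s: "s \<in> R" "z = s [^] (3::int)" by (auto simp: K_def)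
    have sc: "s \<in> carrier V" using s Rc by auto
    show "y \<otimes> z \<in> K" unfolding K_def
      by (rule image_eqI[of _ _ "r \<otimes> s"]) (use r s rc sc subgroup.m_closed[OF sR] in \<open>auto simp: int_pow_distrib\<close>)
  qed
  have "fin_index V K R"
  proof (rule fi[OF sK sR KR, of 3])
    fix h assume "h \<in> R"
    then show "h [^] (3::nat) \<in> K"
      unfolding K_def using int_pow_int[of V h 3] by (intro image_eqI[of _ _ h]) simp_all
  qed simp
  then obtain R0 where R0: "finite R0" "R0 \<subseteq> R" "\<And>h. h \<in> R \<Longrightarrow> \<exists>r\<in>R0. inv r \<otimes> h \<in> K"
    unfolding fin_index_def by blast
  define y where "y i = poly_act V \<tau> (monom 1 i) x" for i
  have yR: "y i \<in> R" for i by (auto simp: y_def R_def)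
  obtain r where r: "\<And>i. r i \<in> R0" "\<And>i. inv (r i) \<otimes> y i \<in> K" using R0(3)[OF yR] by metis
  obtain i j where ij: "i < j" "r i = r j" using nat_pigeonhole[OF R0(1), of r] r(1) by blast
  have c: "r j \<in> carrier V" "y i \<in> carrier V" "y j \<in> carrier V" using r(1) R0(2) Rc yR by blast+
  have "(inv (r j) \<otimes> y i) \<otimes> inv (inv (r j) \<otimes> y j) \<in> K"
    using r(2)[of i] r(2)[of j] subgroup.m_closed[OF sK] subgroup.m_inv_closed[OF sK] ij(2) by simp
  also have "(inv (r j) \<otimes> y i) \<otimes> inv (inv (r j) \<otimes> y j) = y i \<otimes> inv (y j)"
    using c by (simp add: inv_mult_group m_ac)
  finally obtain w where w: "y i \<otimes> inv (y j) = poly_act V \<tau> w x [^] (3::int)"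
    by (auto simp: K_def R_def)
  have "poly_act V \<tau> (monom 1 i - monom 1 j - smult 3 w) x = \<one>"
    using x w by (simp add: act_diff act_smult y_def)
  then show ?thesis using ij(1) by blast
qed

lemma act_eq_one_dvd:
  assumes "x \<in> carrier V" "poly_act V \<tau> p x = \<one>" "p dvd q"
  shows "poly_act V \<tau> q x = \<one>"
proof -
  obtain r where "q = r * p" using assms(3) by (metis dvdE mult.commute)
  then show ?thesis using assms group_hom.hom_one[OF act_group_hom] by (simp add: act_mult)
qed

lemma act_unipotent_mono:
  assumes "x \<in> carrier V" "poly_act V \<tau> ((monom 1 m - 1) ^ a) x = \<one>" "m dvd n" "a \<le> b"
  shows "poly_act V \<tau> ((monom 1 n - 1) ^ b) x = \<one>"
proof -
  have "(monom (1::int) m - 1) ^ a dvd (monom 1 n - 1) ^ b"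
    using assms(3,4) monom_minus_one_dvd by (metis dvdE dvd_power_le)
  then show ?thesis using act_eq_one_dvd assms by blast
qed

text \<open>\<open>unipotent_mod_ideal\<close>, applied to the annihilator of \<open>x\<close>,
  gives unipotence only up to an integer factor \<open>c\<close>. The remaining torsion element
  \<open>z\<close> has a finite orbit, which is removed by enlarging \<open>m\<close> and adding one
  to \<open>a\<close>.\<close>

lemma act_unipotent:
  assumes x: "x \<in> carrier V" and inj: "inj_on \<tau> (carrier V)"
    and small: "\<And>m::nat. m > 0 \<Longrightarrow>
      \<exists>p. p \<noteq> 0 \<and> (\<forall>i. coeff p i \<in> {-1, 0, 1}) \<and> poly_act V (\<tau> ^^ m) p x = \<one>"
    and fg: "\<And>K. subgroup K V \<Longrightarrow> fin_gen V K"
    and fi: "\<And>K L k. subgroup K V \<Longrightarrow> subgroup L V \<Longrightarrow> K \<subseteq> L \<Longrightarrow> (k::nat) > 0 \<Longrightarrow>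
      (\<And>h. h \<in> L \<Longrightarrow> h [^] k \<in> K) \<Longrightarrow> fin_index V K L"
  shows "\<exists>m a. m > 0 \<and> poly_act V \<tau> ((monom 1 m - 1) ^ a) x = \<one>"
proof -
  define I where "I = {p. poly_act V \<tau> p x = \<one>}"
  have "\<exists>c m a. c \<noteq> 0 \<and> m > 0 \<and> smult c ((monom 1 m - 1) ^ a) \<in> I"
  proof (rule unipotent_mod_ideal)
    show "p + q \<in> I" if "p \<in> I" "q \<in> I" for p q using that x by (simp add: I_def act_add)
    show "r * p \<in> I" if "p \<in> I" for p r
      using that x group_hom.hom_one[OF act_group_hom] by (simp add: I_def act_mult)
    show "p \<in> I" if "pCons 0 p \<in> I" for p
    proof -
      have "\<tau> (poly_act V \<tau> p x) = \<tau> \<one>" using that x by (simp add: I_def)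
      then show ?thesis using inj_onD[OF inj] x by (simp add: I_def)
    qed
    show "\<exists>p. p \<noteq> 0 \<and> (\<forall>i. coeff p i \<in> {-1, 0, 1}) \<and> pcompose p (monom 1 m) \<in> I" if "m > 0" for m
      using small[OF that] by (simp add: I_def act_funpow[OF x])
    show "\<exists>P. lead_coeff P = 1 \<and> pcompose P w \<in> I" for w
      using integral_relation[OF x fg] by (simp add: I_def)
    show "\<exists>i j w. i < j \<and> monom 1 i - monom 1 j - smult 3 w \<in> I"
      using finite_order_mod_3[OF x fi] by (simp add: I_def)
  qed
  then obtain c m a where cma: "c \<noteq> 0" "m > 0" "smult c ((monom 1 m - 1) ^ a) \<in> I" by blast
  define z where "z = poly_act V \<tau> ((monom 1 m - 1) ^ a) x"
  have zc: "z \<in> carrier V" using x by (simp add: z_def)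
  define k where "k = nat \<bar>c\<bar>"
  have k: "k > 0" using cma(1) by (simp add: k_def)
  have "z [^] c = \<one>" using cma(3) x by (simp add: I_def act_smult z_def)
  then have zk: "z [^] int k = \<one>" using zc by (auto simp: k_def int_pow_neg abs_if)
  \<comment> \<open>The elements of exponent \<open>k\<close> form a finite subgroup, because the
    trivial subgroup has finite index in it, and \<tau> maps it into itself; so the orbit of
    \<open>z\<close> repeats.\<close>
  define U where "U = {v \<in> carrier V. v [^] int k = \<one>}"
  have sU: "subgroup U V"
    by unfold_locales (auto simp: U_def int_pow_distrib int_pow_inv)
  have "fin_index V {\<one>} U"
  proof (rule fi[OF _ sU _ k])
    show "subgroup {\<one>} V" by unfold_locales auto
    show "{\<one>} \<subseteq> U" by (auto simp: U_def)
    show "h [^] k \<in> {\<one>}" if "h \<in> U" for h using that by (simp add: U_def int_pow_int)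
  qed
  then obtain R0 where R0: "finite R0" "R0 \<subseteq> U" "\<And>h. h \<in> U \<Longrightarrow> \<exists>r\<in>R0. inv r \<otimes> h \<in> {\<one>}"
    unfolding fin_index_def by blast
  have "h \<in> R0" if h: "h \<in> U" for h
  proof -
    obtain r where r: "r \<in> R0" "inv r \<otimes> h = \<one>" using R0(3)[OF h] by blast
    moreover have "h \<in> carrier V" "r \<in> carrier V" using h r(1) R0(2) by (auto simp: U_def)
    moreover have "h = r \<otimes> (inv r \<otimes> h)" using calculation(3,4) by simp
    ultimately have "h = r" by simp
    then show ?thesis using r by simp
  qed
  moreover have "(\<tau> ^^ i) z \<in> U" for i
  proof (induction i)
    case 0 then show ?case using zc zk by (simp add: U_def)
  next
    case (Suc i)
    then have "\<tau> ((\<tau> ^^ i) z) [^] int k = \<tau> \<one>" using zc by (simp add: U_def tau.hom_int_pow[symmetric])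
    then show ?case using zc by (simp add: U_def)
  qed
  ultimately obtain i j where ij: "i < j" "(\<tau> ^^ i) z = (\<tau> ^^ j) z"
    using nat_pigeonhole[OF R0(1), of "\<lambda>i. (\<tau> ^^ i) z"] by blast
  define n where "n = j - i"
  have "(\<tau> ^^ i) ((\<tau> ^^ n) z) = (\<tau> ^^ i) z"
    using ij by (simp add: n_def funpow_add[unfolded o_def, THEN fun_cong, symmetric])
  moreover have "inj_on (\<tau> ^^ i) (carrier V)"
  proof (induction i)
    case (Suc i)
    show ?case
    proof (rule inj_onI)
      fix a b assume "a \<in> carrier V" "b \<in> carrier V" "(\<tau> ^^ Suc i) a = (\<tau> ^^ Suc i) b"
      then show "a = b" using inj_onD[OF inj, of "(\<tau> ^^ i) a" "(\<tau> ^^ i) b"] inj_onD[OF Suc] by simp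
    qed
  qed auto
  ultimately have "(\<tau> ^^ n) z = z" using zc by (auto dest: inj_onD)
  then have "poly_act V \<tau> (monom 1 n - 1) z = \<one>" using zc by (simp add: act_diff act_monom)
  then have in_I: "(monom 1 n - 1) * (monom 1 m - 1) ^ a \<in> I" using x by (simp add: I_def act_mult z_def)
  have n: "n > 0" using ij by (simp add: n_def)
  note d = monom_minus_one_dvd
  \<comment> \<open>Both \<open>X^n - 1\<close> and \<open>X^m - 1\<close> divide
    \<open>X^(n m) - 1\<close>, so the two conditions merge into a single power.\<close>
  have "(monom (1::int) n - 1) * (monom 1 m - 1) ^ a dvd (monom 1 (n * m) - 1) ^ Suc a"
    using d[of n m] d[of m n] by (simp add: mult_dvd_mono dvd_power_same mult.commute)
  then have "poly_act V \<tau> ((monom 1 (n * m) - 1) ^ Suc a) x = \<one>"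
    using act_eq_one_dvd[OF x] in_I by (simp add: I_def del: power_Suc)
  then show ?thesis using n cma(2) by (intro exI[of _ "n * m"] exI[of _ "Suc a"]) simp
qed

end

section \<open>Nilpotent by cyclic groups\<close>

text \<open>The letter in position \<open>i\<close> of a word becomes the coefficient of
  \<open>X^i\<close>; differences of two such polynomials have coefficients in
  \<open>{-1, 0, 1}\<close>.\<close>

primrec bool_poly :: "bool list \<Rightarrow> int poly" where
  "bool_poly [] = 0"
| "bool_poly (c # u) = pCons (of_bool c) (bool_poly u)"

lemma coeff_bool_poly: "coeff (bool_poly u) i \<in> {0, 1}"
  by (induction u arbitrary: i) (auto simp: coeff_pCons split: nat.split)

lemma bool_poly_inject: "length u = length v \<Longrightarrow> bool_poly u = bool_poly v \<Longrightarrow> u = v"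
  by (induction u v rule: list_induct2) auto

context group
begin

lemma fin_gen_subgroup:
  assumes "subgroup H G" "fin_gen G K" "K \<subseteq> H"
  shows "fin_gen (G\<lparr>carrier := H\<rparr>) K"
proof -
  obtain S where S: "finite S" "S \<subseteq> carrier G" "K = generate G S"
    using assms(2) unfolding fin_gen_def by blast
  have "S \<subseteq> H" using assms(3) S(3) generate.incl by (metis subset_eq)
  then show ?thesis
    unfolding fin_gen_def using S generate_consistent[OF _ assms(1)] by (intro exI[of _ S]) simp
qed

lemma fin_index_subgroup:
  assumes "subgroup H G" "fin_index G K L" "L \<subseteq> H"
  shows "fin_index (G\<lparr>carrier := H\<rparr>) K L"
proof -
  obtain R where R: "finite R" "R \<subseteq> L" "\<And>h. h \<in> L \<Longrightarrow> \<exists>r\<in>R. inv r \<otimes> h \<in> K"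
    using assms(2) unfolding fin_index_def by blast
  have "inv\<^bsub>G\<lparr>carrier := H\<rparr>\<^esub> r = inv r" if "r \<in> R" for r
    using that R(2) assms m_inv_consistent[OF assms(1)] by blast
  then show ?thesis unfolding fin_index_def using R by (intro exI[of _ R]) auto
qed

lemma funpow_conj_by:
  assumes "t \<in> carrier G" "x \<in> carrier G"
  shows "(conj_by G t ^^ m) x = conj_by G (t [^] m) x"
proof (induction m)
  case (Suc m)
  then show ?case using assms nat_pow_Suc2[OF assms(1), of m] by (simp add: conj_by_conj_by del: nat_pow_Suc)
qed (use assms in auto)

end

locale abelian_section = group_hom G Q \<phi> for G (structure) and Q (structure) and \<phi> +
  fixes A :: "'a set" and t :: 'a
  assumes sub_A: "subgroup A G" and t_closed: "t \<in> carrier G"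
    and conj_A: "\<And>a. a \<in> A \<Longrightarrow> conj_by G t a \<in> A"
    and conj_inv_A: "\<And>a. a \<in> A \<Longrightarrow> conj_by G (inv t) a \<in> A"
    and comm_A: "\<And>a b. a \<in> A \<Longrightarrow> b \<in> A \<Longrightarrow> \<phi> a \<otimes>\<^bsub>Q\<^esub> \<phi> b = \<phi> b \<otimes>\<^bsub>Q\<^esub> \<phi> a"
    and poly_A: "polycyclic G A"
    and no_free: "no_free_semigroup G (carrier G)"
begin

abbreviation V where "V \<equiv> Q\<lparr>carrier := \<phi> ` A\<rparr>"
abbreviation \<tau> where "\<tau> \<equiv> conj_by Q (\<phi> t)"
abbreviation act where "act \<equiv> poly_act V \<tau>"

lemma A_closed [simp]: "a \<in> A \<Longrightarrow> a \<in> carrier G"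
  using subgroup.subset[OF sub_A] by blast

lemma sub_V: "subgroup (\<phi> ` A) Q"
  by (rule subgroup_img_is_subgroup[OF sub_A])

lemma V_closed [simp]: "x \<in> \<phi> ` A \<Longrightarrow> x \<in> carrier Q"
  using subgroup.subset[OF sub_V] by blast

lemma phi_t_closed [simp]: "\<phi> t \<in> carrier Q"
  using t_closed by simp

lemma tau_V: "x \<in> \<phi> ` A \<Longrightarrow> \<tau> x \<in> \<phi> ` A"
  using t_closed conj_A by (auto simp: hom_conj_by[symmetric])

lemma conj_pow_V:
  assumes "x \<in> \<phi> ` A"
  shows "conj_by Q (\<phi> t [^]\<^bsub>Q\<^esub> (i::int)) x \<in> \<phi> ` A"
proof -
  obtain a where a: "a \<in> A" "x = \<phi> a" using assms by blast
  have "conj_by Q (\<phi> t [^]\<^bsub>Q\<^esub> i) x = \<phi> (conj_by G (t [^] i) a)"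
    using a t_closed by (simp add: hom_conj_by hom_int_pow)
  moreover have "conj_by G (t [^] i) a \<in> A"
    by (rule G.conj_by_int_pow_closed[OF t_closed _ conj_A conj_inv_A a(1)]) auto
  ultimately show ?thesis by blast
qed

lemma comm_group_V: "comm_group V"
proof (rule group.group_comm_groupI)
  show "group V" by (rule H.subgroup_imp_group[OF sub_V])
qed (auto simp: comm_A)

sublocale V: comm_group_endo V \<tau>
proof -
  interpret V: comm_group V by (rule comm_group_V)
  show "comm_group_endo V \<tau>"
    by unfold_locales (auto simp: hom_def tau_V H.conj_by_mult simp del: image_iff)
qed

lemma poly_V: "polycyclic Q (\<phi> ` A)"
  using cyc_chain_hom[OF poly_A] by simp

lemma fin_gen_V: "subgroup K V \<Longrightarrow> fin_gen V K"
  using H.incl_subgroup[OF sub_V, of K] subgroup.subset[of K V]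
  by (intro H.fin_gen_subgroup[OF sub_V] H.polycyclic_fin_gen H.polycyclic_subgroup[OF poly_V]) auto

lemma fin_index_V:
  assumes "subgroup K V" "subgroup L V" "K \<subseteq> L" "(k::nat) > 0" "\<And>h. h \<in> L \<Longrightarrow> h [^]\<^bsub>V\<^esub> k \<in> K"
  shows "fin_index V K L"
proof -
  have s: "subgroup K Q" "subgroup L Q" using H.incl_subgroup[OF sub_V] assms(1,2) by auto
  have L: "L \<subseteq> \<phi> ` A" using subgroup.subset[OF assms(2)] by simp
  show ?thesis
    using assms(3-5) s L H.nat_pow_consistent[of _ k "\<phi> ` A"]
    by (intro H.fin_index_subgroup[OF sub_V] H.polycyclic_fin_index[OF H.polycyclic_subgroup[OF poly_V]]) auto
qed

text \<open>Moving the powers of \<open>\<phi> t\<close> to the right conjugates each remaining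
  \<open>x\<close> according to its position, which is exactly the action of the polynomial of the
  word, with \<open>\<tau> ^^ m\<close> in the role of \<open>X\<close>.\<close>

lemma word_eq_act:
  assumes x: "x \<in> \<phi> ` A"
  shows "word Q (x \<otimes>\<^bsub>Q\<^esub> \<phi> t [^]\<^bsub>Q\<^esub> (m::nat)) (\<phi> t [^]\<^bsub>Q\<^esub> m) u
    = poly_act V (\<tau> ^^ m) (bool_poly u) x \<otimes>\<^bsub>Q\<^esub> (\<phi> t [^]\<^bsub>Q\<^esub> m) [^]\<^bsub>Q\<^esub> length u"
    and "poly_act V (\<tau> ^^ m) (bool_poly u) x \<in> \<phi> ` A"
proof -
  let ?S = "\<phi> t [^]\<^bsub>Q\<^esub> m"
  interpret m: comm_group_endo V "\<tau> ^^ m" by (rule V.funpow_endo)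
  show c: "poly_act V (\<tau> ^^ m) (bool_poly u) x \<in> \<phi> ` A" for u using m.act_closed[of x] x by simp
  show "word Q (x \<otimes>\<^bsub>Q\<^esub> ?S) ?S u = poly_act V (\<tau> ^^ m) (bool_poly u) x \<otimes>\<^bsub>Q\<^esub> ?S [^]\<^bsub>Q\<^esub> length u"
  proof (induction u)
    case Nil then show ?case by simp
  next
    case (Cons b u)
    let ?y = "poly_act V (\<tau> ^^ m) (bool_poly u) x"
    have y: "?y \<in> carrier Q" using c[of u] by simp
    have "?S \<otimes>\<^bsub>Q\<^esub> word Q (x \<otimes>\<^bsub>Q\<^esub> ?S) ?S u = (\<tau> ^^ m) ?y \<otimes>\<^bsub>Q\<^esub> ?S [^]\<^bsub>Q\<^esub> Suc (length u)"
      using y H.nat_pow_Suc2[of ?S "length u"] unfolding Cons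
      by (simp add: H.funpow_conj_by conj_by_def H.m_assoc)
    moreover have "(\<tau> ^^ m) ?y \<in> carrier Q" using y by (simp add: H.funpow_conj_by)
    ultimately show ?case using x by (cases b) (simp_all add: H.m_assoc)
  qed
qed

text \<open>Two different words of equal length with the same value end in the same power of
  \<open>\<phi> t\<close>; cancelling it leaves the difference of their polynomials as a relation.
  It is nonzero because words of a given length are determined by their polynomials.\<close>

lemma small_relation:
  assumes x: "x \<in> \<phi> ` A"
  shows "\<exists>p. p \<noteq> 0 \<and> (\<forall>i. coeff p i \<in> {-1, 0, 1}) \<and> poly_act V (\<tau> ^^ m) p x = \<one>\<^bsub>V\<^esub>"
proof -
  let ?S = "\<phi> t [^]\<^bsub>Q\<^esub> m"
  have "no_free_semigroup Q (\<phi> ` carrier G)" by (rule no_free_semigroup_hom[OF no_free]) simp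
  moreover have "?S \<in> \<phi> ` carrier G"
    using t_closed by (intro image_eqI[of _ _ "t [^] m"]) (auto simp: hom_nat_pow)
  moreover from this have "x \<otimes>\<^bsub>Q\<^esub> ?S \<in> \<phi> ` carrier G"
    using x subgroup.m_closed[OF img_is_subgroup] by (auto simp del: image_iff)
  ultimately obtain u v where uv: "length u = length v" "u \<noteq> v"
      "word Q (x \<otimes>\<^bsub>Q\<^esub> ?S) ?S u = word Q (x \<otimes>\<^bsub>Q\<^esub> ?S) ?S v"
    unfolding no_free_semigroup_def by blast
  interpret m: comm_group_endo V "\<tau> ^^ m" by (rule V.funpow_endo)
  have eq: "poly_act V (\<tau> ^^ m) (bool_poly u) x = poly_act V (\<tau> ^^ m) (bool_poly v) x"
    using uv(3) word_eq_act[OF x, of m] uv(1) by simp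
  show ?thesis
  proof (intro exI[of _ "bool_poly u - bool_poly v"] conjI allI)
    show "bool_poly u - bool_poly v \<noteq> 0" using bool_poly_inject[OF uv(1)] uv(2) by auto
    fix i
    show "coeff (bool_poly u - bool_poly v) i \<in> {-1, 0, 1}"
      using coeff_bool_poly[of u i] coeff_bool_poly[of v i] by auto
  next
    show "poly_act V (\<tau> ^^ m) (bool_poly u - bool_poly v) x = \<one>\<^bsub>V\<^esub>"
      using m.act_diff[of x] V.r_inv m.act_closed[of x] x eq by simp
  qed
qed

lemma inj_tau: "inj_on \<tau> (carrier V)"
  by (rule inj_onI) (simp add: H.conj_by_eq_iff)

text \<open>Exponents for finitely many generators are combined into a product for \<open>m\<close>
  and a sum for \<open>a\<close>; the elements killed by the resulting polynomial form a
  subgroup.\<close>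

lemma uniformly_unipotent:
  obtains m a where "m > 0" "\<And>x. x \<in> \<phi> ` A \<Longrightarrow> act ((monom 1 m - 1) ^ a) x = \<one>\<^bsub>Q\<^esub>"
proof -
  obtain S where S: "finite S" "S \<subseteq> carrier V" "\<phi> ` A = generate V S"
    using fin_gen_V[OF V.subgroup_self] unfolding fin_gen_def by auto
  have "\<forall>x\<in>S. \<exists>m a. m > 0 \<and> act ((monom 1 m - 1) ^ a) x = \<one>\<^bsub>V\<^esub>"
    using V.act_unipotent[OF _ inj_tau small_relation fin_gen_V fin_index_V] S(2) by auto
  then obtain f g where fg: "\<And>x. x \<in> S \<Longrightarrow> f x > 0" "\<And>x. x \<in> S \<Longrightarrow> act ((monom 1 (f x) - 1) ^ g x) x = \<one>\<^bsub>V\<^esub>"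
    by metis
  let ?m = "\<Prod>x\<in>S. f x" and ?a = "\<Sum>x\<in>S. g x"
  let ?K = "{x \<in> carrier V. act ((monom 1 ?m - 1) ^ ?a) x = \<one>\<^bsub>V\<^esub>}"
  interpret h: group_hom V V "act ((monom 1 ?m - 1) ^ ?a)" by (rule V.act_group_hom)
  have "subgroup ?K V" using h.subgroup_kernel by (simp add: kernel_def)
  moreover have "S \<subseteq> ?K"
  proof
    fix x assume x: "x \<in> S"
    then have "f x dvd ?m" "g x \<le> ?a" using S(1) by (auto intro: dvd_prodI member_le_sum)
    then show "x \<in> ?K" using V.act_unipotent_mono[OF _ fg(2)[OF x]] x S(2) by auto
  qed
  ultimately have "generate V S \<subseteq> ?K" by (intro V.generate_subgroup_incl)
  then have "\<phi> ` A \<subseteq> ?K" by (simp only: S(3)[symmetric])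
  then show thesis using that[of ?m ?a] fg(1) by (auto simp: prod_pos)
qed

text \<open>The powers of \<open>X\<^sup>m - 1\<close> cut out a chain of subgroups that is central for \<open>t\<^sup>m\<close>.\<close>

lemma commutator_pow_act:
  assumes x: "x \<in> \<phi> ` A" and D: "D = (monom 1 m - 1) ^ j"
  shows "\<exists>y \<in> \<phi> ` A. conj_by Q (\<phi> t [^]\<^bsub>Q\<^esub> (int m * i)) (act D x) \<otimes>\<^bsub>Q\<^esub> inv\<^bsub>Q\<^esub> act D x
    = act ((monom 1 m - 1) ^ Suc j) y"
proof -
  let ?E = "(monom 1 m - 1) ^ Suc j :: int poly"
  have inv_V: "inv\<^bsub>V\<^esub> y = inv\<^bsub>Q\<^esub> y" if "y \<in> \<phi> ` A" for y
    using H.m_inv_consistent[OF sub_V that] by simp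
  have pos: "\<exists>y \<in> \<phi> ` A. (\<tau> ^^ (m * k)) (act D z) \<otimes>\<^bsub>Q\<^esub> inv\<^bsub>Q\<^esub> act D z = act ?E y"
    if z: "z \<in> \<phi> ` A" for z k
  proof -
    obtain r where r: "monom (1::int) (m * k) - 1 = (monom 1 m - 1) * r"
      using monom_minus_one_dvd[of m k] by blast
    have c: "act D z \<in> carrier V" using V.act_closed z by simp
    have "(\<tau> ^^ (m * k)) (act D z) \<otimes>\<^bsub>Q\<^esub> inv\<^bsub>Q\<^esub> act D z = act (monom 1 (m * k) - 1) (act D z)"
      using c inv_V[of "act D z"] by (simp add: V.act_diff[OF c] V.act_monom[OF c])
    also have "\<dots> = act (?E * r) z"
    proof -
      have "(monom 1 (m * k) - 1) * D = ?E * r" unfolding r D by (simp add: mult_ac)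
      then show ?thesis using z by (simp add: V.act_mult[symmetric])
    qed
    also have "\<dots> = act ?E (act r z)" using z by (subst V.act_mult) simp_all
    finally show ?thesis using V.act_closed[of z r] z by auto
  qed
  have conj_nat: "conj_by Q (\<phi> t [^]\<^bsub>Q\<^esub> (int n)) z = (\<tau> ^^ n) z" if "z \<in> \<phi> ` A" for z n
    using that by (simp add: H.funpow_conj_by int_pow_int)
  show ?thesis
  proof (cases i rule: int_cases2)
    case (nonneg k)
    have e: "int m * i = int (m * k)" by (simp add: nonneg)
    have "act D x \<in> \<phi> ` A" using V.act_closed[of x D] x by simp
    then show ?thesis unfolding e conj_nat[OF \<open>act D x \<in> \<phi> ` A\<close>] by (intro pos[OF x])
  next
    \<comment> \<open>A negative power is reduced to a positive one by starting at the translated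
      element \<open>z\<close>: since \<open>x\<close> is the image of \<open>z\<close> under the
      positive power, the commutator for \<open>x\<close> is the inverse of the one for
      \<open>z\<close>.\<close>
    case (nonpos k)
    define T where "T = \<phi> t [^]\<^bsub>Q\<^esub> (int m * i)"
    define z where "z = conj_by Q T x"
    have T: "T \<in> carrier Q" by (simp add: T_def)
    have z: "z \<in> \<phi> ` A" using conj_pow_V[OF x] by (simp add: z_def T_def)
    have TT: "T \<otimes>\<^bsub>Q\<^esub> \<phi> t [^]\<^bsub>Q\<^esub> (int (m * k)) = \<one>\<^bsub>Q\<^esub>" "\<phi> t [^]\<^bsub>Q\<^esub> (int (m * k)) \<otimes>\<^bsub>Q\<^esub> T = \<one>\<^bsub>Q\<^esub>"
      unfolding T_def nonpos using phi_t_closed by (simp_all only: H.int_pow_mult[symmetric]) simp_all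
    have zx: "(\<tau> ^^ (m * k)) z = x"
      using conj_nat[OF z, of "m * k"] x TT T by (simp add: z_def H.conj_by_conj_by)
    have c: "act D z \<in> \<phi> ` A" "act D x \<in> \<phi> ` A" using V.act_closed[of z D] V.act_closed[of x D] x z by auto
    have "act D x = act D (act (monom 1 (m * k)) z)" using z zx by (simp add: V.act_monom)
    also have "\<dots> = act (monom 1 (m * k)) (act D z)"
      using z by (simp add: V.act_mult[symmetric] mult.commute)
    also have "\<dots> = (\<tau> ^^ (m * k)) (act D z)" using c by (simp add: V.act_monom)
    finally have Dx: "act D x = (\<tau> ^^ (m * k)) (act D z)" .
    have "conj_by Q T (conj_by Q (\<phi> t [^]\<^bsub>Q\<^esub> (int (m * k))) (act D z)) = act D z"
      using c TT T by (simp add: H.conj_by_conj_by del: of_nat_mult)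
    then have cj: "conj_by Q T (act D x) = act D z"
      by (simp only: Dx conj_nat[OF c(1)])
    have i: "act D z \<otimes>\<^bsub>Q\<^esub> inv\<^bsub>Q\<^esub> act D x = inv\<^bsub>Q\<^esub> (act D x \<otimes>\<^bsub>Q\<^esub> inv\<^bsub>Q\<^esub> act D z)"
      using V_closed[OF c(1)] V_closed[OF c(2)] by (simp add: H.inv_mult_group)
    obtain y where y: "y \<in> \<phi> ` A" "act D x \<otimes>\<^bsub>Q\<^esub> inv\<^bsub>Q\<^esub> act D z = act ?E y"
      using pos[OF z, of k] Dx by auto
    have "conj_by Q T (act D x) \<otimes>\<^bsub>Q\<^esub> inv\<^bsub>Q\<^esub> act D x = inv\<^bsub>Q\<^esub> act ?E y"
      unfolding cj i y(2) ..
    also have "\<dots> = act ?E (inv\<^bsub>Q\<^esub> y)"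
    proof -
      interpret h: group_hom V V "act ?E" by (rule V.act_group_hom)
      show ?thesis using h.hom_inv[of y] y(1) inv_V[OF y(1)] inv_V[of "act ?E y"] V.act_closed[of y ?E] by simp
    qed
    finally show ?thesis
      using subgroup.m_inv_closed[OF sub_V y(1)] unfolding T_def by blast
  qed
qed

end

text \<open>The lower central series of \<open>M\<close> formed with the operations of
  \<open>G\<close>, so that the series of different subgroups can be compared as sets. For a
  subgroup it agrees with \<open>lower_central\<close>, by
  \<open>lower_central_eq_lcs\<close>.\<close>

primrec lcs :: "('a, 'b) monoid_scheme \<Rightarrow> 'a set \<Rightarrow> nat \<Rightarrow> 'a set" where
  "lcs G M 0 = M"
| "lcs G M (Suc n) = generate G (\<Union>g\<in>M. \<Union>h\<in>lcs G M n.
      {g \<otimes>\<^bsub>G\<^esub> h \<otimes>\<^bsub>G\<^esub> inv\<^bsub>G\<^esub> g \<otimes>\<^bsub>G\<^esub> inv\<^bsub>G\<^esub> h})"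

context group
begin

lemma commutator_closed:
  assumes "subgroup H G" "x \<in> H" "y \<in> H"
  shows "x \<otimes> y \<otimes> inv x \<otimes> inv y \<in> H"
  using assms by (simp add: subgroup.m_closed subgroup.m_inv_closed)

lemma lcs_subgroup:
  assumes "subgroup M G"
  shows "subgroup (lcs G M n) G \<and> lcs G M n \<subseteq> M"
proof (induction n)
  case (Suc n)
  let ?S = "\<Union>g\<in>M. \<Union>h\<in>lcs G M n. {g \<otimes> h \<otimes> inv g \<otimes> inv h}"
  have S: "?S \<subseteq> M" using Suc commutator_closed[OF assms] by blast
  then show ?case
    using generate_subgroup_incl[OF S assms] generate_is_subgroup[of ?S] subgroup.subset[OF assms] by auto
qed (use assms in auto)

lemma lcs_commutator:
  "g \<in> M \<Longrightarrow> h \<in> lcs G M n \<Longrightarrow> g \<otimes> h \<otimes> inv g \<otimes> inv h \<in> lcs G M (Suc n)"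
  by (auto intro!: generate.incl)

lemma lcs_mono: "K \<subseteq> M \<Longrightarrow> lcs G K n \<subseteq> lcs G M n"
proof (induction n)
  case (Suc n)
  then show ?case unfolding lcs.simps by (intro mono_generate UN_mono) auto
qed auto

lemma lcs_Suc_subset:
  assumes "subgroup M G"
  shows "lcs G M (Suc n) \<subseteq> lcs G M n"
proof (induction n)
  case 0 then show ?case using lcs_subgroup[OF assms, of 1] by simp
next
  case (Suc n)
  then show ?case unfolding lcs.simps(2)[of _ _ "Suc n"] lcs.simps(2)[of _ _ n] by (intro mono_generate UN_mono) (auto simp del: lcs.simps)
qed

lemma lcs_conj_by:
  assumes M: "subgroup M G" and t: "t \<in> carrier G" and "\<And>x. x \<in> M \<Longrightarrow> conj_by G t x \<in> M"
    and "y \<in> lcs G M n"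
  shows "conj_by G t y \<in> lcs G M n"
  using assms(4)
proof (induction n arbitrary: y)
  case 0 then show ?case using assms by simp
next
  case (Suc n)
  let ?S = "\<Union>g\<in>M. \<Union>h\<in>lcs G M n. {g \<otimes> h \<otimes> inv g \<otimes> inv h}"
  have sc: "?S \<subseteq> carrier G"
    using lcs_subgroup[OF M] commutator_closed[OF M] subgroup.subset[OF M] by blast
  have "conj_by G t y \<in> generate G (conj_by G t ` ?S)"
    using conj_by_generate[OF sc t] Suc(2) by simp
  moreover have "conj_by G t ` ?S \<subseteq> ?S"
  proof
    fix z assume "z \<in> conj_by G t ` ?S"
    then obtain g h where gh: "g \<in> M" "h \<in> lcs G M n" "z = conj_by G t (g \<otimes> h \<otimes> inv g \<otimes> inv h)" by blast
    have c: "g \<in> carrier G" "h \<in> carrier G" using gh lcs_subgroup[OF M] subgroup.subset[OF M] by blast+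
    have "z = conj_by G t g \<otimes> conj_by G t h \<otimes> inv (conj_by G t g) \<otimes> inv (conj_by G t h)"
      unfolding gh(3) using c t by (simp add: conj_by_mult conj_by_inv)
    then show "z \<in> ?S" using gh Suc.IH assms(3) by blast
  qed
  ultimately show ?case using mono_generate[of "conj_by G t ` ?S" ?S] by auto
qed

lemma lower_central_eq_lcs:
  assumes M: "subgroup M G"
  shows "lower_central (G\<lparr>carrier := M\<rparr>) n = lcs G M n"
proof (induction n)
  case (Suc n)
  have sub: "lcs G M n \<subseteq> M" using lcs_subgroup[OF M] by blast
  have "(\<Union>g\<in>M. \<Union>h\<in>lcs G M n. {g \<otimes> h \<otimes> inv\<^bsub>G\<lparr>carrier := M\<rparr>\<^esub> g \<otimes> inv\<^bsub>G\<lparr>carrier := M\<rparr>\<^esub> h})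
      = (\<Union>g\<in>M. \<Union>h\<in>lcs G M n. {g \<otimes> h \<otimes> inv g \<otimes> inv h})" (is "_ = ?S")
    using sub m_inv_consistent[OF M] by (intro SUP_cong refl) (auto simp: subset_iff)
  moreover have "?S \<subseteq> M" using sub commutator_closed[OF M] by blast
  ultimately show ?case using Suc generate_consistent[OF _ M, of ?S] by simp
qed simp

text \<open>Once a term of the series of \<open>H\<close> has entered a chain that commutation with
  \<open>H\<close> pushes one step down, later terms must follow the chain.\<close>

lemma lcs_le_chain:
  assumes H: "subgroup H G" and "lcs G H N \<subseteq> W 0" and "\<And>j. subgroup (W j) G"
    and "\<And>h v j. h \<in> H \<Longrightarrow> v \<in> W j \<Longrightarrow> h \<otimes> v \<otimes> inv h \<otimes> inv v \<in> W (Suc j)"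
  shows "lcs G H (N + j) \<subseteq> W j"
proof (induction j)
  case (Suc j)
  show ?case
    unfolding add_Suc_right lcs.simps
    using Suc assms(4) by (intro generate_subgroup_incl[OF _ assms(3)]) blast
qed (use assms in simp)

end

context abelian_section
begin

text \<open>Elements of \<open>M\<close> act trivially on the factor and powers of
  \<open>t [^] m\<close> act unipotently, so commutation with \<open>H\<close> raises the power of
  \<open>X^m - 1\<close> in each step, and the \<open>a\<close>-th power is zero.\<close>

lemma lcs_descends:
  assumes m: "\<And>x. x \<in> \<phi> ` A \<Longrightarrow> act ((monom 1 m - 1) ^ a) x = \<one>\<^bsub>Q\<^esub>"
    and ext: "cyc_ext G M (t [^] m) H" and AM: "A \<subseteq> M"
    and cent: "\<And>g v. g \<in> M \<Longrightarrow> v \<in> A \<Longrightarrow> g \<otimes> v \<otimes> inv g \<otimes> inv v \<in> A \<and> \<phi> (g \<otimes> v \<otimes> inv g \<otimes> inv v) = \<one>\<^bsub>Q\<^esub>"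
    and N: "lcs G H N \<subseteq> A"
  shows "lcs G H (N + a) \<subseteq> {v \<in> A. \<phi> v = \<one>\<^bsub>Q\<^esub>}"
proof -
  note D = G.cyc_extD[OF ext]
  \<comment> \<open>Preimages in \<open>A\<close> of the images of the powers of
    \<open>X^m - 1\<close>: a chain starting at \<open>A\<close> and ending inside the kernel of
    \<phi>.\<close>
  define W where "W j = {v \<in> A. \<phi> v \<in> act ((monom 1 m - 1) ^ j) ` (\<phi> ` A)}" for j
  have sV: "subgroup (act p ` (\<phi> ` A)) Q" for p
  proof -
    interpret h: group_hom V V "act p" by (rule V.act_group_hom)
    have "subgroup (act p ` carrier V) V" by (rule h.img_is_subgroup)
    then show ?thesis using H.incl_subgroup[OF sub_V] by simp
  qed
  have "lcs G H (N + a) \<subseteq> W a"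
  proof (rule G.lcs_le_chain[OF G.cyc_ext_subgroup[OF ext]])
    show "lcs G H N \<subseteq> W 0"
    proof
      fix v assume "v \<in> lcs G H N"
      then have v: "v \<in> A" using N by blast
      then have "\<phi> v = act 1 (\<phi> v)" using V.act_one[of "\<phi> v"] by simp
      then show "v \<in> W 0" using v by (auto simp: W_def)
    qed
    show "subgroup (W j) G" for j
    proof -
      have "subgroup {v \<in> carrier G. \<phi> v \<in> act ((monom 1 m - 1) ^ j) ` (\<phi> ` A)} G"
        using subgroup.m_closed[OF sV] subgroup.m_inv_closed[OF sV] subgroup.one_closed[OF sV]
        by unfold_locales (auto simp del: image_iff)
      then have "subgroup (A \<inter> {v \<in> carrier G. \<phi> v \<in> act ((monom 1 m - 1) ^ j) ` (\<phi> ` A)}) G"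
        by (rule G.subgroups_Inter_pair[OF sub_A])
      moreover have "A \<inter> {v \<in> carrier G. \<phi> v \<in> act ((monom 1 m - 1) ^ j) ` (\<phi> ` A)} = W j"
        by (auto simp: W_def)
      ultimately show ?thesis by simp
    qed
    fix h v j assume h: "h \<in> H" and v: "v \<in> W j"
    obtain n i where n: "n \<in> M" "h = n \<otimes> (t [^] m) [^] (i::int)" using G.cyc_ext_elem[OF ext h] by blast
    have vA: "v \<in> A" using v by (simp add: W_def)
    obtain x where x: "x \<in> \<phi> ` A" "\<phi> v = act ((monom 1 m - 1) ^ j) x" using v by (auto simp: W_def)
    define s where "s = (t [^] m) [^] i"
    have s: "s = t [^] (int m * i)" using t_closed by (simp add: s_def int_pow_int[symmetric] G.int_pow_pow)
    have sc: "s \<in> carrier G" using t_closed by (simp add: s)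
    have nc: "n \<in> carrier G" using n D by blast
    define v' where "v' = conj_by G s v"
    have v'A: "v' \<in> A"
      unfolding v'_def s by (rule G.conj_by_int_pow_closed[OF t_closed _ conj_A conj_inv_A vA]) auto
    \<comment> \<open>The commutator with \<open>h = n \<otimes> s\<close> splits into one with
      \<open>n\<close>, which dies in \<open>Q\<close>, and the commutator of \<open>v\<close> with
      the power \<open>s\<close> of \<open>t [^] m\<close>, which moves down the chain.\<close>
    have "h \<otimes> v \<otimes> inv h \<otimes> inv v = (n \<otimes> v' \<otimes> inv n \<otimes> inv v') \<otimes> (v' \<otimes> inv v)"
      using vA nc sc by (simp add: n(2) s_def[symmetric] v'_def conj_by_def G.m_assoc G.inv_mult_group)
    moreover have "v' \<otimes> inv v \<in> A"
      using v'A vA subgroup.m_closed[OF sub_A] subgroup.m_inv_closed[OF sub_A] by blast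
    moreover have "n \<otimes> v' \<otimes> inv n \<otimes> inv v' \<in> A" "\<phi> (n \<otimes> v' \<otimes> inv n \<otimes> inv v') = \<one>\<^bsub>Q\<^esub>"
      using cent[OF n(1) v'A] by auto
    ultimately have hA: "h \<otimes> v \<otimes> inv h \<otimes> inv v \<in> A"
      and ph: "\<phi> (h \<otimes> v \<otimes> inv h \<otimes> inv v) = \<phi> (v' \<otimes> inv v)"
      using subgroup.m_closed[OF sub_A] by auto
    have "\<phi> (v' \<otimes> inv v) = conj_by Q (\<phi> t [^]\<^bsub>Q\<^esub> (int m * i)) (\<phi> v) \<otimes>\<^bsub>Q\<^esub> inv\<^bsub>Q\<^esub> \<phi> v"
      using vA v'A sc t_closed by (simp add: v'_def hom_conj_by s hom_int_pow)
    also have "\<dots> \<in> act ((monom 1 m - 1) ^ Suc j) ` (\<phi> ` A)"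
      unfolding x(2) using commutator_pow_act[OF x(1) refl, of m i j] by auto
    finally show "h \<otimes> v \<otimes> inv h \<otimes> inv v \<in> W (Suc j)"
      using hA ph by (simp add: W_def)
  qed
  moreover have "W a \<subseteq> {v \<in> A. \<phi> v = \<one>\<^bsub>Q\<^esub>}" using m by (auto simp: W_def)
  ultimately show ?thesis by blast
qed

end

section \<open>Change of ambient group and nilpotent by cyclic extensions\<close>

context group
begin

lemma conj_by_consistent:
  assumes "subgroup P G" "t \<in> P"
  shows "conj_by (G\<lparr>carrier := P\<rparr>) t x = conj_by G t x"
  using m_inv_consistent[OF assms] by (simp add: conj_by_def)

lemma cyc_ext_consistent:
  assumes P: "subgroup P G" "H \<subseteq> P" "t \<in> P" "N \<subseteq> P"
  shows "cyc_ext (G\<lparr>carrier := P\<rparr>) N t H \<longleftrightarrow> cyc_ext G N t H"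
proof -
  have tc: "t \<in> carrier G" "inv t \<in> P" using P subgroup.subset[OF P(1)] subgroup.m_inv_closed[OF P(1)] by auto
  have "subgroup N (G\<lparr>carrier := P\<rparr>) \<longleftrightarrow> subgroup N G"
    using subgroup_incl[OF _ P(1,4)] incl_subgroup[OF P(1)] by blast
  then show ?thesis
    unfolding cyc_ext_def using P(3) tc m_inv_consistent[OF P(1,3)]
      conj_by_consistent[OF P(1)] int_pow_consistent[OF P(1,3)] by simp
qed

lemma cyc_chain_consistent:
  assumes "cyc_chain G N H" "subgroup P G" "H \<subseteq> P"
  shows "cyc_chain (G\<lparr>carrier := P\<rparr>) N H"
  using assms(1,3)
proof induction
  case base
  then show ?case using subgroup_incl[OF _ assms(2)] by (intro cyc_chain.base)
next
  case (step K t K')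
  have KP: "K \<subseteq> P" "t \<in> P" using cyc_ext_subset[OF step(2)] step(4) by auto
  then have "cyc_ext (G\<lparr>carrier := P\<rparr>) K t K'"
    using cyc_ext_consistent[OF assms(2) step(4)] step(2) by simp
  then show ?case by (rule cyc_chain.step[OF step(3)[OF KP(1)]])
qed

lemma no_free_semigroup_consistent:
  "no_free_semigroup (G\<lparr>carrier := P\<rparr>) H \<longleftrightarrow> no_free_semigroup G H"
proof -
  have "word (G\<lparr>carrier := P\<rparr>) a b u = word G a b u" for a b u by (induction u) auto
  then show ?thesis by (simp add: no_free_semigroup_def)
qed

lemma lcs_consistent:
  assumes P: "subgroup P G" and H: "subgroup H G" "H \<subseteq> P"
  shows "lcs (G\<lparr>carrier := P\<rparr>) H n = lcs G H n"
proof -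
  interpret P: group "G\<lparr>carrier := P\<rparr>" by (rule subgroup_imp_group[OF P])
  have "lcs (G\<lparr>carrier := P\<rparr>) H n = lower_central (G\<lparr>carrier := P, carrier := H\<rparr>) n"
    using P.lower_central_eq_lcs[of H] subgroup_incl[OF H(1) P H(2)] by simp
  also have "\<dots> = lcs G H n" using lower_central_eq_lcs[OF H(1)] by simp
  finally show ?thesis .
qed

lemma cyc_ext_commutator:
  assumes ext: "cyc_ext G M t H" and "x \<in> H" "y \<in> H"
  shows "x \<otimes> y \<otimes> inv x \<otimes> inv y \<in> M"
proof -
  note D = cyc_extD[OF ext]
  obtain n i where n: "n \<in> M" "x = n \<otimes> t [^] (i::int)" using cyc_ext_elem[OF ext assms(2)] by blast
  obtain n' j where n': "n' \<in> M" "y = n' \<otimes> t [^] (j::int)" using cyc_ext_elem[OF ext assms(3)] by blast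
  obtain p where p: "p \<in> M" "x \<otimes> y = p \<otimes> t [^] (i + j)"
    unfolding n(2) n'(2) cyc_ext_mult[OF ext n(1) n'(1)]
    using cyc_ext_conj_pow[OF ext n'(1)] subgroup.m_closed[OF D(1) n(1)] by blast
  obtain q where q: "q \<in> M" "y \<otimes> x = q \<otimes> t [^] (j + i)"
    unfolding n(2) n'(2) cyc_ext_mult[OF ext n'(1) n(1)]
    using cyc_ext_conj_pow[OF ext n(1)] subgroup.m_closed[OF D(1) n'(1)] by blast
  have c: "x \<in> carrier G" "y \<in> carrier G" "p \<in> carrier G" "q \<in> carrier G"
    using assms(2,3) cyc_ext_subset[OF ext] p q D by auto
  have "x \<otimes> y \<otimes> inv x \<otimes> inv y = (x \<otimes> y) \<otimes> inv (y \<otimes> x)"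
    using c by (simp add: inv_mult_group m_assoc)
  also have "\<dots> = p \<otimes> inv q"
    unfolding p(2) q(2) using c D by (simp add: inv_mult_group m_assoc add.commute)
  finally show ?thesis using p q subgroup.m_closed[OF D(1)] subgroup.m_inv_closed[OF D(1)] by simp
qed

text \<open>The order of the quantifiers matters: \<open>m0\<close> depends only on the factor
  \<open>i\<close> and serves all multiples \<open>m\<close>, so that finitely many factors can
  later share one exponent. The number of steps \<open>N'\<close> may depend on \<open>H\<close> and
  \<open>N\<close>.\<close>

lemma lcs_section:
  assumes ext: "cyc_ext G M t (carrier G)" and poly: "polycyclic G M"
    and nf: "no_free_semigroup G (carrier G)"
  shows "\<exists>m0>0. \<forall>m H N. m0 dvd m \<longrightarrow> cyc_ext G M (t [^] (m::nat)) H \<longrightarrow> lcs G H N \<subseteq> lcs G M i \<longrightarrow>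
    (\<exists>N'. lcs G H N' \<subseteq> lcs G M (Suc i))"
proof -
  note D = cyc_extD[OF ext]
  let ?A = "lcs G M i" and ?B = "lcs G M (Suc i)"
  have conj: "conj_by G g y \<in> lcs G M k" if "g \<in> carrier G" "y \<in> lcs G M k" for g y k
    using lcs_conj_by[OF D(1) that(1) _ that(2)] cyc_ext_normal[OF ext that(1)] by blast
  have sA: "subgroup ?A G" "?A \<subseteq> M" and sB: "subgroup ?B G" using lcs_subgroup[OF D(1)] by blast+
  have nB: "?B \<lhd> G"
    using conj[of _ _ "Suc i"] by (intro normal_invI[OF sB]) (simp add: conj_by_def)
  interpret B: normal ?B G by (rule nB)
  define \<phi> where "\<phi> = (\<lambda>a. ?B #> a)"
  have "\<phi> \<in> hom G (G Mod ?B)" unfolding \<phi>_def by (rule B.r_coset_hom_Mod)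
  then have hom: "group_hom G (G Mod ?B) \<phi>"
    by (intro group_hom.intro group_hom_axioms.intro group_axioms B.factorgroup_is_group)
  interpret h: group_hom G "G Mod ?B" \<phi> by (rule hom)
  have ker: "\<phi> a = \<one>\<^bsub>G Mod ?B\<^esub> \<longleftrightarrow> a \<in> ?B" if "a \<in> carrier G" for a
    using that coset_join1[OF _ _ B.subgroup_axioms] coset_join2[OF _ B.subgroup_axioms]
    by (auto simp: \<phi>_def FactGroup_def simp del: lcs.simps)
  have comm: "g \<otimes> v \<otimes> inv g \<otimes> inv v \<in> ?A \<and> \<phi> (g \<otimes> v \<otimes> inv g \<otimes> inv v) = \<one>\<^bsub>G Mod ?B\<^esub>"
    if "g \<in> M" "v \<in> ?A" for g v
  proof -
    have "g \<otimes> v \<otimes> inv g \<otimes> inv v \<in> ?B" by (rule lcs_commutator[OF that])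
    then show ?thesis using lcs_Suc_subset[OF D(1)] ker B.subset by blast
  qed
  have "abelian_section G (G Mod ?B) \<phi> ?A t"
  proof (intro abelian_section.intro abelian_section_axioms.intro)
    show "group_hom G (G Mod ?B) \<phi>" by (rule hom)
    show "\<phi> a \<otimes>\<^bsub>G Mod ?B\<^esub> \<phi> b = \<phi> b \<otimes>\<^bsub>G Mod ?B\<^esub> \<phi> a" if "a \<in> ?A" "b \<in> ?A" for a b
    proof -
      have c: "a \<in> carrier G" "b \<in> carrier G" using that sA subgroup.subset by blast+
      define k where "k = a \<otimes> b \<otimes> inv a \<otimes> inv b"
      have k: "k \<in> carrier G" "\<phi> k = \<one>\<^bsub>G Mod ?B\<^esub>"
        using c comm[of a b] that sA(2) by (auto simp: k_def)
      have "\<phi> a \<otimes>\<^bsub>G Mod ?B\<^esub> \<phi> b = \<phi> (a \<otimes> b)" using c by (simp only: h.hom_mult)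
      moreover have "a \<otimes> b = k \<otimes> (b \<otimes> a)"
        unfolding k_def using c by (simp only: m_assoc m_closed inv_closed inv_mult_cancel l_inv r_one)
      moreover have "\<phi> (k \<otimes> (b \<otimes> a)) = \<phi> b \<otimes>\<^bsub>G Mod ?B\<^esub> \<phi> a"
        using k c by (simp only: h.hom_mult m_closed h.hom_closed h.H.m_closed h.H.l_one)
      ultimately show ?thesis by (simp only:)
    qed
    show "polycyclic G ?A" by (rule polycyclic_subgroup[OF poly sA])
  qed (use sA D conj nf in auto)
  then interpret s: abelian_section G "G Mod ?B" \<phi> ?A t .
  obtain m0 a where m0: "m0 > 0" "\<And>x. x \<in> \<phi> ` ?A \<Longrightarrow> s.act ((monom 1 m0 - 1) ^ a) x = \<one>\<^bsub>G Mod ?B\<^esub>"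
    using s.uniformly_unipotent by blast
  show ?thesis
  proof (rule exI[of _ m0], intro conjI m0(1) allI impI)
    fix m H N assume asm: "m0 dvd m" "cyc_ext G M (t [^] m) H" "lcs G H N \<subseteq> ?A"
    have un: "s.act ((monom 1 m - 1) ^ a) x = \<one>\<^bsub>G Mod ?B\<^esub>" if "x \<in> \<phi> ` ?A" for x
      using s.V.act_unipotent_mono[of x m0 a m a] m0(2)[OF that] that asm(1) by simp
    have "lcs G H (N + a) \<subseteq> {v \<in> ?A. \<phi> v = \<one>\<^bsub>G Mod ?B\<^esub>}"
      by (rule s.lcs_descends[OF un asm(2) sA(2) comm asm(3)])
    moreover have "{v \<in> ?A. \<phi> v = \<one>\<^bsub>G Mod ?B\<^esub>} \<subseteq> ?B"
      using ker subgroup.subset[OF sA(1)] by blast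
    ultimately show "\<exists>N'. lcs G H N' \<subseteq> ?B" by blast
  qed
qed

text \<open>With \<open>m\<close> the product of the exponents for all \<open>c\<close> factors, the
  series of \<open>H\<close> first enters \<open>M\<close>, because \<open>H\<close> modulo
  \<open>M\<close> is cyclic, and then passes through the factors one by one.\<close>

lemma nilpotent_cyc_ext_carrier:
  assumes ext: "cyc_ext G M t (carrier G)" and poly: "polycyclic G M"
    and nf: "no_free_semigroup G (carrier G)" and nil: "lcs G M c = {\<one>}"
  shows "\<exists>m H n. (m::nat) > 0 \<and> cyc_ext G M (t [^] m) H \<and> lcs G H n = {\<one>}"
proof -
  note D = cyc_extD[OF ext]
  have "\<forall>i. \<exists>m0>0. \<forall>m H N. m0 dvd m \<longrightarrow> cyc_ext G M (t [^] (m::nat)) H \<longrightarrow> lcs G H N \<subseteq> lcs G M i \<longrightarrow>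
    (\<exists>N'. lcs G H N' \<subseteq> lcs G M (Suc i))"
    using lcs_section[OF ext poly nf] by blast
  then obtain f where f: "\<And>i. f i > (0::nat)" "\<And>i m H N. f i dvd m \<Longrightarrow> cyc_ext G M (t [^] m) H \<Longrightarrow>
      lcs G H N \<subseteq> lcs G M i \<Longrightarrow> \<exists>N'. lcs G H N' \<subseteq> lcs G M (Suc i)"
    by metis
  define m where "m = (\<Prod>i<c. f i)"
  have m: "m > 0" using f(1) by (simp add: m_def prod_pos)
  have inv_pow: "inv (t [^] m) = t [^] (- int m)" using D by (simp add: int_pow_neg_int)
  have "cyc_ext G M (t [^] m) {n \<otimes> (t [^] m) [^] i | n (i::int). n \<in> M}"
    using cyc_ext_conj_pow[OF ext, of _ "int m"] cyc_ext_conj_pow[OF ext, of _ "- int m"] D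
    by (intro cyc_extI) (auto simp: inv_pow int_pow_int)
  then obtain H where H: "cyc_ext G M (t [^] m) H" by blast
  have "\<exists>N. lcs G H N \<subseteq> lcs G M i" if "i \<le> c" for i
    using that
  proof (induction i)
    case 0
    have "(\<Union>g\<in>H. \<Union>h\<in>lcs G H 0. {g \<otimes> h \<otimes> inv g \<otimes> inv h}) \<subseteq> M"
      using cyc_ext_commutator[OF H] by auto
    then have "lcs G H (Suc 0) \<subseteq> lcs G M 0" using generate_subgroup_incl[OF _ D(1)] by simp
    then show ?case by blast
  next
    case (Suc i)
    then have "f i dvd m" by (auto simp: m_def intro!: dvd_prodI)
    then show ?case using f(2)[OF _ H] Suc by auto
  qed
  then obtain N where "lcs G H N \<subseteq> {\<one>}" using nil by blast
  moreover have "\<one> \<in> lcs G H N" using lcs_subgroup[OF cyc_ext_subgroup[OF H]] subgroup.one_closed by blast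
  ultimately have "lcs G H N = {\<one>}" by blast
  then show ?thesis using m H by blast
qed

text \<open>The preceding lemma forms quotients of the whole group by terms of the series of
  \<open>M\<close>; here \<open>P\<close>, which normalises them, is made the ambient group.\<close>

lemma nilpotent_cyc_ext:
  assumes ext: "cyc_ext G M t P" and poly: "polycyclic G M"
    and nf: "no_free_semigroup G P" and nil: "lcs G M c = {\<one>}"
  shows "\<exists>m H n. (m::nat) > 0 \<and> cyc_ext G M (t [^] m) H \<and> lcs G H n = {\<one>}"
proof -
  note D = cyc_extD[OF ext]
  note P = cyc_ext_subgroup[OF ext] 
  note S = cyc_ext_subset[OF ext]
  interpret P: group "G\<lparr>carrier := P\<rparr>" by (rule subgroup_imp_group[OF P])
  have "\<exists>m H n. (m::nat) > 0 \<and> cyc_ext (G\<lparr>carrier := P\<rparr>) M (t [^]\<^bsub>G\<lparr>carrier := P\<rparr>\<^esub> m) H \<and>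
      lcs (G\<lparr>carrier := P\<rparr>) H n = {\<one>\<^bsub>G\<lparr>carrier := P\<rparr>\<^esub>}"
  proof (rule P.nilpotent_cyc_ext_carrier)
    show "cyc_ext (G\<lparr>carrier := P\<rparr>) M t (carrier (G\<lparr>carrier := P\<rparr>))"
      using cyc_ext_consistent[OF P _ S(2,1)] ext by simp
    show "polycyclic (G\<lparr>carrier := P\<rparr>) M" using cyc_chain_consistent[OF poly P S(1)] by simp
    show "no_free_semigroup (G\<lparr>carrier := P\<rparr>) (carrier (G\<lparr>carrier := P\<rparr>))"
      using nf by (simp add: no_free_semigroup_consistent)
    show "lcs (G\<lparr>carrier := P\<rparr>) M c = {\<one>\<^bsub>G\<lparr>carrier := P\<rparr>\<^esub>}"
      using nil lcs_consistent[OF P D(1) S(1)] by simp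
  qed
  then obtain m H n where mH: "(m::nat) > 0" "cyc_ext (G\<lparr>carrier := P\<rparr>) M (t [^]\<^bsub>G\<lparr>carrier := P\<rparr>\<^esub> m) H"
      "lcs (G\<lparr>carrier := P\<rparr>) H n = {\<one>}" by auto
  have HP: "H \<subseteq> P" using P.cyc_ext_subset[OF mH(2)] by simp
  have tm: "t [^]\<^bsub>G\<lparr>carrier := P\<rparr>\<^esub> m = t [^] m" by (simp add: nat_pow_def)
  have "t [^] m \<in> P" using subgroup_int_pow_closed[OF P S(2), of "int m"] by (simp add: int_pow_int)
  then have H: "cyc_ext G M (t [^] m) H" using mH(2) cyc_ext_consistent[OF P HP _ S(1)] unfolding tm by blast
  then have "lcs G H n = {\<one>}" using mH(3) lcs_consistent[OF P cyc_ext_subgroup[OF H] HP] by simp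
  then show ?thesis using mH(1) H by blast
qed

text \<open>Among the powers of \<open>h\<close> with exponents from 0 to \<open>card R\<close>, two
  share a coset of \<open>M\<close>, so some positive power with exponent at most
  \<open>card R\<close> lies in \<open>M\<close>. The factorial is a multiple of all these
  exponents.\<close>

lemma fin_index_pow:
  assumes M: "subgroup M G" and H: "subgroup H G" and "fin_index G M H"
  obtains k :: nat where "k > 0" "\<And>h. h \<in> H \<Longrightarrow> h [^] k \<in> M"
proof -
  obtain R where R: "finite R" "R \<subseteq> H" "\<And>h. h \<in> H \<Longrightarrow> \<exists>r\<in>R. inv r \<otimes> h \<in> M"
    using assms(3) unfolding fin_index_def by blast
  have "h [^] (fact (card R) :: nat) \<in> M" if h: "h \<in> H" for h
  proof -
    have hc: "h \<in> carrier G" using h subgroup.subset[OF H] by blast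
    have pow: "h [^] i \<in> H" for i :: nat
      using subgroup_int_pow_closed[OF H h, of "int i"] by (simp add: int_pow_int)
    obtain r where r: "\<And>i::nat. r i \<in> R" "\<And>i. inv (r i) \<otimes> h [^] i \<in> M" using R(3)[OF pow] by metis
    have "r ` {..card R} \<subseteq> R" using r(1) by blast
    then have "card (r ` {..card R}) \<le> card R" by (rule card_mono[OF R(1)])
    then have "\<not> inj_on r {..card R}" by (intro pigeonhole) simp
    then obtain i j where ij: "i \<le> card R" "j \<le> card R" "i < j" "r i = r j"
      unfolding inj_on_def by (metis atMost_iff linorder_neqE_nat)
    have rc: "r j \<in> carrier G" using r(1) R(2) subgroup.subset[OF H] by blast
    have "inv (inv (r j) \<otimes> h [^] i) \<otimes> (inv (r j) \<otimes> h [^] j) \<in> M"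
      using r(2)[of i] r(2)[of j] ij(4) subgroup.m_closed[OF M] subgroup.m_inv_closed[OF M] by simp
    also have "inv (inv (r j) \<otimes> h [^] i) \<otimes> (inv (r j) \<otimes> h [^] j) = inv (h [^] i) \<otimes> h [^] j"
      using rc hc by (simp add: inv_mult_group m_assoc)
    also have "h [^] j = h [^] i \<otimes> h [^] (j - i)" using hc ij(3) by (simp add: nat_pow_mult)
    finally have "h [^] (j - i) \<in> M" using hc by simp
    moreover have "j - i dvd fact (card R)" using ij by (intro dvd_fact) auto
    then obtain l where "fact (card R) = (j - i) * l" by (metis dvdE)
    then have "h [^] (fact (card R) :: nat) = (h [^] (j - i)) [^] l" using hc by (simp add: nat_pow_pow)
    ultimately show ?thesis
      using subgroup_int_pow_closed[OF M, of "h [^] (j - i)" "int l"] by (simp add: int_pow_int)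
  qed
  then show thesis using that[of "fact (card R)"] by simp
qed

text \<open>
  The subgroup of \<open>H\<close> generated by the \<open>k\<close>-th powers is characteristic, lies in a nilpotent
  subgroup of finite index for suitable \<open>k\<close>, and has finite index itself.
\<close>

lemma polycyclic_virtually_nilpotent:
  assumes "polycyclic G H" "no_free_semigroup G H"
  shows "\<exists>M c. subgroup M G \<and> M \<subseteq> H \<and> fin_index G M H \<and> lcs G M c = {\<one>}"
  using assms
proof induction
  case base
  then show ?case using subgroup.one_closed[OF base(1)]
    by (intro exI[of _ "{\<one>}"] exI[of _ 0]) (auto simp: fin_index_def)
next
  case (step H t H')
  note ext = step(2)
  note D = cyc_extD[OF ext]
  have "no_free_semigroup G H" using no_free_semigroup_mono[OF step(4)] cyc_ext_subset[OF ext] by blast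
  then obtain M c where M: "subgroup M G" "M \<subseteq> H" "fin_index G M H" "lcs G M c = {\<one>}" using step.IH by blast
  obtain k :: nat where k: "k > 0" "\<And>h. h \<in> H \<Longrightarrow> h [^] k \<in> M" using fin_index_pow[OF M(1) D(1) M(3)] by blast
  \<comment> \<open>\<open>M\<close> need not be invariant under conjugation by \<open>t\<close>,
    but the set of \<open>k\<close>-th powers of \<open>H\<close> is.\<close>
  let ?S = "(\<lambda>h. h [^] k) ` H"
  define N where "N = generate G ?S"
  have S: "?S \<subseteq> M" "?S \<subseteq> carrier G" using k(2) subgroup.subset[OF M(1)] by auto
  have N: "subgroup N G" "N \<subseteq> M" unfolding N_def
    by (rule generate_is_subgroup[OF S(2)]) (rule generate_subgroup_incl[OF S(1) M(1)])
  have conjN: "conj_by G u n \<in> N" if "n \<in> N" "u = t \<or> u = inv t" for n u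
  proof -
    have u: "u \<in> carrier G" "\<And>x. x \<in> H \<Longrightarrow> conj_by G u x \<in> H" using that(2) D by auto
    have "conj_by G u n \<in> generate G (conj_by G u ` ?S)"
      using conj_by_generate[OF S(2) u(1)] that(1) by (simp add: N_def)
    moreover have "conj_by G u ` ?S \<subseteq> ?S"
      using u D(3) conj_by_pow[OF u(1)] by (auto simp: subset_iff)
    ultimately show ?thesis unfolding N_def using mono_generate by blast
  qed
  obtain P where P: "cyc_ext G N t P" using cyc_extI[OF N(1) D(2)] conjN by blast
  have "P \<subseteq> H'"
    using cyc_ext_subset[OF ext] N M(2) by (intro cyc_ext_least[OF P cyc_ext_subgroup[OF ext]]) auto
  then have nf: "no_free_semigroup G P" by (rule no_free_semigroup_mono[OF step(4)])
  have "lcs G N c \<subseteq> {\<one>}" using lcs_mono[OF N(2)] M(4) by blast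
  then have nil: "lcs G N c = {\<one>}" using lcs_subgroup[OF N(1)] subgroup.one_closed by blast
  have NH: "N \<subseteq> H" using N M by blast
  have poly: "polycyclic G N" by (rule polycyclic_subgroup[OF step(1) N(1) NH])
  obtain m K n where K: "(m::nat) > 0" "cyc_ext G N (t [^] m) K" "lcs G K n = {\<one>}"
    using nilpotent_cyc_ext[OF P poly nf nil] by blast
  have "fin_index G N H"
    by (rule polycyclic_fin_index[OF step(1) N(1) NH k(1)]) (auto simp: N_def intro: generate.incl)
  then have "fin_index G K H'" 
    by (rule fin_index_cyc_ext[OF ext _ K(1) cyc_ext_subgroup[OF K(2)] cyc_ext_subset(1,2)[OF K(2)]])
  moreover have "t [^] m \<in> H'"
    using subgroup_int_pow_closed[OF cyc_ext_subgroup[OF ext], of t "int m"] cyc_ext_subset[OF ext]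
    by (simp add: int_pow_int)
  then have "K \<subseteq> H'"
    using cyc_ext_subset[OF ext] NH by (intro cyc_ext_least[OF K(2) cyc_ext_subgroup[OF ext]]) auto
  ultimately show ?case using cyc_ext_subgroup[OF K(2)] K(3) by blast
qed

theorem solvable_virtually_nilpotent:
  assumes "solvable G" "finite_generating_set G S" "no_free_semigroup G (carrier G)"
  shows "virtually_nilpotent G"
proof -
  obtain n where n: "(derived G ^^ n) (carrier G) = {\<one>}"
    using assms(1) solvable_iff_trivial_derived_seq by blast
  have "fin_gen G (carrier G)" using assms(2) unfolding fin_gen_def finite_generating_set_def by metis
  then have "polycyclic G (carrier G)" by (rule solvable_polycyclic[OF subgroup_self n assms(3)])
  then obtain M c where M: "subgroup M G" "fin_index G M (carrier G)" "lcs G M c = {\<one>}"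
    using polycyclic_virtually_nilpotent[OF _ assms(3)] by blast
  obtain R where R: "finite R" "R \<subseteq> carrier G" "\<And>h. h \<in> carrier G \<Longrightarrow> \<exists>r\<in>R. inv r \<otimes> h \<in> M"
    using M(2) unfolding fin_index_def by blast
  \<comment> \<open>Inverting the representatives converts the left cosets of
    \<open>fin_index\<close> into the right cosets of \<open>rcosets\<close>.\<close>
  have "rcosets M \<subseteq> (\<lambda>r. M #> inv r) ` R"
  proof
    fix C assume "C \<in> rcosets M"
    then obtain g where g: "g \<in> carrier G" "C = M #> g" by (auto simp: RCOSETS_def)
    obtain r where r: "r \<in> R" "inv r \<otimes> inv g \<in> M" using R(3)[of "inv g"] g by auto
    have rc: "r \<in> carrier G" using r R by blast
    have "inv (inv r \<otimes> inv g) \<in> M" using r(2) by (rule subgroup.m_inv_closed[OF M(1)])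
    then have "g \<otimes> r \<in> M" using rc g by (simp add: inv_mult_group)
    then have "g \<in> M #> inv r"
      unfolding r_coset_def using rc g by (auto simp: m_assoc intro!: bexI[of _ "g \<otimes> r"])
    then have "C = M #> inv r" using repr_independence[OF _ _ M(1)] g rc by auto
    then show "C \<in> (\<lambda>r. M #> inv r) ` R" using r by blast
  qed
  then have "finite (rcosets M)" using R(1) finite_surj by blast
  moreover have "nilpotent (G\<lparr>carrier := M\<rparr>)"
    unfolding nilpotent_def using M(3) lower_central_eq_lcs[OF M(1)] by auto
  ultimately show ?thesis unfolding virtually_nilpotent_def using M(1) by blast
qed

end

section \<open>Amenability of solvable groups\<close>

text \<open>Almost invariance is under right multiplication, matching the edges of
  \<open>cayley_graph\<close>.\<close>

definition folner :: "('a, 'b) monoid_scheme \<Rightarrow> 'a set \<Rightarrow> bool" where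
  "folner G H \<longleftrightarrow> (\<forall>K \<epsilon>. finite K \<and> K \<subseteq> H \<and> \<epsilon> > 0 \<longrightarrow>
     (\<exists>F. finite F \<and> F \<noteq> {} \<and> F \<subseteq> H \<and>
        (\<forall>k\<in>K. real (card {x \<in> F. x \<otimes>\<^bsub>G\<^esub> k \<notin> F}) \<le> \<epsilon> * real (card F))))"

lemma folnerE:
  assumes "folner G H" "finite K" "K \<subseteq> H" "\<epsilon> > 0"
  obtains F where "finite F" "F \<noteq> {}" "F \<subseteq> H"
    "\<And>k. k \<in> K \<Longrightarrow> real (card {x \<in> F. x \<otimes>\<^bsub>G\<^esub> k \<notin> F}) \<le> \<epsilon> * real (card F)"
proof -
  have "\<exists>F. finite F \<and> F \<noteq> {} \<and> F \<subseteq> H \<and>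
        (\<forall>k\<in>K. real (card {x \<in> F. x \<otimes>\<^bsub>G\<^esub> k \<notin> F}) \<le> \<epsilon> * real (card F))"
    using assms(1)[unfolded folner_def, rule_format, of K \<epsilon>] assms(2-) by simp
  then show thesis
    by (elim exE conjE) (rule that, assumption+, erule bspec, assumption)
qed

context group
begin

text \<open>\<open>Y\<close> is an almost invariant finite set in the space of cosets
  \<open>N y\<close>, with one representative for each. The product of \<open>Y\<close> with a
  sufficiently invariant subset \<open>E\<close> of \<open>N\<close> is almost invariant in
  \<open>H\<close>: multiplication by \<open>k\<close> moves one representative to another up to an
  element of \<open>N\<close>.\<close>

lemma folner_extension:
  assumes N: "subgroup N G" "folner G N" and H: "subgroup H G" "N \<subseteq> H"
    and quot: "\<And>K \<epsilon>. finite K \<Longrightarrow> K \<subseteq> H \<Longrightarrow> \<epsilon> > 0 \<Longrightarrow>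
      \<exists>Y. finite Y \<and> Y \<noteq> {} \<and> Y \<subseteq> H \<and> (\<forall>y\<in>Y. \<forall>y'\<in>Y. y \<otimes> inv y' \<in> N \<longrightarrow> y = y') \<and>
        (\<forall>k\<in>K. real (card {y \<in> Y. \<forall>y'\<in>Y. y \<otimes> k \<otimes> inv y' \<notin> N}) \<le> \<epsilon> * real (card Y))"
  shows "folner G H"
  unfolding folner_def
proof (intro allI impI, elim conjE)
  fix K and \<epsilon> :: real
  assume K: "finite K" "K \<subseteq> H" and \<epsilon>: "\<epsilon> > 0"
  obtain Y where Y': "finite Y" "Y \<noteq> {}" "Y \<subseteq> H" "\<forall>y\<in>Y. \<forall>y'\<in>Y. y \<otimes> inv y' \<in> N \<longrightarrow> y = y'"
    "\<forall>k\<in>K. real (card {y \<in> Y. \<forall>y'\<in>Y. y \<otimes> k \<otimes> inv y' \<notin> N}) \<le> \<epsilon> / 2 * real (card Y)"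
    using quot[OF K half_gt_zero[OF \<epsilon>]] by (elim exE conjE) (rule that)
  note Y = Y'(1-3) Y'(4)[rule_format] Y'(5)[rule_format]
  \<comment> \<open>The finitely many elements of \<open>N\<close> by which right multiplication by
    some \<open>k\<close> in \<open>K\<close> can shift the \<open>N\<close>-coordinate.\<close>
  let ?K = "(\<lambda>(y, k, y'). y \<otimes> k \<otimes> inv y') ` (Y \<times> K \<times> Y) \<inter> N"
  have "finite ?K" "?K \<subseteq> N" "\<epsilon> / 2 > 0" using Y(1) K(1) \<epsilon> by auto
  from folnerE[OF N(2) this]
  obtain E where E: "finite E" "E \<noteq> {}" "E \<subseteq> N"
    "\<And>k. k \<in> ?K \<Longrightarrow> real (card {x \<in> E. x \<otimes> k \<notin> E}) \<le> \<epsilon> / 2 * real (card E)"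
    by blast
  have Ec: "n \<in> carrier G" if "n \<in> E" for n using that E(3) subgroup.subset[OF N(1)] by blast
  have Yc: "y \<in> carrier G" if "y \<in> Y" for y using that Y(3) subgroup.subset[OF H(1)] by blast
  define F where "F = (\<lambda>(n, y). n \<otimes> y) ` (E \<times> Y)"
  have inj: "inj_on (\<lambda>(n, y). n \<otimes> y) (E \<times> Y)"
  proof (rule inj_onI, clarsimp)
    fix n y n' y' assume a: "n \<in> E" "y \<in> Y" "n' \<in> E" "y' \<in> Y" "n \<otimes> y = n' \<otimes> y'"
    note c = Ec[OF a(1)] Ec[OF a(3)] Yc[OF a(2)] Yc[OF a(4)]
    have "y = inv n \<otimes> (n' \<otimes> y')" using c a(5)[symmetric] by simp
    then have "y \<otimes> inv y' = inv n \<otimes> n'" using c by (simp add: m_assoc)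
    moreover have "inv n \<otimes> n' \<in> N"
      using a E(3) subgroup.m_closed[OF N(1)] subgroup.m_inv_closed[OF N(1)] by (meson subsetD)
    ultimately have "y = y'" using Y(4) a by metis
    then show "n = n' \<and> y = y'" using a(5) c by simp
  qed
  have cardF: "card F = card E * card Y"
    unfolding F_def card_image[OF inj] by (simp add: card_cartesian_product)
  have "real (card {x \<in> F. x \<otimes> k \<notin> F}) \<le> \<epsilon> * real (card F)" if k: "k \<in> K" for k
  proof -
    have kc: "k \<in> carrier G" using k K(2) subgroup.subset[OF H(1)] by blast
    define bad where "bad = {y \<in> Y. \<forall>y'\<in>Y. y \<otimes> k \<otimes> inv y' \<notin> N}"
    have "\<forall>y\<in>Y - bad. \<exists>y'. y' \<in> Y \<and> y \<otimes> k \<otimes> inv y' \<in> N" by (auto simp: bad_def)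
    then obtain c where c: "\<And>y. y \<in> Y - bad \<Longrightarrow> c y \<in> Y" "\<And>y. y \<in> Y - bad \<Longrightarrow> y \<otimes> k \<otimes> inv (c y) \<in> N"
      by metis
    define D where "D y = {n \<in> E. n \<otimes> (y \<otimes> k \<otimes> inv (c y)) \<notin> E}" for y
    have D: "real (card (D y)) \<le> \<epsilon> / 2 * real (card E)" if "y \<in> Y - bad" for y
      unfolding D_def using that c k by (intro E(4)) force
    have fin: "finite (E \<times> bad)" "finite (\<Union>y\<in>Y - bad. D y \<times> {y})"
      using E(1) Y(1) by (auto simp: bad_def D_def)
    \<comment> \<open>A point leaves \<open>F\<close> only if its coset leaves the coset set of
      \<open>Y\<close>, or if its \<open>N\<close>-coordinate is shifted out of \<open>E\<close>.
      Each alternative costs half of \<epsilon>.\<close>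
    have "{x \<in> F. x \<otimes> k \<notin> F} \<subseteq> (\<lambda>(n, y). n \<otimes> y) ` (E \<times> bad \<union> (\<Union>y\<in>Y - bad. D y \<times> {y}))"
    proof
      fix x assume x: "x \<in> {x \<in> F. x \<otimes> k \<notin> F}"
      then obtain n y where ny: "n \<in> E" "y \<in> Y" "x = n \<otimes> y" by (auto simp: F_def)
      have "n \<in> D y" if y: "y \<notin> bad"
      proof (rule ccontr)
        assume "n \<notin> D y"
        then have "n \<otimes> (y \<otimes> k \<otimes> inv (c y)) \<in> E" using ny by (simp add: D_def)
        then have "(n \<otimes> (y \<otimes> k \<otimes> inv (c y))) \<otimes> c y \<in> F" using c(1)[of y] ny y by (auto simp: F_def)
        moreover have "(n \<otimes> (y \<otimes> k \<otimes> inv (c y))) \<otimes> c y = x \<otimes> k"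
          using Ec[OF ny(1)] Yc[OF ny(2)] Yc[OF c(1)[of y]] ny y kc by (simp add: m_assoc)
        ultimately show False using x by simp
      qed
      then show "x \<in> (\<lambda>(n, y). n \<otimes> y) ` (E \<times> bad \<union> (\<Union>y\<in>Y - bad. D y \<times> {y}))"
        using ny by (intro image_eqI[of _ _ "(n, y)"]) auto
    qed
    then have "card {x \<in> F. x \<otimes> k \<notin> F} \<le> card (E \<times> bad \<union> (\<Union>y\<in>Y - bad. D y \<times> {y}))"
      using fin by (meson finite_UnI surj_card_le)
    also have "\<dots> \<le> card (E \<times> bad) + card (\<Union>y\<in>Y - bad. D y \<times> {y})" by (rule card_Un_le)
    also have "\<dots> \<le> card E * card bad + (\<Sum>y\<in>Y - bad. card (D y))"
      using card_UN_le[of "Y - bad" "\<lambda>y. D y \<times> {y}"] Y(1) by (simp add: card_cartesian_product)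
    finally have le: "card {x \<in> F. x \<otimes> k \<notin> F} \<le> card E * card bad + (\<Sum>y\<in>Y - bad. card (D y))" .
    have "real (card {x \<in> F. x \<otimes> k \<notin> F}) \<le> real (card E) * real (card bad) + (\<Sum>y\<in>Y - bad. real (card (D y)))"
      using of_nat_mono[OF le, where 'a = real] by simp
    also have "\<dots> \<le> real (card E) * (\<epsilon> / 2 * real (card Y)) + (\<Sum>y\<in>Y. \<epsilon> / 2 * real (card E))"
    proof (intro add_mono mult_left_mono)
      show "real (card bad) \<le> \<epsilon> / 2 * real (card Y)" unfolding bad_def by (rule Y(5)[OF k])
      have "(\<Sum>y\<in>Y - bad. real (card (D y))) \<le> (\<Sum>y\<in>Y - bad. \<epsilon> / 2 * real (card E))"
        by (intro sum_mono D)
      also have "\<dots> \<le> (\<Sum>y\<in>Y. \<epsilon> / 2 * real (card E))"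
        using Y(1) \<epsilon> by (intro sum_mono2) auto
      finally show "(\<Sum>y\<in>Y - bad. real (card (D y))) \<le> (\<Sum>y\<in>Y. \<epsilon> / 2 * real (card E))" .
    qed auto
    also have "\<dots> = \<epsilon> * real (card F)" by (simp add: cardF algebra_simps)
    finally show ?thesis .
  qed
  moreover have "F \<subseteq> H"
    using E(3) H(2) Y(3) subgroup.m_closed[OF H(1)] by (auto simp: F_def subset_iff)
  ultimately show "\<exists>F. finite F \<and> F \<noteq> {} \<and> F \<subseteq> H \<and>
      (\<forall>k\<in>K. real (card {x \<in> F. x \<otimes> k \<notin> F}) \<le> \<epsilon> * real (card F))"
    using E(1,2) Y(1,2) by (intro exI[of _ F]) (auto simp: F_def)
qed

lemma folner_cyc_ext:
  assumes ext: "cyc_ext G N t H" and N: "folner G N"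
  shows "folner G H"
proof (rule folner_extension[OF cyc_extD(1)[OF ext] N cyc_ext_subgroup[OF ext] cyc_ext_subset(1)[OF ext]])
  note D = cyc_extD[OF ext]
  fix K and \<epsilon> :: real
  assume K: "finite K" "K \<subseteq> H" and \<epsilon>: "\<epsilon> > 0"
  have "\<forall>k\<in>K. \<exists>n. n \<in> N \<and> (\<exists>i::int. k = n \<otimes> t [^] i)" using K(2) cyc_ext_elem[OF ext] by (metis subsetD)
  then obtain f e where fe: "\<And>k. k \<in> K \<Longrightarrow> f k \<in> N" "\<And>k. k \<in> K \<Longrightarrow> k = f k \<otimes> t [^] (e k :: int)"
    by metis
  have move: "t [^] i \<otimes> k \<otimes> inv (t [^] j) = conj_by G (t [^] i) (f k) \<otimes> t [^] (i + e k - j)"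
    if "k \<in> K" for k and i j :: int
  proof -
    have "f k \<in> carrier G" using fe(1)[OF that] D by blast
    then show ?thesis
      using D by (subst fe(2)[OF that]) (simp add: conj_by_def m_assoc int_pow_mult int_pow_diff)
  qed
  obtain m where tN: "\<And>i::int. t [^] i \<in> N \<longleftrightarrow> m dvd i"
    using int_pow_mem_subgroup[OF D(1,2)] by blast
  have good: "t [^] i \<otimes> k \<otimes> inv (t [^] j) \<in> N" if "k \<in> K" "m dvd i + e k - j" for k and i j :: int
    unfolding move[OF that(1)]
    using cyc_ext_conj_pow[OF ext fe(1)[OF that(1)]] tN that(2) subgroup.m_closed[OF D(1)] by blast
  have diff: "t [^] i \<otimes> inv (t [^] j) \<in> N \<longleftrightarrow> m dvd i - j" for i j :: int
    using tN[of "i - j"] D by (simp add: int_pow_diff)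
  \<comment> \<open>If some nonzero power of \<open>t\<close> lies in \<open>N\<close>, a full
    period of length \<open>\<bar>m\<bar>\<close> has no boundary. Otherwise an interval is used
    that is long compared with all shifts \<open>e k\<close>; \<open>max 1\<close> keeps it
    nonempty.\<close>
  define R where "R = (if m = 0 then max 1 \<lceil>(\<Sum>k\<in>K. real_of_int \<bar>e k\<bar>) / \<epsilon>\<rceil> else \<bar>m\<bar>)"
  have R: "R > 0" by (auto simp: R_def less_max_iff_disj)
  define Y where "Y = (\<lambda>i::int. t [^] i) ` {0..<R}"
  have small: "m dvd d \<Longrightarrow> \<bar>d\<bar> < R \<Longrightarrow> d = 0" for d
    using dvd_imp_le_int[of d m] by (cases "m = 0"; cases "d = 0") (auto simp: R_def)
  have inj: "inj_on (\<lambda>i::int. t [^] i) {0..<R}"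
  proof (rule inj_onI)
    fix i j :: int assume a: "i \<in> {0..<R}" "j \<in> {0..<R}" "t [^] i = t [^] j"
    then have "t [^] i \<otimes> inv (t [^] j) \<in> N" using D subgroup.one_closed[OF D(1)] by simp
    then have "m dvd i - j" using diff[of i j] by blast
    moreover have "\<bar>i - j\<bar> < R" using a(1,2) by auto
    ultimately show "i = j" using small[of "i - j"] by simp
  qed
  have cardY: "card Y = nat R" unfolding Y_def card_image[OF inj] by simp
  have "real (card {y \<in> Y. \<forall>y'\<in>Y. y \<otimes> k \<otimes> inv y' \<notin> N}) \<le> \<epsilon> * real (card Y)" if k: "k \<in> K" for k
  proof (cases "m = 0")
    case False
    have "{y \<in> Y. \<forall>y'\<in>Y. y \<otimes> k \<otimes> inv y' \<notin> N} = {}"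
    proof safe
      fix y assume "y \<in> Y" and b: "\<forall>y'\<in>Y. y \<otimes> k \<otimes> inv y' \<notin> N"
      then obtain i :: int where "y = t [^] i" by (auto simp: Y_def)
      moreover have "t [^] ((i + e k) mod R) \<in> Y" using R by (auto simp: Y_def)
      moreover have "m dvd i + e k - (i + e k) mod R"
        using False by (simp add: R_def minus_mod_eq_mult_div)
      ultimately show "y \<in> {}" using b good[OF k] by blast
    qed
    then show ?thesis using \<epsilon> by (simp only: card.empty) simp
  next
    case True
    have "{y \<in> Y. \<forall>y'\<in>Y. y \<otimes> k \<otimes> inv y' \<notin> N} \<subseteq> (\<lambda>i::int. t [^] i) ` ({0..<R} - {- e k..<R - e k})"
    proof
      fix y assume y: "y \<in> {y \<in> Y. \<forall>y'\<in>Y. y \<otimes> k \<otimes> inv y' \<notin> N}"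
      then obtain i where i: "i \<in> {0..<R}" "y = t [^] i" by (auto simp: Y_def)
      have "i \<notin> {- e k..<R - e k}"
      proof
        assume "i \<in> {- e k..<R - e k}"
        then have "t [^] (i + e k) \<in> Y" by (auto simp: Y_def)
        then show False using y i good[OF k, of i "i + e k"] by simp
      qed
      then show "y \<in> (\<lambda>i::int. t [^] i) ` ({0..<R} - {- e k..<R - e k})" using i by blast
    qed
    then have "card {y \<in> Y. \<forall>y'\<in>Y. y \<otimes> k \<otimes> inv y' \<notin> N} \<le> card ({0..<R} - {- e k..<R - e k})"
      by (meson finite_Diff finite_atLeastLessThan_int surj_card_le)
    also have "\<dots> \<le> card ({0..<- e k} \<union> {R - e k..<R})"
      by (intro card_mono) auto
    also have "\<dots> \<le> nat \<bar>e k\<bar>"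
      by (rule order_trans[OF card_Un_le]) (simp add: abs_if)
    finally have "real (card {y \<in> Y. \<forall>y'\<in>Y. y \<otimes> k \<otimes> inv y' \<notin> N}) \<le> real_of_int \<bar>e k\<bar>" by linarith
    also have "\<dots> \<le> (\<Sum>k\<in>K. real_of_int \<bar>e k\<bar>)" using k K(1) by (intro member_le_sum) auto
    also have "\<dots> \<le> \<epsilon> * real_of_int R"
    proof -
      have "(\<Sum>k\<in>K. real_of_int \<bar>e k\<bar>) / \<epsilon> \<le> real_of_int R"
        using True by (simp add: R_def) linarith
      then show ?thesis using \<epsilon> by (simp add: pos_divide_le_eq mult.commute)
    qed
    finally show ?thesis using R by (simp add: cardY)
  qed
  moreover have "Y \<subseteq> H"
    using subgroup_int_pow_closed[OF cyc_ext_subgroup[OF ext]] cyc_ext_subset[OF ext] by (auto simp: Y_def)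
  moreover have "\<forall>y\<in>Y. \<forall>y'\<in>Y. y \<otimes> inv y' \<in> N \<longrightarrow> y = y'"
  proof (intro ballI impI)
    fix y y' assume "y \<in> Y" "y' \<in> Y" and n: "y \<otimes> inv y' \<in> N"
    then obtain i j where ij: "i \<in> {0..<R}" "j \<in> {0..<R}" "y = t [^] i" "y' = t [^] j" by (auto simp: Y_def)
    have "m dvd i - j" using n ij(3,4) diff[of i j] by blast
    moreover have "\<bar>i - j\<bar> < R" using ij(1,2) by auto
    ultimately have "i - j = 0" by (rule small)
    then show "y = y'" using ij by simp
  qed
  ultimately show "\<exists>Y. finite Y \<and> Y \<noteq> {} \<and> Y \<subseteq> H \<and> (\<forall>y\<in>Y. \<forall>y'\<in>Y. y \<otimes> inv y' \<in> N \<longrightarrow> y = y') \<and>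
        (\<forall>k\<in>K. real (card {y \<in> Y. \<forall>y'\<in>Y. y \<otimes> k \<otimes> inv y' \<notin> N}) \<le> \<epsilon> * real (card Y))"
    using R by (intro exI[of _ Y]) (auto simp: Y_def)
qed

lemma folner_cyc_chain:
  assumes "cyc_chain G N H" "folner G N"
  shows "folner G H"
  using assms by induction (auto intro: folner_cyc_ext)

text \<open>The derived subgroup, and the abelian quotient, may fail to be finitely generated. Since
  each instance of the Folner condition concerns a finite \<open>K\<close> only, it is enough to
  adjoin \<open>K\<close> to the derived subgroup.\<close>

theorem folner_solvable:
  assumes "subgroup L G" "(derived G ^^ n) L = {\<one>}"
  shows "folner G L"
  using assms
proof (induction n arbitrary: L)
  case 0
  then have L: "L = {\<one>}" by simp
  show ?case
    unfolding folner_def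
  proof (intro allI impI exI[of _ "{\<one>}"], elim conjE, intro conjI ballI)
    fix K k and \<epsilon> :: real
    assume "K \<subseteq> L" "k \<in> K" "\<epsilon> > 0"
    then have "{x \<in> {\<one>}. x \<otimes> k \<notin> {\<one>}} = {}" using L by auto
    then show "real (card {x \<in> {\<one>}. x \<otimes> k \<notin> {\<one>}}) \<le> \<epsilon> * real (card {\<one>})"
      using \<open>\<epsilon> > 0\<close> by (simp only: card.empty) simp
  qed (auto simp: L)
next
  case (Suc n)
  let ?D = "derived G L"
  have D: "subgroup ?D G" "?D \<subseteq> L"
    using derived_is_subgroup[OF subgroup.subset[OF Suc(2)]] derived_incl[OF subset_refl Suc(2)] by auto
  have fD: "folner G ?D" using Suc.IH[OF D(1)] Suc(3) by (simp add: funpow_swap1)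
  show ?case
    unfolding folner_def
  proof (intro allI impI, elim conjE)
    fix K and \<epsilon> :: real
    assume K: "finite K" "K \<subseteq> L" and \<epsilon>: "\<epsilon> > 0"
    let ?B = "generate G (?D \<union> K)"
    have "folner G ?B" by (rule folner_cyc_chain[OF cyc_chain_derived[OF Suc(2) K] fD])
    moreover have "K \<subseteq> ?B" by (auto intro: generate.incl)
    ultimately obtain F where F: "finite F" "F \<noteq> {}" "F \<subseteq> ?B"
      "\<And>k. k \<in> K \<Longrightarrow> real (card {x \<in> F. x \<otimes> k \<notin> F}) \<le> \<epsilon> * real (card F)"
      using folnerE[OF _ K(1) _ \<epsilon>] by blast
    moreover have "?B \<subseteq> L" using D(2) K(2) by (intro generate_subgroup_incl Suc(2)) auto
    ultimately show "\<exists>F. finite F \<and> F \<noteq> {} \<and> F \<subseteq> L \<and>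
      (\<forall>k\<in>K. real (card {x \<in> F. x \<otimes> k \<notin> F}) \<le> \<epsilon> * real (card F))" by blast
  qed
qed

end

section \<open>Isoperimetry\<close>

definition disp :: "('a, 'b) monoid_scheme \<Rightarrow> 'a set \<Rightarrow> 'a \<Rightarrow> nat" where
  "disp G F g = card {x \<in> F. x \<otimes>\<^bsub>G\<^esub> g \<notin> F}"

definition bd :: "('a, 'b) monoid_scheme \<Rightarrow> 'a set \<Rightarrow> 'a set \<Rightarrow> real" where
  "bd G T F = (\<Sum>s\<in>T. real (disp G F s))"

context group
begin

lemma bd_nonneg: "bd G T F \<ge> 0"
  unfolding bd_def by (intro sum_nonneg) auto

lemma disp_one: "F \<subseteq> carrier G \<Longrightarrow> disp G F \<one> = 0"
proof -
  assume "F \<subseteq> carrier G"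
  then have "{x \<in> F. x \<otimes> \<one> \<notin> F} = {}" by auto
  then show ?thesis by (simp only: disp_def card.empty)
qed

text \<open>A point moved out of \<open>F\<close> by \<open>g \<otimes> h\<close> is moved out by
  \<open>g\<close>, or is sent by \<open>g\<close> to a point of \<open>F\<close> which
  \<open>h\<close> moves out; the latter are counted injectively.\<close>

lemma disp_mult:
  assumes F: "finite F" "F \<subseteq> carrier G" and "g \<in> carrier G" "h \<in> carrier G"
  shows "disp G F (g \<otimes> h) \<le> disp G F g + disp G F h"
proof -
  have inj: "inj_on (\<lambda>x. x \<otimes> g) F"
    using F(2) assms(3) by (intro inj_onI) (auto simp: subset_iff)
  let ?P = "{x \<in> F. x \<otimes> g \<in> F \<and> x \<otimes> (g \<otimes> h) \<notin> F}"
  have "(\<lambda>x. x \<otimes> g) ` ?P \<subseteq> {x \<in> F. x \<otimes> h \<notin> F}"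
    using F(2) assms(3,4) by (auto simp: m_assoc subset_iff)
  then have "card ?P \<le> card {x \<in> F. x \<otimes> h \<notin> F}"
    using F(1) by (intro card_inj_on_le[OF inj_on_subset[OF inj]]) auto
  moreover have "card {x \<in> F. x \<otimes> (g \<otimes> h) \<notin> F} \<le> card ({x \<in> F. x \<otimes> g \<notin> F} \<union> ?P)"
    using F(1) by (intro card_mono) auto
  moreover have "card ({x \<in> F. x \<otimes> g \<notin> F} \<union> ?P) \<le> card {x \<in> F. x \<otimes> g \<notin> F} + card ?P" by (rule card_Un_le)
  ultimately show ?thesis unfolding disp_def by linarith
qed

lemma disp_bounded:
  assumes T: "finite T" "S \<union> m_inv G ` S \<subseteq> T" "S \<subseteq> carrier G" and g: "g \<in> generate G S"
  shows "\<exists>l\<ge>0. \<forall>F. finite F \<longrightarrow> F \<subseteq> carrier G \<longrightarrow> real (disp G F g) \<le> l * bd G T F"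
  using g
proof induction
  case one
  show ?case using disp_one bd_nonneg by (intro exI[of _ 0]) auto
next
  case (incl h)
  then have "real (disp G F h) \<le> bd G T F" for F
    unfolding bd_def using T by (intro member_le_sum) auto
  then show ?case by (intro exI[of _ 1]) auto
next
  case (inv h)
  then have "real (disp G F (inv h)) \<le> bd G T F" for F
    unfolding bd_def using T by (intro member_le_sum) auto
  then show ?case by (intro exI[of _ 1]) auto
next
  case (eng h1 h2)
  obtain l1 where l1: "l1 \<ge> 0" "\<And>F. finite F \<Longrightarrow> F \<subseteq> carrier G \<Longrightarrow> real (disp G F h1) \<le> l1 * bd G T F"
    using eng.IH(1) by blast
  obtain l2 where l2: "l2 \<ge> 0" "\<And>F. finite F \<Longrightarrow> F \<subseteq> carrier G \<Longrightarrow> real (disp G F h2) \<le> l2 * bd G T F"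
    using eng.IH(2) by blast
  have c: "h1 \<in> carrier G" "h2 \<in> carrier G"
    using generate_in_carrier[OF T(3)] eng.hyps by auto
  have "real (disp G F (h1 \<otimes> h2)) \<le> (l1 + l2) * bd G T F" if "finite F" "F \<subseteq> carrier G" for F
    using disp_mult[OF that c] l1(2)[OF that] l2(2)[OF that] by (simp add: distrib_right)
  then show ?case using l1(1) l2(1) by (intro exI[of _ "l1 + l2"]) auto
qed

lemma disp_word:
  assumes F: "finite F" "F \<subseteq> carrier G" and c: "a \<in> carrier G" "b \<in> carrier G"
    and l: "real (disp G F a) \<le> l * bd G T F" "real (disp G F b) \<le> l * bd G T F"
  shows "real (disp G F (word G a b u)) \<le> real (length u) * l * bd G T F"
proof (induction u)
  case Nil then show ?case using disp_one[OF F(2)] by simp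
next
  case (Cons e u)
  let ?g = "if e then a else b"
  have "disp G F (?g \<otimes> word G a b u) \<le> disp G F ?g + disp G F (word G a b u)"
    using c by (intro disp_mult F) auto
  moreover have "real (disp G F ?g) \<le> l * bd G T F" using l by simp
  ultimately have "real (disp G F (?g \<otimes> word G a b u)) \<le> l * bd G T F + real (length u) * l * bd G T F"
    using Cons by linarith
  then show ?case by (simp add: algebra_simps)
qed

text \<open>
  The argument of Coulhon and Saloff-Coste: on average, right multiplication by one of the \<open>2\<^sup>k\<close> words of
  length \<open>k\<close> in a free subsemigroup moves half of \<open>F\<close> out of \<open>F\<close>.
\<close>

lemma isoperimetry:
  assumes T: "finite T" "S \<union> m_inv G ` S \<subseteq> T" "S \<subseteq> carrier G" "generate G S = carrier G"
    and free: "\<not> no_free_semigroup G (carrier G)"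
  shows "\<exists>l>0. \<forall>F k. finite F \<longrightarrow> F \<subseteq> carrier G \<longrightarrow> 2 * card F \<le> 2 ^ k \<longrightarrow>
    real (card F) \<le> 2 * real k * l * bd G T F"
proof -
  obtain a b where ab: "a \<in> carrier G" "b \<in> carrier G"
    "\<And>u v. length u = length v \<Longrightarrow> word G a b u = word G a b v \<Longrightarrow> u = v"
    using free unfolding no_free_semigroup_def by blast
  obtain l1 where l1: "l1 \<ge> 0" "\<And>F. finite F \<Longrightarrow> F \<subseteq> carrier G \<Longrightarrow> real (disp G F a) \<le> l1 * bd G T F"
    using disp_bounded[OF T(1-3), of a] ab(1) T(4) by auto
  obtain l2 where l2: "l2 \<ge> 0" "\<And>F. finite F \<Longrightarrow> F \<subseteq> carrier G \<Longrightarrow> real (disp G F b) \<le> l2 * bd G T F"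
    using disp_bounded[OF T(1-3), of b] ab(2) T(4) by auto
  define l where "l = l1 + l2 + 1"
  have l: "l > 0" using l1 l2 by (simp add: l_def)
  have "real (card F) \<le> 2 * real k * l * bd G T F"
    if F: "finite F" "F \<subseteq> carrier G" and k: "2 * card F \<le> 2 ^ k" for F k
  proof (cases "F = {}")
    case True
    then show ?thesis using l bd_nonneg[of T F] by simp
  next
    case False
    have le: "real (disp G F a) \<le> l * bd G T F" "real (disp G F b) \<le> l * bd G T F"
      using l1 l2 F bd_nonneg[of T F] mult_right_mono[of l1 l "bd G T F"] mult_right_mono[of l2 l "bd G T F"]
      by (fastforce simp: l_def)+
    define U where "U = {u :: bool list. length u = k}"
    have U: "finite U" "card U = 2 ^ k"
      using finite_lists_length_eq[of "UNIV :: bool set" k] card_lists_length_eq[of "UNIV :: bool set" k]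
      by (simp_all add: U_def)
    have "(\<Sum>u\<in>U. card {x \<in> F. x \<otimes> word G a b u \<in> F}) = card (SIGMA u:U. {x \<in> F. x \<otimes> word G a b u \<in> F})"
      using U F by (simp add: card_SigmaI)
    also have "\<dots> \<le> card (F \<times> F)"
    \<comment> \<open>Freeness enters here: the pair of start and end point determines the word, so
      there are at most \<open>card F\<close> squared incidences.\<close>
    proof (rule card_inj_on_le[where f = "\<lambda>(u, x). (x, x \<otimes> word G a b u)"])
      show "inj_on (\<lambda>(u, x). (x, x \<otimes> word G a b u)) (SIGMA u:U. {x \<in> F. x \<otimes> word G a b u \<in> F})"
      proof (rule inj_onI, clarsimp)
        fix u v x assume a: "u \<in> U" "v \<in> U" "x \<in> F" "x \<otimes> word G a b u = x \<otimes> word G a b v"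
        then have "word G a b u = word G a b v" using ab F(2) by (auto simp: subset_iff)
        then show "u = v" using ab(3) a by (simp add: U_def)
      qed
    qed (use F in auto)
    finally have sum: "(\<Sum>u\<in>U. card {x \<in> F. x \<otimes> word G a b u \<in> F}) \<le> card F * card F"
      by (simp add: card_cartesian_product)
    \<comment> \<open>Averaging over the \<open>2 ^ k\<close> words, of which there are at least
      \<open>2 * card F\<close>, gives a word that keeps at most half of the points inside.\<close>
    have "\<exists>u\<in>U. 2 * card {x \<in> F. x \<otimes> word G a b u \<in> F} \<le> card F"
    proof (rule ccontr)
      assume "\<not> ?thesis"
      then have "(\<Sum>u\<in>U. card F) < (\<Sum>u\<in>U. 2 * card {x \<in> F. x \<otimes> word G a b u \<in> F})"
        using U by (intro sum_strict_mono) auto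
      also have "\<dots> = 2 * (\<Sum>u\<in>U. card {x \<in> F. x \<otimes> word G a b u \<in> F})" by (simp add: sum_distrib_left)
      also have "\<dots> \<le> 2 * (card F * card F)" using sum by simp
      also have "\<dots> \<le> 2 ^ k * card F" using k by (simp add: mult.assoc[symmetric])
      finally show False using U by simp
    qed
    then obtain u where u: "u \<in> U" "2 * card {x \<in> F. x \<otimes> word G a b u \<in> F} \<le> card F" by blast
    have "card F \<le> card ({x \<in> F. x \<otimes> word G a b u \<in> F} \<union> {x \<in> F. x \<otimes> word G a b u \<notin> F})"
      using F(1) by (intro card_mono) auto
    also have "\<dots> \<le> card {x \<in> F. x \<otimes> word G a b u \<in> F} + disp G F (word G a b u)"
      unfolding disp_def by (rule card_Un_le)
    finally have "card F \<le> 2 * disp G F (word G a b u)" using u(2) by linarith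
    moreover have "real (disp G F (word G a b u)) \<le> real k * l * bd G T F"
      using disp_word[OF F ab(1,2) le, of u] u(1) by (simp add: U_def)
    ultimately show ?thesis by linarith
  qed
  then show ?thesis using l by blast
qed

text \<open>For each generator, a point leaving its part either leaves \<open>F\<close> or has its
  edge cut. The set of cut points does not depend on the generator, hence the factor
  \<open>card T\<close>.\<close>

lemma bd_cut:
  assumes F: "finite F" and A: "A \<subseteq> F" and T: "finite T"
  shows "bd G T A + bd G T (F - A) \<le> bd G T F +
    real (card T) * real (card {x \<in> F. \<exists>y\<in>F. (\<exists>s\<in>T. y = x \<otimes> s) \<and> (x \<in> A) \<noteq> (y \<in> A)})"
proof -
  let ?C = "{x \<in> F. \<exists>y\<in>F. (\<exists>s\<in>T. y = x \<otimes> s) \<and> (x \<in> A) \<noteq> (y \<in> A)}"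
  have "real (disp G A s) + real (disp G (F - A) s) \<le> real (disp G F s) + real (card ?C)" if s: "s \<in> T" for s
  proof -
    have "disp G A s + disp G (F - A) s = card ({x \<in> A. x \<otimes> s \<notin> A} \<union> {x \<in> F - A. x \<otimes> s \<notin> F - A})"
      unfolding disp_def using F A by (subst card_Un_disjoint) (auto intro: finite_subset)
    also have "\<dots> \<le> card ({x \<in> F. x \<otimes> s \<notin> F} \<union> ?C)"
      using F A s by (intro card_mono) auto
    also have "\<dots> \<le> disp G F s + card ?C" unfolding disp_def by (rule card_Un_le)
    finally show ?thesis by linarith
  qed
  then have "(\<Sum>s\<in>T. real (disp G A s) + real (disp G (F - A) s)) \<le> (\<Sum>s\<in>T. real (disp G F s) + real (card ?C))"
    by (rule sum_mono)
  then show ?thesis by (simp add: bd_def sum.distrib)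
qed

end

text \<open>The choice of \<open>M\<close> near \<open>n powr (1 / (d + 1))\<close> balances the two
  terms. Rounding up at most doubles \<open>M\<close>, which accounts for
  \<open>2 ^ d\<close>.\<close>

lemma cut_rate:
  fixes C :: real and d n :: nat
  assumes "n \<ge> 1" "C \<ge> 0"
  obtains M :: nat where "M \<ge> 1"
    "C * real M ^ d + real n / real M \<le> (C * 2 ^ d + 1) * real n * real n powr (- 1 / (real d + 1))"
proof -
  define e where "e = 1 / (real d + 1)"
  have e: "e > 0" by (simp add: e_def)
  define y where "y = real n powr e"
  have y: "y \<ge> 1" using assms(1) e by (simp add: y_def ge_one_powr_ge_zero)
  define M where "M = nat \<lceil>y\<rceil>"
  have M: "real M \<ge> y" "real M \<le> 2 * y" "M \<ge> 1" using y unfolding M_def by linarith+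
  have yd: "y ^ d * y = real n"
  proof -
    have "y ^ d * y = y powr (real d + 1)" using y by (simp add: powr_add powr_realpow)
    also have "\<dots> = real n powr (e * (real d + 1))" by (simp add: y_def powr_powr)
    also have "e * (real d + 1) = 1" by (simp add: e_def)
    finally show ?thesis using assms(1) by simp
  qed
  have ny: "real n / y = y ^ d" using yd y by (simp add: field_simps)
  have "C * real M ^ d \<le> C * (2 * y) ^ d" using M assms(2) by (intro mult_left_mono power_mono) auto
  also have "\<dots> = C * 2 ^ d * (real n / y)" unfolding ny by (simp add: power_mult_distrib)
  finally have 1: "C * real M ^ d \<le> C * 2 ^ d * (real n / y)" .
  have 2: "real n / real M \<le> real n / y" using M y by (intro divide_left_mono) auto
  have "real n powr (- 1 / (real d + 1)) = inverse y" by (simp add: y_def e_def powr_minus)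
  then have "(C * 2 ^ d + 1) * real n * real n powr (- 1 / (real d + 1)) = (C * 2 ^ d + 1) * (real n / y)"
    by (simp add: divide_inverse)
  moreover have "C * real M ^ d + real n / real M \<le> (C * 2 ^ d + 1) * (real n / y)"
    unfolding distrib_right mult_1_left using 1 2 by (rule add_mono)
  ultimately show thesis using that[of M] M(3) by simp
qed

context group
begin

text \<open>
  Cutting a set and keeping the part with the smaller boundary ratio, until the size drops to \<open>N\<close>,
  increases the ratio by a convergent geometric sum only, since the sizes decrease geometrically.
\<close>

lemma cut_descent:
  fixes \<epsilon> K c N :: real
  assumes \<epsilon>: "\<epsilon> > 0" and K: "K \<ge> 2" and c: "c \<ge> 0" and N: "N \<ge> 1"
    and cuts: "\<And>F. finite F \<Longrightarrow> F \<subseteq> carrier G \<Longrightarrow> real (card F) \<ge> N \<Longrightarrow>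
      \<exists>A\<subseteq>F. real (card F) \<le> K * real (card A) \<and> 2 * real (card A) \<le> real (card F) \<and>
        bd G T A + bd G T (F - A) \<le> bd G T F + c * real (card F) * real (card F) powr (- \<epsilon>)"
    and F: "finite F" "F \<subseteq> carrier G" "N / K \<le> real (card F)"
  shows "\<exists>F'. finite F' \<and> F' \<subseteq> carrier G \<and> N / K \<le> real (card F') \<and> real (card F') \<le> N \<and>
    bd G T F' / real (card F') \<le> bd G T F / real (card F) +
      c / ((1 - 1 / K) powr (- \<epsilon>) - 1) * (real (card F') powr (- \<epsilon>) - real (card F) powr (- \<epsilon>))"
  using F
proof (induction "card F" arbitrary: F rule: less_induct)
  case less
  define q where "q = 1 - 1 / K"
  have q: "0 < q" "q < 1" "1 / 2 \<le> q" using K by (auto simp: q_def field_simps)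
  \<comment> \<open>Chosen so that the cost \<open>c n powr (- \<epsilon>)\<close> of one cut is at
    most \<open>D\<close> times the increase of the power \<open>- \<epsilon>\<close> of the size
    when the size shrinks by at least the factor \<open>q\<close>. The costs then telescope.\<close>
  define D where "D = c / (q powr (- \<epsilon>) - 1)"
  have q1: "q powr (- \<epsilon>) > 1" using q \<epsilon> powr_less_mono2_neg[of "- \<epsilon>" q 1] by simp
  have D: "D \<ge> 0" "D * (q powr (- \<epsilon>) - 1) = c" using q1 c by (simp_all add: D_def)
  have NK: "N / K > 0" using N K by simp
  show ?case
  proof (cases "real (card F) \<le> N")
    case True
    then show ?thesis using less by (intro exI[of _ F]) auto
  next
    case False
    let ?n = "real (card F)"
    have n: "?n > N" "?n \<ge> 1" using False N by auto
    obtain A where A: "A \<subseteq> F" "?n \<le> K * real (card A)" "2 * real (card A) \<le> ?n"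
      "bd G T A + bd G T (F - A) \<le> bd G T F + c * ?n * ?n powr (- \<epsilon>)"
      using cuts[OF less(2,3)] n(1) by auto
    let ?A = "real (card A)" and ?B = "real (card (F - A))"
    have fA: "finite A" using A(1) less(2) finite_subset by blast
    have AB: "?A + ?B = ?n" using A(1) less(2) fA card_Diff_subset[OF fA A(1)] card_mono[OF less(2) A(1)]
      by (simp add: of_nat_diff)
    have Apos: "?A \<ge> ?n / K" using A(2) K by (simp add: pos_divide_le_eq mult.commute)
    have nK: "?n / K > 0" using n K by simp
    have n2: "?n / K \<le> ?n / 2" using K by (intro divide_left_mono) auto
    have Bpos: "?B \<ge> ?n / K" using AB A(3) n2 by linarith
    have qn: "q * ?n = ?n - ?n / K" using K by (simp add: q_def algebra_simps)
    have le: "?A \<le> q * ?n" "?B \<le> q * ?n" using AB Apos Bpos unfolding qn by linarith+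
    \<comment> \<open>The ratio of the union is a weighted mean of the ratios of the parts, so one
      part does not exceed it.\<close>
    have "\<exists>E. E \<subseteq> F \<and> real (card E) \<ge> ?n / K \<and> real (card E) \<le> q * ?n \<and>
        bd G T E / real (card E) \<le> bd G T F / ?n + c * ?n powr (- \<epsilon>)"
    proof (rule ccontr)
      assume not: "\<not> ?thesis"
      define r where "r = bd G T F / ?n + c * ?n powr (- \<epsilon>)"
      have "bd G T A / ?A > r" "bd G T (F - A) / ?B > r"
        using not A(1) Apos Bpos le unfolding r_def by (meson Diff_subset not_le)+
      then have "r * ?A < bd G T A" "r * ?B < bd G T (F - A)"
        using Apos Bpos nK by (simp_all add: pos_less_divide_eq)
      then have "r * (?A + ?B) < bd G T A + bd G T (F - A)" by (simp add: distrib_left)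
      also note A(4)
      also have "bd G T F + c * ?n * ?n powr (- \<epsilon>) = r * ?n"
        using n by (simp add: r_def distrib_right)
      finally show False unfolding AB by simp
    qed
    then obtain E where E: "E \<subseteq> F" "real (card E) \<ge> ?n / K" "real (card E) \<le> q * ?n"
        "bd G T E / real (card E) \<le> bd G T F / ?n + c * ?n powr (- \<epsilon>)" by blast
    have "q * ?n < ?n" using q n by simp
    then have cE: "card E < card F" using E(3) by linarith
    have "N / K \<le> ?n / K" using n K by (intro divide_right_mono) auto
    then have NE: "N / K \<le> real (card E)" using E(2) by linarith
    have Epos: "real (card E) > 0" using NE NK by linarith
    have "finite E" "E \<subseteq> carrier G" using E(1) less(2,3) finite_subset by auto
    from less(1)[OF cE this NE, folded q_def, folded D_def]
    obtain F' where F': "finite F'" "F' \<subseteq> carrier G" "N / K \<le> real (card F')" "real (card F') \<le> N"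
      "bd G T F' / real (card F') \<le> bd G T E / real (card E) +
        D * (real (card F') powr (- \<epsilon>) - real (card E) powr (- \<epsilon>))"
      by (elim exE conjE) (rule that)
    have "(q * ?n) powr (- \<epsilon>) \<le> real (card E) powr (- \<epsilon>)"
      using E(3) Epos \<epsilon> by (intro powr_mono2') auto
    then have "q powr (- \<epsilon>) * ?n powr (- \<epsilon>) \<le> real (card E) powr (- \<epsilon>)"
      using q n by (simp add: powr_mult)
    then have "D * (q powr (- \<epsilon>) * ?n powr (- \<epsilon>)) \<le> D * real (card E) powr (- \<epsilon>)"
      using D(1) by (rule mult_left_mono)
    moreover have "c * ?n powr (- \<epsilon>) = D * (q powr (- \<epsilon>) * ?n powr (- \<epsilon>)) - D * ?n powr (- \<epsilon>)"
      unfolding D(2)[symmetric] by (simp add: algebra_simps)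
    ultimately have "c * ?n powr (- \<epsilon>) \<le> D * real (card E) powr (- \<epsilon>) - D * ?n powr (- \<epsilon>)" by linarith
    then have "bd G T F' / real (card F') \<le> bd G T F / ?n +
        D * (real (card F') powr (- \<epsilon>) - ?n powr (- \<epsilon>))"
      using F'(5) E(4) by (simp add: right_diff_distrib)
    then show ?thesis using F' unfolding D_def q_def by blast
  qed
qed

lemma no_free_semigroup_of_cuts:
  fixes C K n0 :: real and d :: nat
  assumes S: "finite S" "S \<subseteq> carrier G" "generate G S = carrier G" and T: "T = S \<union> m_inv G ` S"
    and folner: "folner G (carrier G)"
    and C: "C \<ge> 0" and K: "K \<ge> 2"
    and cuts: "\<And>F M. finite F \<Longrightarrow> F \<subseteq> carrier G \<Longrightarrow> F \<noteq> {} \<Longrightarrow> real (card F) \<ge> n0 \<Longrightarrow> (M::nat) \<ge> 1 \<Longrightarrow>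
      \<exists>A\<subseteq>F. real (card F) \<le> K * real (card A) \<and> 2 * real (card A) \<le> real (card F) \<and>
        real (card {x \<in> F. \<exists>y\<in>F. (\<exists>s\<in>T. y = x \<otimes> s) \<and> (x \<in> A) \<noteq> (y \<in> A)})
          \<le> C * real M ^ d + real (card F) / real M"
  shows "no_free_semigroup G (carrier G)"
proof (rule ccontr)
  assume free: "\<not> no_free_semigroup G (carrier G)"
  have fT: "finite T" "T \<subseteq> carrier G" using S T by auto
  define \<epsilon> where "\<epsilon> = 1 / (real d + 1)"
  have \<epsilon>: "\<epsilon> > 0" by (simp add: \<epsilon>_def)
  define c where "c = real (card T) * (C * 2 ^ d + 1)"
  have c: "c \<ge> 0" using C by (simp add: c_def)
  have cuts': "\<exists>A\<subseteq>F. real (card F) \<le> K * real (card A) \<and> 2 * real (card A) \<le> real (card F) \<and>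
        bd G T A + bd G T (F - A) \<le> bd G T F + c * real (card F) * real (card F) powr (- \<epsilon>)"
    if F: "finite F" "F \<subseteq> carrier G" and n: "real (card F) \<ge> max 1 n0" for F
  proof -
    have n1: "card F \<ge> 1" using n by simp
    then have ne: "F \<noteq> {}" by auto
    obtain M where M: "M \<ge> 1" "C * real M ^ d + real (card F) / real M
        \<le> (C * 2 ^ d + 1) * real (card F) * real (card F) powr (- 1 / (real d + 1))"
      using cut_rate[OF n1 C] by blast
    obtain A where A: "A \<subseteq> F" "real (card F) \<le> K * real (card A)" "2 * real (card A) \<le> real (card F)"
      "real (card {x \<in> F. \<exists>y\<in>F. (\<exists>s\<in>T. y = x \<otimes> s) \<and> (x \<in> A) \<noteq> (y \<in> A)})
          \<le> C * real M ^ d + real (card F) / real M"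
      using cuts[OF F ne _ M(1)] n by auto
    have "real (card T) * real (card {x \<in> F. \<exists>y\<in>F. (\<exists>s\<in>T. y = x \<otimes> s) \<and> (x \<in> A) \<noteq> (y \<in> A)})
        \<le> real (card T) * ((C * 2 ^ d + 1) * real (card F) * real (card F) powr (- 1 / (real d + 1)))"
      using A(4) M(2) by (intro mult_left_mono) auto
    also have "\<dots> = c * real (card F) * real (card F) powr (- \<epsilon>)" by (simp add: c_def \<epsilon>_def)
    finally show ?thesis using bd_cut[OF F(1) A(1) fT(1)] A by (intro exI[of _ A]) auto
  qed
  obtain l where l: "l > 0" "\<And>F k. finite F \<Longrightarrow> F \<subseteq> carrier G \<Longrightarrow> 2 * card F \<le> 2 ^ k \<Longrightarrow>
      real (card F) \<le> 2 * real k * l * bd G T F"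
    using isoperimetry[OF fT(1) _ S(2,3) free] T by blast
  define D where "D = c / ((1 - 1 / K) powr (- \<epsilon>) - 1)"
  have D: "D \<ge> 0"
  proof -
    have "(1 - 1 / K) powr (- \<epsilon>) \<ge> 1"
      using powr_mono2'[of "- \<epsilon>" "1 - 1 / K" 1] K \<epsilon> by (simp add: field_simps)
    then show ?thesis using c by (simp add: D_def)
  qed
  have key: "1 / (4 * real (Suc j) * l) \<le> D * (2 ^ j / K) powr (- \<epsilon>)" if j: "2 ^ j \<ge> max 1 n0" for j
  proof -
    define N :: real where "N = 2 ^ j"
    have N: "N \<ge> 1" "N \<ge> max 1 n0" using j by (simp_all add: N_def)
    \<comment> \<open>Half the boundary ratio that \<open>isoperimetry\<close> with
      \<open>k = Suc j\<close> forces on nonempty sets of at most \<open>N\<close> points. The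
      Folner set gets ratio at most \<eta>, and the other \<eta> has to be paid by cutting.\<close>
    define \<eta> where "\<eta> = 1 / (4 * real (Suc j) * l)"
    have \<eta>: "\<eta> > 0" using l by (simp add: \<eta>_def)
    have iso: "2 * \<eta> \<le> bd G T F / real (card F)"
      if F: "finite F" "F \<subseteq> carrier G" "F \<noteq> {}" "real (card F) \<le> N" for F
    proof -
      have "real (2 * card F) \<le> real (2 ^ Suc j)" using F(4) by (simp add: N_def)
      then have "2 * card F \<le> 2 ^ Suc j" by (simp only: of_nat_le_iff)
      from l(2)[OF F(1,2) this]
      have "real (card F) \<le> 2 * real (Suc j) * l * bd G T F" .
      moreover have q: "2 * real (Suc j) * l > 0" using l(1) by simp
      ultimately have "real (card F) / (2 * real (Suc j) * l) \<le> bd G T F"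
        by (simp only: pos_divide_le_eq mult.commute)
      then have "real (card F) / (2 * real (Suc j) * l) / real (card F) \<le> bd G T F / real (card F)"
        by (intro divide_right_mono) auto
      moreover have "real (card F) > 0" using F by (simp add: card_gt_0_iff)
      ultimately have "1 / (2 * real (Suc j) * l) \<le> bd G T F / real (card F)" by simp
      moreover have "2 * (1 / (4 * x)) = 1 / (2 * x)" for x :: real by simp
      from this[of "real (Suc j) * l"] have "2 * \<eta> = 1 / (2 * real (Suc j) * l)"
        by (simp only: \<eta>_def mult.assoc)
      ultimately show ?thesis by (simp only:)
    qed
    obtain F where F: "finite F" "F \<noteq> {}" "F \<subseteq> carrier G"
      "\<And>s. s \<in> T \<Longrightarrow> real (card {x \<in> F. x \<otimes> s \<notin> F}) \<le> \<eta> / (real (card T) + 1) * real (card F)"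
      using folnerE[OF folner fT, of "\<eta> / (real (card T) + 1)"] \<eta> by auto
    have "bd G T F \<le> real (card T) * (\<eta> / (real (card T) + 1) * real (card F))"
      unfolding bd_def disp_def by (rule sum_bounded_above) (rule F(4))
    also have "\<dots> = (real (card T) / (real (card T) + 1)) * (\<eta> * real (card F))" by simp
    also have "\<dots> \<le> 1 * (\<eta> * real (card F))" using \<eta> by (intro mult_right_mono) auto
    finally have "bd G T F \<le> \<eta> * real (card F)" by simp
    moreover have Fpos: "real (card F) > 0" using F by (simp add: card_gt_0_iff)
    ultimately have rF: "bd G T F / real (card F) \<le> \<eta>" by (simp add: pos_divide_le_eq)
    \<comment> \<open>A ratio of at most \<eta> violates the isoperimetric bound at sizes up to
      \<open>N\<close>, so the Folner set is automatically large enough to be cut down.\<close>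
    have "real (card F) > N"
    proof (rule ccontr)
      assume "\<not> ?thesis"
      then have "2 * \<eta> \<le> bd G T F / real (card F)" using iso[OF F(1,3,2)] by simp
      then show False using rF \<eta> by linarith
    qed
    moreover have "N / K \<le> N" using K N by (simp add: field_simps)
    ultimately have "N / K \<le> real (card F)" by linarith
    note NF = this
    have cutsN: "\<exists>A\<subseteq>F. real (card F) \<le> K * real (card A) \<and> 2 * real (card A) \<le> real (card F) \<and>
        bd G T A + bd G T (F - A) \<le> bd G T F + c * real (card F) * real (card F) powr (- \<epsilon>)"
      if "finite F" "F \<subseteq> carrier G" "real (card F) \<ge> N" for F
      by (rule cuts'[OF that(1,2) order_trans[OF N(2) that(3)]])
    have "\<exists>F'. finite F' \<and> F' \<subseteq> carrier G \<and> N / K \<le> real (card F') \<and> real (card F') \<le> N \<and>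
      bd G T F' / real (card F') \<le> bd G T F / real (card F) +
        D * (real (card F') powr (- \<epsilon>) - real (card F) powr (- \<epsilon>))"
      unfolding D_def by (rule cut_descent[OF \<epsilon> K c N(1) cutsN F(1,3) NF])
    then obtain F' where F': "finite F'" "F' \<subseteq> carrier G" "N / K \<le> real (card F')" "real (card F') \<le> N"
      "bd G T F' / real (card F') \<le> bd G T F / real (card F) +
        D * (real (card F') powr (- \<epsilon>) - real (card F) powr (- \<epsilon>))"
      by (elim exE conjE) (rule that)
    have NK: "N / K > 0" using N K by simp
    then have "F' \<noteq> {}" using F'(3) by auto
    then have "2 * \<eta> \<le> bd G T F' / real (card F')" using iso F' by blast
    moreover have "D * (real (card F') powr (- \<epsilon>) - real (card F) powr (- \<epsilon>)) \<le> D * (N / K) powr (- \<epsilon>)"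
    proof (rule mult_left_mono[OF _ D])
      have "real (card F') powr (- \<epsilon>) \<le> (N / K) powr (- \<epsilon>)"
        using NK F'(3) \<epsilon> by (intro powr_mono2') auto
      then show "real (card F') powr (- \<epsilon>) - real (card F) powr (- \<epsilon>) \<le> (N / K) powr (- \<epsilon>)"
        using powr_ge_zero[of "real (card F)" "- \<epsilon>"] by linarith
    qed
    ultimately have "\<eta> \<le> D * (N / K) powr (- \<epsilon>)" using F'(5) rF by linarith
    then show ?thesis by (simp add: \<eta>_def N_def)
  qed
  \<comment> \<open>The scale is \<open>2 ^ j\<close>: isoperimetry decays like
    \<open>1 / j\<close>, the cutting cost exponentially in \<open>j\<close>, so \<open>key\<close>
    fails for large \<open>j\<close>.\<close>
  have "(\<lambda>j::nat. 4 * real (Suc j) * l * (D * (2 ^ j / K) powr (- \<epsilon>))) \<longlonglongrightarrow> 0"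
    using \<epsilon> K by real_asymp
  then have "\<forall>\<^sub>F j in sequentially. 4 * real (Suc j) * l * (D * (2 ^ j / K) powr (- \<epsilon>)) < 1"
    by (rule order_tendstoD) simp
  moreover have "\<forall>\<^sub>F j in sequentially. (2::real) ^ j \<ge> max 1 n0"
    by real_asymp
  ultimately have "\<forall>\<^sub>F j in sequentially. False"
  proof eventually_elim
    case (elim j)
    have "1 / (4 * real (Suc j) * l) \<le> D * (2 ^ j / K) powr (- \<epsilon>)" using key[OF elim(2)] .
    moreover define x where "x = 4 * real (Suc j) * l"
    moreover have "x > 0" using l(1) by (simp add: x_def)
    ultimately have "1 \<le> (D * (2 ^ j / K) powr (- \<epsilon>)) * x" by (simp add: pos_divide_le_eq)
    then show False using elim(1) unfolding x_def[symmetric] by (simp add: mult.commute)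
  qed
  then show False by simp
qed

end

section \<open>Separating finite sets of points in a half-space\<close>

lemma card_le_fibres:
  assumes "finite A" "finite C" "c ` A \<subseteq> C" "\<And>z. z \<in> C \<Longrightarrow> real (card {a \<in> A. c a = z}) \<le> b"
  shows "real (card A) \<le> real (card C) * b"
proof -
  have "A = (\<Union>z\<in>C. {a \<in> A. c a = z})" using assms(3) by auto
  then have "card A \<le> (\<Sum>z\<in>C. card {a \<in> A. c a = z})" using card_UN_le[OF assms(2)] by metis
  then have "real (card A) \<le> (\<Sum>z\<in>C. real (card {a \<in> A. c a = z}))"
    by (metis of_nat_le_iff of_nat_sum)
  also have "\<dots> \<le> real (card C) * b" using sum_bounded_above[of C "\<lambda>z. real (card {a \<in> A. c a = z})" b] assms(4) by simp
  finally show ?thesis .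
qed

definition cell :: "real \<Rightarrow> real ^ 'n \<Rightarrow> 'n \<Rightarrow> int" where
  "cell s x = (\<lambda>i. \<lfloor>x $ i / s\<rfloor>)"

lemma floor_divide_eq_imp_close:
  fixes x y s :: real
  assumes "s > 0" "\<lfloor>x / s\<rfloor> = \<lfloor>y / s\<rfloor>"
  shows "\<bar>x - y\<bar> \<le> s"
proof -
  have "\<bar>x / s - y / s\<bar> < 1" using assms(2) by linarith
  then have "\<bar>(x - y) / s\<bar> < 1" by (simp add: diff_divide_distrib)
  then show ?thesis using assms(1) by (simp add: abs_divide divide_less_eq)
qed

lemma cell_eq_imp_close:
  fixes x y :: "real ^ 'n"
  assumes "s > 0" "cell s x = cell s y"
  shows "norm (x - y) \<le> real CARD('n) * s"
proof -
  have "\<bar>(x - y) $ i\<bar> \<le> s" for i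
    using floor_divide_eq_imp_close[OF assms(1), of "x $ i" "y $ i"] fun_cong[OF assms(2), of i]
    by (simp add: cell_def)
  then have "(\<Sum>i\<in>UNIV. \<bar>(x - y) $ i\<bar>) \<le> real CARD('n) * s"
    using sum_bounded_above[of UNIV "\<lambda>i. \<bar>(x - y) $ i\<bar>" s] by simp
  then show ?thesis using norm_le_l1_cart[of "x - y"] by linarith
qed

text \<open>The extra 1 allows for negative coordinates, where the floor of \<open>- r\<close> may
  be one less than \<open>- \<lfloor>r\<rfloor>\<close>.\<close>

definition cells :: "real \<Rightarrow> ('n::finite \<Rightarrow> int) set" where
  "cells r = PiE UNIV (\<lambda>_. {- (\<lfloor>r\<rfloor> + 1)..\<lfloor>r\<rfloor> + 1})"

lemma finite_cells: "finite (cells r)"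
  unfolding cells_def by (intro finite_PiE) auto

lemma card_cells:
  assumes "r \<ge> 0"
  shows "real (card (cells r :: ('n::finite \<Rightarrow> int) set)) \<le> (2 * r + 3) ^ CARD('n)"
proof -
  have "card (cells r :: ('n \<Rightarrow> int) set) = nat (2 * \<lfloor>r\<rfloor> + 3) ^ CARD('n)"
    unfolding cells_def by (subst card_PiE) (auto simp: add.commute)
  moreover have "real (nat (2 * \<lfloor>r\<rfloor> + 3)) \<le> 2 * r + 3" using assms by linarith
  ultimately show ?thesis by (simp add: power_mono)
qed

lemma cell_in_cells:
  fixes x :: "real ^ 'n"
  assumes "s > 0" "norm x \<le> \<rho>"
  shows "cell s x \<in> cells (\<rho> / s)"
proof -
  have "\<lfloor>x $ i / s\<rfloor> \<in> {- (\<lfloor>\<rho> / s\<rfloor> + 1)..\<lfloor>\<rho> / s\<rfloor> + 1}" for i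
  proof -
    have "\<bar>x $ i\<bar> \<le> \<rho>" using component_le_norm_cart[of x i] assms(2) by linarith
    then have "x $ i \<le> \<rho>" "- \<rho> \<le> x $ i" by linarith+
    then have "x $ i / s \<le> \<rho> / s" "(- \<rho>) / s \<le> x $ i / s"
      using assms(1) by (intro divide_right_mono; simp)+
    then have "x $ i / s \<le> \<rho> / s" "- (\<rho> / s) \<le> x $ i / s" by simp_all
    then show ?thesis by (simp add: le_floor_iff floor_le_iff) linarith
  qed
  then show ?thesis unfolding cells_def cell_def by auto
qed

text \<open>Only scale-invariant consequences of hyperbolic geometry are kept. By
  \<open>mult\<close>, a set of Euclidean size about \<open>s\<close> lying above height
  \<open>s\<close>, hence of bounded hyperbolic diameter, has at most \<mu> points; by
  \<open>adj\<close>, neighbours are as close as points at bounded hyperbolic distance.\<close>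

locale half_space_points =
  fixes A :: "'a set" and X :: "'a \<Rightarrow> real ^ 'n" and h :: "'a \<Rightarrow> real"
    and adj :: "'a \<Rightarrow> 'a \<Rightarrow> bool" and \<mu> L :: real
  assumes finite_A: "finite A" and h_pos: "\<And>a. a \<in> A \<Longrightarrow> h a > 0"
    and L: "L \<ge> 1"
    and mult: "\<And>B s. B \<subseteq> A \<Longrightarrow> s > 0 \<Longrightarrow> (\<And>a. a \<in> B \<Longrightarrow> s \<le> h a) \<Longrightarrow>
      (\<And>a b. a \<in> B \<Longrightarrow> b \<in> B \<Longrightarrow> norm (X a - X b) \<le> real CARD('n) * s \<and> \<bar>h a - h b\<bar> \<le> s) \<Longrightarrow>
      real (card B) \<le> \<mu>"
    and adj: "\<And>a b. a \<in> A \<Longrightarrow> b \<in> A \<Longrightarrow> adj a b \<Longrightarrow>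
      norm (X a - X b) \<le> L * h a \<and> norm (X a - X b) \<le> L * h b \<and> h a \<le> L * h b \<and> h b \<le> L * h a"
begin

definition box :: "real ^ 'n \<Rightarrow> real \<Rightarrow> 'a set" where
  "box x R = {a \<in> A. norm (X a - x) \<le> R \<and> h a \<le> R}"

lemma mu_nonneg: "\<mu> \<ge> 0"
  using mult[of "{}" 1] by simp

text \<open>Above height \<open>s\<close>, Euclidean cells of side \<open>s\<close> hold at most
  \<mu> points each, so it remains to count cells.\<close>

lemma card_high:
  assumes "s > 0" "\<rho> \<ge> 0" "\<eta> \<ge> 0"
  shows "real (card {a \<in> A. norm (X a - x) \<le> \<rho> \<and> s \<le> h a \<and> h a \<le> \<eta>})
    \<le> (2 * (\<rho> / s) + 3) ^ CARD('n) * (\<eta> / s + 1) * \<mu>"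
proof -
  let ?B = "{a \<in> A. norm (X a - x) \<le> \<rho> \<and> s \<le> h a \<and> h a \<le> \<eta>}"
  let ?c = "\<lambda>a. (cell s (X a - x), \<lfloor>h a / s\<rfloor>)"
  let ?C = "(cells (\<rho> / s) :: ('n \<Rightarrow> int) set) \<times> {0..\<lfloor>\<eta> / s\<rfloor>}"
  have "real (card ?B) \<le> real (card ?C) * \<mu>"
  proof (rule card_le_fibres[where c = ?c])
    show "finite ?B" using finite_A by auto
    show "finite ?C" using finite_cells by auto
    show "?c ` ?B \<subseteq> ?C"
      using assms h_pos by (auto intro!: cell_in_cells floor_mono divide_right_mono simp: less_imp_le)
    fix z
    show "real (card {a \<in> ?B. ?c a = z}) \<le> \<mu>"
    proof (rule mult[of _ s])
      fix a b assume a: "a \<in> {a \<in> ?B. ?c a = z}" and b: "b \<in> {a \<in> ?B. ?c a = z}"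
      then have "cell s (X a - x) = cell s (X b - x)" "\<lfloor>h a / s\<rfloor> = \<lfloor>h b / s\<rfloor>" by auto
      then show "norm (X a - X b) \<le> real CARD('n) * s \<and> \<bar>h a - h b\<bar> \<le> s"
        using cell_eq_imp_close[OF assms(1), of "X a - x" "X b - x"]
          floor_divide_eq_imp_close[OF assms(1), of "h a" "h b"] by simp
    qed (use assms in auto)
  qed
  also have "\<dots> \<le> ((2 * (\<rho> / s) + 3) ^ CARD('n) * (\<eta> / s + 1)) * \<mu>"
  proof (rule mult_right_mono[OF _ mu_nonneg])
    have "0 \<le> \<eta> / s" using assms by simp
    then have "0 \<le> \<lfloor>\<eta> / s\<rfloor>" by simp
    then have "real (nat (\<lfloor>\<eta> / s\<rfloor> + 1)) \<le> \<eta> / s + 1" by linarith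
    then show "real (card ?C) \<le> (2 * (\<rho> / s) + 3) ^ CARD('n) * (\<eta> / s + 1)"
      using card_cells[of "\<rho> / s"] assms by (auto simp: card_cartesian_product intro!: mult_mono)
  qed
  finally show ?thesis .
qed

text \<open>Near the boundary cells are useless, as their points are not bounded in number. The
  region is covered by columns instead, each contained in one box of radius \<sigma>.\<close>

lemma card_low:
  assumes "\<sigma> > 0" "\<rho> \<ge> 0" "\<And>y. real (card (box y \<sigma>)) \<le> q"
  shows "real (card {a \<in> A. norm (X a - x) \<le> \<rho> \<and> h a \<le> \<sigma>})
    \<le> (2 * (\<rho> * real CARD('n) / \<sigma>) + 3) ^ CARD('n) * q"
proof -
  let ?B = "{a \<in> A. norm (X a - x) \<le> \<rho> \<and> h a \<le> \<sigma>}"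
  \<comment> \<open>\<open>cell_eq_imp_close\<close> loses a factor \<open>CARD('n)\<close>;
    dividing by it makes a column fit into a box of radius \<sigma>.\<close>
  define s where "s = \<sigma> / real CARD('n)"
  have s: "s > 0" using assms(1) by (simp add: s_def)
  let ?c = "\<lambda>a. cell s (X a - x)"
  have q: "q \<ge> 0" using assms(3)[of 0] by linarith
  have "real (card ?B) \<le> real (card (cells (\<rho> / s) :: ('n \<Rightarrow> int) set)) * q"
  proof (rule card_le_fibres[where c = ?c])
    show "finite ?B" using finite_A by auto
    show "finite (cells (\<rho> / s) :: ('n \<Rightarrow> int) set)" using finite_cells by auto
    show "?c ` ?B \<subseteq> cells (\<rho> / s)" using s by (auto intro!: cell_in_cells)
    fix z
    show "real (card {a \<in> ?B. ?c a = z}) \<le> q"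
    proof (cases "{a \<in> ?B. ?c a = z} = {}")
      case True
      then show ?thesis using q by (simp only: card.empty)
    next
      case False
      then obtain b where b: "b \<in> ?B" "?c b = z" by blast
      have "{a \<in> ?B. ?c a = z} \<subseteq> box (X b) \<sigma>"
      proof
        fix a assume a: "a \<in> {a \<in> ?B. ?c a = z}"
        then have "norm (X a - X b) \<le> real CARD('n) * s"
          using cell_eq_imp_close[OF s, of "X a - x" "X b - x"] b by simp
        then show "a \<in> box (X b) \<sigma>" using a by (simp add: box_def s_def)
      qed
      then have "card {a \<in> ?B. ?c a = z} \<le> card (box (X b) \<sigma>)"
        using finite_A by (intro card_mono) (auto simp: box_def)
      then show ?thesis using assms(3)[of "X b"] by linarith
    qed
  qed
  also have "\<dots> \<le> (2 * (\<rho> / s) + 3) ^ CARD('n) * q"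
    using card_cells[of "\<rho> / s"] assms s by (intro mult_right_mono[OF _ q]) simp
  finally show ?thesis by (simp add: s_def)
qed

text \<open>Radii are doubled from one below every height, where all boxes are empty, until a box
  holds the proportion \<open>1 / K\<close> of \<open>A\<close>. At the first such radius all boxes
  of half the radius are still light.\<close>

lemma critical_box:
  assumes "A \<noteq> {}" "K \<ge> 1"
  obtains x R where "R > 0" "K * real (card (box x R)) \<ge> real (card A)"
    "\<And>y. K * real (card (box y (R / 2))) < real (card A)"
proof -
  define r0 where "r0 = Min (h ` A) / 2"
  have r0: "r0 > 0" using assms(1) finite_A h_pos by (simp add: r0_def)
  have r0h: "r0 < h a" if "a \<in> A" for a
  proof -
    have "Min (h ` A) \<le> h a" using that finite_A by simp
    then show ?thesis using r0 by (simp add: r0_def)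
  qed
  have n: "card A > 0" using assms(1) finite_A by (simp add: card_gt_0_iff)
  define P where "P j \<longleftrightarrow> (\<exists>x. K * real (card (box x (r0 * 2 ^ j))) \<ge> real (card A))" for j :: nat
  have "box x (r0 * 2 ^ 0) = {}" for x using r0h by (force simp: box_def)
  then have P0: "\<not> P 0" using n by (simp add: P_def)
  have "\<exists>j. P j"
  proof -
    define B where "B = (\<Sum>a\<in>A. norm (X a) + h a)"
    obtain j where j: "B / r0 < 2 ^ j" using real_arch_pow[of 2 "B / r0"] by auto
    then have B: "B < r0 * 2 ^ j" using r0 by (simp add: pos_divide_less_eq mult.commute)
    have "a \<in> box 0 (r0 * 2 ^ j)" if a: "a \<in> A" for a
    proof -
      have "norm (X a) + h a \<le> B"
        unfolding B_def using a finite_A h_pos by (intro member_le_sum) (auto simp: less_imp_le)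
      then have "norm (X a) \<le> r0 * 2 ^ j" "h a \<le> r0 * 2 ^ j"
        using B h_pos[OF a] norm_ge_zero[of "X a"] by linarith+
      then show ?thesis using a by (simp add: box_def)
    qed
    then have "box 0 (r0 * 2 ^ j) = A" by (auto simp: box_def)
    moreover have "real (card A) \<le> K * real (card A)" using assms(2) n by simp
    ultimately show ?thesis unfolding P_def by metis
  qed
  then obtain j where j: "P j" "\<And>i. i < j \<Longrightarrow> \<not> P i" using exists_least_iff[of P] by auto
  have "j \<noteq> 0" using j(1) P0 by metis
  then obtain i where i: "j = Suc i" by (metis not0_implies_Suc)
  obtain x where x: "K * real (card (box x (r0 * 2 ^ j))) \<ge> real (card A)" using j(1) by (auto simp: P_def)
  have "r0 * 2 ^ j / 2 = r0 * 2 ^ i" by (simp add: i)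
  then have "K * real (card (box y (r0 * 2 ^ j / 2))) < real (card A)" for y
    using j(2)[of i] i by (auto simp: P_def not_le)
  then show thesis using that[of "r0 * 2 ^ j" x] x r0 by simp
qed

text \<open>
  The critical box of the previous lemma, doubled, is covered by boundedly many boxes of half its size
  and boundedly many points near the top, so all boxes in between are balanced.  Among \<open>M\<close> of them with
  evenly spaced radii, one has few low points near its boundary; the high points are few anyway.
\<close>

theorem balanced_cut:
  fixes M :: nat
  defines "N \<equiv> CARD('n)"
  defines "K \<equiv> 4 * (8 * real N + 3) ^ N"
  assumes large: "real (card A) \<ge> 20 * 11 ^ N * \<mu>" and "A \<noteq> {}" and M: "M \<ge> 1"
  obtains A1 where "A1 \<subseteq> A" "real (card A) \<le> K * real (card A1)" "2 * real (card A1) \<le> real (card A)"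
    "real (card {a \<in> A. \<exists>b\<in>A. adj a b \<and> (a \<in> A1) \<noteq> (b \<in> A1)})
      \<le> (12 * (1 + L\<^sup>2) * L + 3) ^ N * (6 * L\<^sup>2 + 1) * \<mu> * real M ^ (N + 1) + real (card A) / real M"
proof -
  have K: "K \<ge> 1"
  proof -
    have "1 \<le> (8 * real N + 3) ^ N" by (intro one_le_power) simp
    then show ?thesis unfolding K_def by linarith
  qed
  obtain x R0 where R0: "R0 > 0" "K * real (card (box x R0)) \<ge> real (card A)"
    "\<And>y. K * real (card (box y (R0 / 2))) < real (card A)"
    using critical_box[OF \<open>A \<noteq> {}\<close> K] by blast
  \<comment> \<open>The low part is covered by \<open>(8 * N + 3) ^ N\<close> light boxes, which by
    the choice of \<open>K\<close> hold at most a quarter of \<open>A\<close>; the high part has at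
    most \<open>5 * 11 ^ N * \<mu>\<close> points, a quarter again by \<open>large\<close>.\<close>
  have upper: "2 * real (card (box x (2 * R0))) \<le> real (card A)"
  proof -
    let ?low = "{a \<in> A. norm (X a - x) \<le> 2 * R0 \<and> h a \<le> R0 / 2}"
    let ?high = "{a \<in> A. norm (X a - x) \<le> 2 * R0 \<and> R0 / 2 \<le> h a \<and> h a \<le> 2 * R0}"
    have "card (box x (2 * R0)) \<le> card (?low \<union> ?high)"
      using finite_A by (intro card_mono) (auto simp: box_def)
    also have "\<dots> \<le> card ?low + card ?high" by (rule card_Un_le)
    finally have "real (card (box x (2 * R0))) \<le> real (card ?low) + real (card ?high)" by linarith
    moreover have "real (card ?low) \<le> (2 * (2 * R0 * real N / (R0 / 2)) + 3) ^ N * (real (card A) / K)"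
      unfolding N_def
    proof (rule card_low)
      show "real (card (box y (R0 / 2))) \<le> real (card A) / K" for y
        using R0(3)[of y] K by (simp add: pos_le_divide_eq mult.commute)
    qed (use R0 in auto)
    moreover have "(2 * (2 * R0 * real N / (R0 / 2)) + 3) ^ N * (real (card A) / K) = real (card A) / 4"
      using R0(1) by (simp add: K_def)
    moreover have "real (card ?high) \<le> (2 * (2 * R0 / (R0 / 2)) + 3) ^ N * (2 * R0 / (R0 / 2) + 1) * \<mu>"
      unfolding N_def using R0(1) by (intro card_high) auto
    moreover have "(2 * (2 * R0 / (R0 / 2)) + 3) ^ N * (2 * R0 / (R0 / 2) + 1) * \<mu> = 5 * 11 ^ N * \<mu>"
      using R0(1) by simp
    ultimately show ?thesis using large by linarith
  qed
  \<comment> \<open>Edges at points below height \<open>\<delta> * R0\<close> have horizontal length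
    at most \<open>R0 / (3 * M)\<close>, while consecutive radii differ by \<open>R0 / M\<close>;
    the shells \<open>W i\<close> are therefore disjoint.\<close>
  define \<delta> where "\<delta> = 1 / (3 * L * real M)"
  have \<delta>: "\<delta> > 0" "L * \<delta> = 1 / (3 * real M)" "L * \<delta> \<le> 1" "\<delta> \<le> 1"
  proof -
    show "\<delta> > 0" "L * \<delta> = 1 / (3 * real M)" using L M by (simp_all add: \<delta>_def)
    then show le: "L * \<delta> \<le> 1" using M by simp
    have "1 * \<delta> \<le> L * \<delta>" using L \<open>\<delta> > 0\<close> by (intro mult_right_mono) auto
    then show "\<delta> \<le> 1" using le by linarith
  qed
  define R where "R i = R0 * (1 + real i / real M)" for i :: nat
  have R: "R0 \<le> R i" "R i \<le> 2 * R0" if "i < M" for i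
    using that R0(1) by (auto simp: R_def mult_le_cancel_left1 field_simps)
  \<comment> \<open>High endpoints of cut edges fall into \<open>Z\<close>, low ones into
    \<open>W i\<close>. A point outside the box with a neighbour \<open>b\<close> inside is within
    \<open>L * h b \<le> 2 * L * R0\<close> of it; estimating \<open>L\<close> by its square gives
    the width of \<open>Z\<close>.\<close>
  define Z where "Z = {a \<in> A. norm (X a - x) \<le> (2 + 2 * L\<^sup>2) * R0 \<and> \<delta> * R0 \<le> h a \<and> h a \<le> 2 * L * R0}"
  define W where "W i = {a \<in> A. \<bar>norm (X a - x) - R i\<bar> \<le> L * \<delta> * R0}" for i
  define cut where "cut i = {a \<in> A. \<exists>b\<in>A. adj a b \<and> (a \<in> box x (R i)) \<noteq> (b \<in> box x (R i))}" for i
  have fin: "finite Z" "finite (W i)" for i using finite_A by (auto simp: Z_def W_def)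
  have "cut i \<subseteq> Z \<union> W i" if i: "i < M" for i
  proof
    fix a assume "a \<in> cut i"
    then obtain b where ab: "a \<in> A" "b \<in> A" "adj a b" "(a \<in> box x (R i)) \<noteq> (b \<in> box x (R i))"
      by (auto simp: cut_def)
    note Ri = R[OF i]
    note ad = adj[OF ab(1-3)]
    have L2: "L \<le> L\<^sup>2" using L by (simp add: power2_eq_square)
    have tri: "norm (X a - x) \<le> norm (X b - x) + norm (X a - X b)"
      "norm (X b - x) \<le> norm (X a - x) + norm (X a - X b)"
      using norm_triangle_ineq[of "X b - x" "X a - X b"] norm_triangle_ineq[of "X a - x" "X b - X a"]
      by (simp_all add: norm_minus_commute)
    have LR: "R0 \<le> L * R0" using L R0(1) by simp
    have L2R: "L * R0 \<le> L\<^sup>2 * R0" using L2 R0(1) by simp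
    have dR: "\<delta> * R0 \<le> R0" "L * \<delta> * R0 \<le> R0" 
      using mult_right_mono[OF \<delta>(4), of R0] mult_right_mono[OF \<delta>(3), of R0] R0(1)
      by (simp_all only: mult_1_left less_imp_le)
    have e: "(2 + 2 * L\<^sup>2) * R0 = 2 * R0 + 2 * (L\<^sup>2 * R0)" "2 * L * R0 = 2 * (L * R0)" "L * (2 * R0) = 2 * (L * R0)"
      by (simp_all add: algebra_simps)
    show "a \<in> Z \<union> W i"
    proof (cases "\<delta> * R0 \<le> h a")
      case True
      have "a \<in> Z"
      proof (cases "a \<in> box x (R i)")
        case True2: True
        then have "norm (X a - x) \<le> R i" "h a \<le> R i" by (auto simp: box_def)
        then have "norm (X a - x) \<le> (2 + 2 * L\<^sup>2) * R0" "h a \<le> 2 * L * R0"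
          unfolding e using Ri LR L2R R0(1) by linarith+
        then show ?thesis using ab(1) True by (simp add: Z_def)
      next
        case False
        then have b: "norm (X b - x) \<le> R i" "h b \<le> R i" using ab(4) by (auto simp: box_def)
        have "L * h b \<le> L * (2 * R0)" using b(2) Ri L by (intro mult_left_mono) auto
        then have "L * h b \<le> 2 * (L * R0)" unfolding e .
        then have "norm (X a - x) \<le> (2 + 2 * L\<^sup>2) * R0" "h a \<le> 2 * L * R0"
          unfolding e using b tri(1) ad Ri L2R by linarith+
        then show ?thesis using ab(1) True by (simp add: Z_def)
      qed
      then show ?thesis by blast
    next
      case False
      \<comment> \<open>Both ends of such an edge lie below the top of the box, so only the side
        wall can separate them, and the edge is too short to start far from it.\<close>
      then have ha: "h a \<le> \<delta> * R0" by simp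
      then have "L * h a \<le> L * (\<delta> * R0)" using L by (intro mult_left_mono) auto
      then have Lha: "L * h a \<le> L * \<delta> * R0" by (simp add: mult.assoc)
      have "\<bar>norm (X a - x) - R i\<bar> \<le> L * \<delta> * R0"
      proof (cases "a \<in> box x (R i)")
        case True
        then have "b \<notin> box x (R i)" using ab(4) by blast
        moreover have "h b \<le> R i" using ad Lha dR Ri by linarith
        ultimately have "norm (X b - x) > R i" using ab(2) by (auto simp: box_def)
        moreover have "norm (X a - x) \<le> R i" using True by (simp add: box_def)
        ultimately show ?thesis using tri ad Lha by linarith
      next
        case False
        then have "norm (X b - x) \<le> R i" using ab(4) by (auto simp: box_def)
        moreover have "h a \<le> R i" using ha dR Ri by linarith
        then have "norm (X a - x) > R i" using False ab(1) by (auto simp: box_def)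
        ultimately show ?thesis using tri ad Lha by linarith
      qed
      then show ?thesis using ab(1) by (simp add: W_def)
    qed
  qed
  then have cut: "real (card (cut i)) \<le> real (card Z) + real (card (W i))" if "i < M" for i
  proof -
    have "card (cut i) \<le> card (Z \<union> W i)" using \<open>i < M\<close> fin by (intro card_mono \<open>\<And>i. i < M \<Longrightarrow> cut i \<subseteq> Z \<union> W i\<close>) auto
    also have "\<dots> \<le> card Z + card (W i)" by (rule card_Un_le)
    finally show ?thesis by linarith
  qed
  have disj: "W i \<inter> W j = {}" if ij: "i < j" for i j
  proof (rule ccontr)
    assume "W i \<inter> W j \<noteq> {}"
    then obtain a where "a \<in> W i" "a \<in> W j" by blast
    then have "R j - R i \<le> 2 * (L * \<delta> * R0)" by (auto simp: W_def)
    moreover have "R j - R i = R0 * ((real j - real i) / real M)"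
      by (simp add: R_def algebra_simps diff_divide_distrib)
    moreover have "R0 * (1 / real M) \<le> R0 * ((real j - real i) / real M)"
      using ij R0(1) by (intro mult_left_mono divide_right_mono) auto
    ultimately have "R0 * (1 / real M) \<le> 2 * (1 / (3 * real M) * R0)" unfolding \<delta>(2) by linarith
    then show False using R0(1) M by (simp add: field_simps)
  qed
  \<comment> \<open>Averaging over the \<open>M\<close> disjoint shells.\<close>
  have "\<exists>i<M. real (card (W i)) \<le> real (card A) / real M"
  proof (rule ccontr)
    assume "\<not> (\<exists>i<M. real (card (W i)) \<le> real (card A) / real M)"
    then have "(\<Sum>i<M. real (card A) / real M) < (\<Sum>i<M. real (card (W i)))"
      using M by (intro sum_strict_mono) (auto simp: lessThan_empty_iff)
    moreover have "(\<Sum>i<M. card (W i)) = card (\<Union>i<M. W i)"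
    proof (subst card_UN_disjoint)
      show "\<forall>i\<in>{..<M}. \<forall>j\<in>{..<M}. i \<noteq> j \<longrightarrow> W i \<inter> W j = {}"
        using disj by (metis Int_commute linorder_neqE_nat)
    qed (use fin in auto)
    moreover have "card (\<Union>i<M. W i) \<le> card A"
      using finite_A by (intro card_mono) (auto simp: W_def)
    ultimately show False using M by (simp add: of_nat_sum[symmetric] del: of_nat_sum)
  qed
  then obtain i where i: "i < M" "real (card (W i)) \<le> real (card A) / real M" by blast
  \<comment> \<open>Measured in the smallest height \<open>\<delta> * R0\<close>, the region has
    extent of order \<open>M\<close> in \<open>N\<close> horizontal directions and in the vertical
    one, whence the exponent \<open>N + 1\<close>.\<close>
  have Zle: "real (card Z) \<le> (12 * (1 + L\<^sup>2) * L + 3) ^ N * (6 * L\<^sup>2 + 1) * \<mu> * real M ^ (N + 1)"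
  proof -
    have "real (card Z) \<le> (2 * ((2 + 2 * L\<^sup>2) * R0 / (\<delta> * R0)) + 3) ^ N * (2 * L * R0 / (\<delta> * R0) + 1) * \<mu>"
      unfolding N_def Z_def using \<delta> R0(1) L by (intro card_high) auto
    also have "2 * ((2 + 2 * L\<^sup>2) * R0 / (\<delta> * R0)) + 3 = 12 * (1 + L\<^sup>2) * L * real M + 3"
      using R0(1) L M by (simp add: \<delta>_def field_simps)
    also have "2 * L * R0 / (\<delta> * R0) + 1 = 6 * L\<^sup>2 * real M + 1"
      using R0(1) L M by (simp add: \<delta>_def field_simps power2_eq_square)
    also have "(12 * (1 + L\<^sup>2) * L * real M + 3) ^ N * (6 * L\<^sup>2 * real M + 1) * \<mu>
        \<le> ((12 * (1 + L\<^sup>2) * L + 3) * real M) ^ N * ((6 * L\<^sup>2 + 1) * real M) * \<mu>"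
      using M L mu_nonneg by (intro mult_right_mono mult_mono power_mono) (auto simp: algebra_simps)
    also have "\<dots> = (12 * (1 + L\<^sup>2) * L + 3) ^ N * (6 * L\<^sup>2 + 1) * \<mu> * real M ^ (N + 1)"
      by (simp add: power_mult_distrib mult_ac)
    finally show ?thesis .
  qed
  show thesis
  proof (rule that[of "box x (R i)"])
    show "box x (R i) \<subseteq> A" by (auto simp: box_def)
    have "card (box x R0) \<le> card (box x (R i))"
      using finite_A R[OF i(1)] by (intro card_mono) (auto simp: box_def)
    then have "K * real (card (box x R0)) \<le> K * real (card (box x (R i)))" using K by simp
    then show "real (card A) \<le> K * real (card (box x (R i)))" using R0(2) by linarith
    have "card (box x (R i)) \<le> card (box x (2 * R0))"
      using finite_A R[OF i(1)] by (intro card_mono) (auto simp: box_def)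
    then show "2 * real (card (box x (R i))) \<le> real (card A)" using upper by linarith
    show "real (card {a \<in> A. \<exists>b\<in>A. adj a b \<and> (a \<in> box x (R i)) \<noteq> (b \<in> box x (R i))})
      \<le> (12 * (1 + L\<^sup>2) * L + 3) ^ N * (6 * L\<^sup>2 + 1) * \<mu> * real M ^ (N + 1) + real (card A) / real M"
      using cut[OF i(1)] i(2) Zle by (simp add: cut_def)
  qed
qed

end

section \<open>Hyperbolic estimates\<close>

lemma cosh_dist_le:
  fixes p q :: "'n::finite hyperbolic_space"
  assumes "dist p q \<le> l"
  shows "(norm (coords p - coords q))\<^sup>2 \<le> 2 * height p * height q * (cosh l - 1)"
proof -
  have "cosh (dist p q) \<le> cosh l" using assms by (subst cosh_real_nonneg_le_iff) (auto intro: order_trans[OF zero_le_dist])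
  then have "(norm (coords p - coords q))\<^sup>2 / (2 * height p * height q) \<le> cosh l - 1"
    unfolding cosh_hyperbolic_dist by simp
  moreover have "2 * height p * height q > 0" by simp
  ultimately show ?thesis by (simp add: pos_divide_le_eq mult_ac)
qed

lemma coords_diff:
  "coords p - coords q = (fst (coords p) - fst (coords q), height p - height q)"
  by (simp add: prod_eq_iff)

lemma height_le_of_dist:
  fixes p q :: "'n::finite hyperbolic_space"
  assumes "dist p q \<le> l"
  shows "height p \<le> 2 * cosh l * height q"
proof -
  let ?s = "height p" and ?t = "height q"
  have "\<bar>?s - ?t\<bar> \<le> norm (coords p - coords q)"
    unfolding coords_diff real_norm_def[symmetric] by (rule norm_snd_le)
  then have "\<bar>?s - ?t\<bar>\<^sup>2 \<le> (norm (coords p - coords q))\<^sup>2" by (intro power_mono) auto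
  then have "(?s - ?t)\<^sup>2 \<le> 2 * ?s * ?t * (cosh l - 1)" using cosh_dist_le[OF assms] by simp
  then have "?s * ?s + ?t * ?t \<le> ?s * (2 * cosh l * ?t)"
    by (simp add: power2_eq_square algebra_simps)
  moreover have "?t * ?t > 0" by simp
  ultimately have "?s * ?s \<le> ?s * (2 * cosh l * ?t)" by linarith
  then show ?thesis by (simp add: mult_le_cancel_left_pos)
qed

lemma norm_fst_le_of_dist:
  fixes p q :: "'n::finite hyperbolic_space"
  assumes "dist p q \<le> l"
  shows "norm (fst (coords p) - fst (coords q)) \<le> 2 * cosh l * height q"
proof -
  have "norm (fst (coords p) - fst (coords q)) \<le> norm (coords p - coords q)"
    unfolding coords_diff by (rule norm_fst_le)
  then have "(norm (fst (coords p) - fst (coords q)))\<^sup>2 \<le> (norm (coords p - coords q))\<^sup>2"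
    by (intro power_mono) auto
  also have "\<dots> \<le> 2 * height p * height q * (cosh l - 1)" by (rule cosh_dist_le[OF assms])
  also have "\<dots> \<le> 2 * (2 * cosh l * height q) * height q * cosh l"
    using height_le_of_dist[OF assms] cosh_real_ge_1[of l] height_pos[of q] height_pos[of p]
    by (intro mult_mono) (auto simp: less_imp_le)
  also have "\<dots> = (2 * cosh l * height q)\<^sup>2" by (simp add: power2_eq_square)
  finally show ?thesis by (rule power2_le_imp_le) (auto simp: less_imp_le)
qed

text \<open>Dilations are isometries of half-space: with heights at least \<open>s\<close>,
  Euclidean distance counts in units of \<open>s\<close>, and the bound depends on \<open>c\<close>
  alone.\<close>

lemma dist_le_of_norm:
  fixes p q :: "'n::finite hyperbolic_space"
  assumes "s > 0" "s \<le> height p" "s \<le> height q" "norm (coords p - coords q) \<le> c * s"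
  shows "dist p q \<le> 2 * arsinh (c / 2)"
proof -
  have "sqrt (s * s) \<le> sqrt (height p * height q)"
    using assms by (intro real_sqrt_le_mono mult_mono) auto
  then have sq: "s \<le> sqrt (height p * height q)" using assms(1) by simp
  have "sinh (dist p q / 2) \<le> (c * s) / (2 * s)"
    unfolding sinh_half_hyperbolic_dist
    using assms sq order_trans[OF norm_ge_zero assms(4)] by (intro frac_le) auto
  also have "\<dots> = sinh (arsinh (c / 2))" using assms(1) by simp
  finally have "dist p q / 2 \<le> arsinh (c / 2)" by (simp only: sinh_real_le_iff)
  then show ?thesis by simp
qed

lemma norm_coords_le:
  fixes p q :: "'n::finite hyperbolic_space"
  shows "norm (coords p - coords q) \<le> norm (fst (coords p) - fst (coords q)) + \<bar>height p - height q\<bar>"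
  unfolding coords_diff real_norm_def[symmetric] by (rule norm_Pair_le)

lemma hyperbolic_ball_totally_bounded:
  fixes o' :: "'n::finite hyperbolic_space"
  assumes "\<epsilon> > 0"
  obtains f :: "'n hyperbolic_space \<Rightarrow> ('n \<Rightarrow> int) \<times> int" and C where "finite C"
    "\<And>p. dist p o' \<le> r \<Longrightarrow> f p \<in> C"
    "\<And>p q. dist p o' \<le> r \<Longrightarrow> dist q o' \<le> r \<Longrightarrow> f p = f q \<Longrightarrow> dist p q < \<epsilon>"
proof -
  define \<tau> where "\<tau> = height o' / (2 * cosh r)"
  have cr: "2 * cosh r > 0" using cosh_real_pos[of r] by simp
  then have \<tau>: "\<tau> > 0" by (simp add: \<tau>_def)
  define m where "m = real CARD('n) + 1"
  have m: "m > 0" by (simp add: m_def)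
  \<comment> \<open>Points of the ball have height at least \<tau>; this mesh makes two points of
    one cell at most \<open>\<epsilon> / 2\<close> apart, hence strictly less than
    \<epsilon>.\<close>
  define s where "s = 2 * sinh (\<epsilon> / 4) * \<tau> / m"
  have s: "s > 0" using assms \<tau> m by (simp add: s_def)
  let ?x = "fst (coords o')"
  let ?\<rho> = "2 * cosh r * height o'"
  define f where "f p = (cell s (fst (coords p) - ?x), \<lfloor>height p / s\<rfloor>)" for p :: "'n hyperbolic_space"
  define C where "C = (cells (?\<rho> / s) :: ('n \<Rightarrow> int) set) \<times> {0..\<lfloor>?\<rho> / s\<rfloor>}"
  have fin: "finite C" unfolding C_def using finite_cells by blast
  have low: "\<tau> \<le> height p" if "dist p o' \<le> r" for p
    using height_le_of_dist[of o' p r] that cr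
    by (simp add: \<tau>_def pos_divide_le_eq dist_commute mult.commute)
  show thesis
  proof (rule that[OF fin])
    fix p :: "'n hyperbolic_space" assume p: "dist p o' \<le> r"
    have "height p / s \<le> ?\<rho> / s" using height_le_of_dist[OF p] s by (intro divide_right_mono) auto
    then have "\<lfloor>height p / s\<rfloor> \<le> \<lfloor>?\<rho> / s\<rfloor>" by (rule floor_mono)
    moreover have "0 \<le> height p / s" using s height_pos[of p] by (simp add: less_imp_le)
    ultimately show "f p \<in> C"
      unfolding f_def C_def using cell_in_cells[OF s norm_fst_le_of_dist[OF p]] by simp
  next
    fix p q :: "'n hyperbolic_space"
    assume p: "dist p o' \<le> r" and q: "dist q o' \<le> r" and eq: "f p = f q"
    have "norm (fst (coords p) - fst (coords q)) \<le> real CARD('n) * s"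
      using cell_eq_imp_close[OF s, of "fst (coords p) - ?x" "fst (coords q) - ?x"] eq by (simp add: f_def)
    moreover have "\<bar>height p - height q\<bar> \<le> s"
      using floor_divide_eq_imp_close[OF s] eq by (simp add: f_def)
    ultimately have "norm (coords p - coords q) \<le> m * s"
      using norm_coords_le[of p q] by (simp add: m_def distrib_right)
    also have "m * s = (2 * sinh (\<epsilon> / 4)) * \<tau>" using m by (simp add: s_def)
    finally have "dist p q \<le> 2 * arsinh ((2 * sinh (\<epsilon> / 4)) / 2)"
      by (intro dist_le_of_norm[OF \<tau> low[OF p] low[OF q]])
    then show "dist p q < \<epsilon>" using assms by (simp add: arsinh_sinh_real)
  qed
qed


section \<open>Orbits of discrete groups of isometries\<close>

lemma isometry_groupD:
  assumes "\<gamma> \<in> carrier isometry_group"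
  shows "dist (\<gamma> x) (\<gamma> y) = dist x y"
  using assms by (simp add: isometry_group_def)

lemma isometry_group_simps [simp]:
  "x \<otimes>\<^bsub>isometry_group\<^esub> y = x \<circ> y" "\<one>\<^bsub>isometry_group\<^esub> = id"
  by (simp_all add: isometry_group_def)

text \<open>A basic neighbourhood of the identity for pointwise convergence restricts the values at
  finitely many points only; these form \<open>P\<close>.\<close>

lemma discrete_isometries_isolated:
  assumes \<Gamma>: "subgroup \<Gamma> isometry_group"
    and discrete: "subtopology isometry_topology \<Gamma> = discrete_topology \<Gamma>"
  obtains P and \<epsilon> :: real where "finite P" "\<epsilon> > 0"
    "\<And>\<gamma>. \<gamma> \<in> \<Gamma> \<Longrightarrow> (\<And>p. p \<in> P \<Longrightarrow> dist (\<gamma> p) p < \<epsilon>) \<Longrightarrow> \<gamma> = id"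
proof -
  have id: "id \<in> \<Gamma>" using subgroup.one_closed[OF \<Gamma>] by simp
  have sub: "\<Gamma> \<subseteq> carrier isometry_group" using subgroup.subset[OF \<Gamma>] .
  have "openin (subtopology isometry_topology \<Gamma>) {id}" unfolding discrete using id by simp
  then obtain U where U: "open U" "{id} = U \<inter> carrier isometry_group \<inter> \<Gamma>"
    unfolding isometry_topology_def openin_subtopology by auto
  have "id \<in> U" using U(2) by blast
  then obtain X where X: "finite {i. X i \<noteq> UNIV}" "\<And>i. open (X i)" "id \<in> PiE UNIV X" "PiE UNIV X \<subseteq> U"
    using U(1) unfolding open_fun_def openin_product_topology_alt by auto
  define P where "P = {i. X i \<noteq> UNIV}"
  have "\<forall>i. \<exists>e>0. \<forall>y. dist y i < e \<longrightarrow> y \<in> X i"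
    using X(2,3) unfolding open_dist PiE_iff by auto
  then obtain e where e: "\<And>i. e i > 0" "\<And>i y. dist y i < e i \<Longrightarrow> y \<in> X i" by metis
  define \<epsilon> where "\<epsilon> = Min (insert 1 (e ` P))"
  have finP: "finite P" using X(1) by (simp add: P_def)
  have "\<gamma> = id" if \<gamma>: "\<gamma> \<in> \<Gamma>" "\<And>p. p \<in> P \<Longrightarrow> dist (\<gamma> p) p < \<epsilon>" for \<gamma>
  proof -
    have "\<gamma> i \<in> X i" for i
    proof (cases "i \<in> P")
      case True
      then have "\<epsilon> \<le> e i" using finP by (simp add: \<epsilon>_def)
      then show ?thesis using e(2) \<gamma>(2)[OF True] by fastforce
    qed (auto simp: P_def)
    then have "\<gamma> \<in> U" using X(4) by auto
    then show ?thesis using U(2) \<gamma>(1) sub by blast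
  qed
  moreover have "\<epsilon> > 0" using finP e(1) by (simp add: \<epsilon>_def)
  ultimately show thesis using that finP by blast
qed

lemma isometry_inv:
  assumes \<Gamma>: "subgroup \<Gamma> isometry_group" and "\<gamma> \<in> \<Gamma>"
  obtains \<gamma>' where "\<gamma>' \<in> \<Gamma>" "\<gamma>' \<circ> \<gamma> = id" "\<gamma> \<circ> \<gamma>' = id"
proof -
  interpret group "isometry_group :: ('a \<Rightarrow> 'a) monoid" by (rule group_isometry_group)
  have "\<gamma> \<in> carrier isometry_group" using assms subgroup.subset[OF \<Gamma>] by blast
  then show thesis
    using that[of "inv\<^bsub>isometry_group\<^esub> \<gamma>"] subgroup.m_inv_closed[OF assms] l_inv[of \<gamma>] r_inv[of \<gamma>] by simp
qed

text \<open>Each element of the set is recorded by the grid cells of its values on \<open>P\<close>,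
  and only finitely many records occur. If two elements have the same record, the inverse of one
  composed with the other moves every point of \<open>P\<close> by less than \<epsilon> and is the
  identity.\<close>

lemma discrete_orbit_finite:
  fixes \<Gamma> :: "('n::finite hyperbolic_space \<Rightarrow> 'n hyperbolic_space) set"
  assumes \<Gamma>: "subgroup \<Gamma> isometry_group"
    and discrete: "subtopology isometry_topology \<Gamma> = discrete_topology \<Gamma>"
  shows "finite {\<gamma> \<in> \<Gamma>. dist (\<gamma> o') o' \<le> R}"
proof -
  obtain P and \<epsilon> :: real where P: "finite P" "\<epsilon> > 0"
    "\<And>\<gamma>. \<gamma> \<in> \<Gamma> \<Longrightarrow> (\<And>p. p \<in> P \<Longrightarrow> dist (\<gamma> p) p < \<epsilon>) \<Longrightarrow> \<gamma> = id"
    using discrete_isometries_isolated[OF assms] by blast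
  have iso: "dist (\<gamma> x) (\<gamma> y) = dist x y" if "\<gamma> \<in> \<Gamma>" for \<gamma> x y
    using that subgroup.subset[OF \<Gamma>] isometry_groupD by blast
  have "\<forall>p. \<exists>f :: 'n hyperbolic_space \<Rightarrow> ('n \<Rightarrow> int) \<times> int. \<exists>C. finite C \<and>
    (\<forall>q. dist q o' \<le> dist p o' + R \<longrightarrow> f q \<in> C) \<and>
    (\<forall>q q'. dist q o' \<le> dist p o' + R \<longrightarrow> dist q' o' \<le> dist p o' + R \<longrightarrow> f q = f q' \<longrightarrow> dist q q' < \<epsilon>)"
    using hyperbolic_ball_totally_bounded[OF P(2), of o'] by metis
  then obtain f :: "'n hyperbolic_space \<Rightarrow> 'n hyperbolic_space \<Rightarrow> ('n \<Rightarrow> int) \<times> int" and C where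
    f: "\<And>p. finite (C p)" "\<And>p q. dist q o' \<le> dist p o' + R \<Longrightarrow> f p q \<in> C p"
      "\<And>p q q'. dist q o' \<le> dist p o' + R \<Longrightarrow> dist q' o' \<le> dist p o' + R \<Longrightarrow> f p q = f p q' \<Longrightarrow> dist q q' < \<epsilon>"
    by metis
  let ?S = "{\<gamma> \<in> \<Gamma>. dist (\<gamma> o') o' \<le> R}"
  define F where "F \<gamma> = (\<lambda>p\<in>P. f p (\<gamma> p))" for \<gamma>
  have near: "dist (\<gamma> p) o' \<le> dist p o' + R" if "\<gamma> \<in> ?S" for \<gamma> p
    using dist_triangle[of "\<gamma> p" o' "\<gamma> o'"] iso[of \<gamma> p o'] that by auto
  have "F ` ?S \<subseteq> PiE P C"
    using f(2)[OF near] by (auto simp: F_def)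
  moreover have "finite (PiE P C)" using P(1) f(1) by (intro finite_PiE) auto
  ultimately have "finite (F ` ?S)" using finite_subset by blast
  moreover have "inj_on F ?S"
  proof (rule inj_onI)
    fix \<gamma> \<delta> assume \<gamma>: "\<gamma> \<in> ?S" and \<delta>: "\<delta> \<in> ?S" and eq: "F \<gamma> = F \<delta>"
    obtain \<gamma>' where \<gamma>': "\<gamma>' \<in> \<Gamma>" "\<gamma>' \<circ> \<gamma> = id" "\<gamma> \<circ> \<gamma>' = id" using isometry_inv[OF \<Gamma>] \<gamma> by blast
    have "\<gamma>' \<circ> \<delta> \<in> \<Gamma>" using subgroup.m_closed[OF \<Gamma> \<gamma>'(1)] \<delta> by simp
    moreover have "dist ((\<gamma>' \<circ> \<delta>) p) p < \<epsilon>" if p: "p \<in> P" for p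
    proof -
      have "f p (\<gamma> p) = f p (\<delta> p)" using fun_cong[OF eq, of p] p by (simp add: F_def)
      then have "dist (\<gamma> p) (\<delta> p) < \<epsilon>" by (rule f(3)[OF near[OF \<gamma>] near[OF \<delta>]])
      moreover have "dist (\<gamma>' (\<gamma> p)) (\<gamma>' (\<delta> p)) = dist (\<gamma> p) (\<delta> p)" by (rule iso[OF \<gamma>'(1)])
      moreover have "\<gamma>' (\<gamma> p) = p" using fun_cong[OF \<gamma>'(2), of p] by simp
      ultimately show ?thesis by (simp add: dist_commute)
    qed
    ultimately have "\<gamma>' \<circ> \<delta> = id" by (rule P(3))
    then have "\<gamma> \<circ> (\<gamma>' \<circ> \<delta>) = \<gamma>" by simp
    then show "\<gamma> = \<delta>" using \<gamma>'(3) by (metis comp_assoc id_comp)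
  qed
  ultimately show ?thesis using finite_imageD by blast
qed

text \<open>A translation by one element of the set brings all of it within \<open>2 * R\<close> of
  the base point, which makes the bound independent of \<open>p\<close>.\<close>

lemma discrete_orbit_bounded_multiplicity:
  fixes \<Gamma> :: "('n::finite hyperbolic_space \<Rightarrow> 'n hyperbolic_space) set"
  assumes \<Gamma>: "subgroup \<Gamma> isometry_group"
    and discrete: "subtopology isometry_topology \<Gamma> = discrete_topology \<Gamma>"
  obtains N where "\<And>p. finite {\<gamma> \<in> \<Gamma>. dist (\<gamma> o') p \<le> R}" "\<And>p. card {\<gamma> \<in> \<Gamma>. dist (\<gamma> o') p \<le> R} \<le> N"
proof -
  let ?S = "{\<gamma> \<in> \<Gamma>. dist (\<gamma> o') o' \<le> 2 * R}"
  have fin: "finite ?S" by (rule discrete_orbit_finite[OF assms])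
  have iso: "dist (\<gamma> x) (\<gamma> y) = dist x y" if "\<gamma> \<in> \<Gamma>" for \<gamma> x y
    using that subgroup.subset[OF \<Gamma>] isometry_groupD by blast
  have "finite {\<gamma> \<in> \<Gamma>. dist (\<gamma> o') p \<le> R} \<and> card {\<gamma> \<in> \<Gamma>. dist (\<gamma> o') p \<le> R} \<le> card ?S" for p
  proof (cases "{\<gamma> \<in> \<Gamma>. dist (\<gamma> o') p \<le> R} = {}")
    case True
    then show ?thesis by (simp only: finite.emptyI card.empty) simp
  next
    case False
    then obtain \<gamma> where \<gamma>: "\<gamma> \<in> \<Gamma>" "dist (\<gamma> o') p \<le> R" by blast
    obtain \<gamma>' where \<gamma>': "\<gamma>' \<in> \<Gamma>" "\<gamma>' \<circ> \<gamma> = id" "\<gamma> \<circ> \<gamma>' = id" using isometry_inv[OF \<Gamma> \<gamma>(1)] by blast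
    have inj: "inj_on (\<lambda>\<delta>. \<gamma>' \<circ> \<delta>) {\<gamma> \<in> \<Gamma>. dist (\<gamma> o') p \<le> R}"
      by (rule inj_onI) (metis \<gamma>'(3) comp_assoc id_comp)
    have im: "(\<lambda>\<delta>. \<gamma>' \<circ> \<delta>) ` {\<gamma> \<in> \<Gamma>. dist (\<gamma> o') p \<le> R} \<subseteq> ?S"
    proof safe
      fix \<delta> assume \<delta>: "\<delta> \<in> \<Gamma>" "dist (\<delta> o') p \<le> R"
      show "\<gamma>' \<circ> \<delta> \<in> \<Gamma>" using subgroup.m_closed[OF \<Gamma> \<gamma>'(1) \<delta>(1)] by simp
      have "dist ((\<gamma>' \<circ> \<delta>) o') o' = dist (\<gamma>' (\<delta> o')) (\<gamma>' (\<gamma> o'))" using fun_cong[OF \<gamma>'(2), of o'] by simp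
      also have "\<dots> = dist (\<delta> o') (\<gamma> o')" by (rule iso[OF \<gamma>'(1)])
      also have "\<dots> \<le> 2 * R" using dist_triangle2[of "\<delta> o'" "\<gamma> o'" p] \<delta>(2) \<gamma>(2) by linarith
      finally show "dist ((\<gamma>' \<circ> \<delta>) o') o' \<le> 2 * R" .
    qed
    show ?thesis using inj_on_finite[OF inj im fin] card_inj_on_le[OF inj im fin] by blast
  qed
  then show thesis using that by blast
qed

lemma orbit_lipschitz:
  fixes \<Gamma> T :: "('a::metric_space \<Rightarrow> 'a) set"
  assumes \<Gamma>: "subgroup \<Gamma> isometry_group"
    and T: "finite_generating_set (isometry_group\<lparr>carrier := \<Gamma>\<rparr>) T"
  obtains l where "l \<ge> 0" "\<And>\<gamma> \<delta>. \<gamma> \<in> \<Gamma> \<Longrightarrow> \<delta> \<in> \<Gamma> \<Longrightarrow>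
    dist (\<gamma> o') (\<delta> o') \<le> l * real (graph_dist (cayley_graph (isometry_group\<lparr>carrier := \<Gamma>\<rparr>) T) \<gamma> \<delta>)"
proof -
  let ?G = "isometry_group\<lparr>carrier := \<Gamma>\<rparr>"
  interpret I: group "isometry_group :: ('a \<Rightarrow> 'a) monoid" by (rule group_isometry_group)
  interpret G: group ?G by (rule I.subgroup_imp_group[OF \<Gamma>])
  let ?T = "T \<union> m_inv ?G ` T" and ?E = "edges (cayley_graph ?G T)"
  have T': "finite T" "T \<subseteq> carrier ?G" "generate ?G T = carrier ?G"
    using T by (auto simp: finite_generating_set_def)
  define l where "l = (\<Sum>s\<in>?T. dist o' (s o'))"
  have l: "l \<ge> 0" unfolding l_def by (intro sum_nonneg) auto
  have edge: "dist (\<gamma> o') (\<delta> o') \<le> l" if "(\<gamma>, \<delta>) \<in> ?E" for \<gamma> \<delta>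
  proof -
    have "\<exists>s. \<gamma> \<in> \<Gamma> \<and> s \<in> ?T \<and> \<delta> = \<gamma> \<circ> s"
      using \<open>(\<gamma>, \<delta>) \<in> ?E\<close> by (simp add: cayley_graph_def) blast
    then obtain s where s: "\<gamma> \<in> \<Gamma>" "s \<in> ?T" "\<delta> = \<gamma> \<circ> s" by (elim exE conjE)
    have "dist (\<gamma> o') (\<delta> o') = dist o' (s o')"
      using s(1,3) subgroup.subset[OF \<Gamma>] isometry_groupD[of \<gamma> o' "s o'"] by auto
    also have "\<dots> \<le> l" unfolding l_def using s(2) T'(1) by (intro member_le_sum) auto
    finally show ?thesis .
  qed
  have path: "dist (\<gamma> o') (\<delta> o') \<le> l * real n" if "(\<gamma>, \<delta>) \<in> ?E ^^ n" for \<gamma> \<delta> n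
    using that
  proof (induction n arbitrary: \<delta>)
    case (Suc n)
    then obtain \<eta> where "(\<gamma>, \<eta>) \<in> ?E ^^ n" "(\<eta>, \<delta>) \<in> ?E" by auto
    then show ?case
      using Suc.IH edge dist_triangle[of "\<gamma> o'" "\<delta> o'" "\<eta> o'"] by (fastforce simp: algebra_simps)
  qed auto
  show thesis
  proof (rule that[OF l])
    fix \<gamma> \<delta> assume "\<gamma> \<in> \<Gamma>" "\<delta> \<in> \<Gamma>"
    \<comment> \<open>Connectedness guarantees that the \<open>LEAST\<close> in
      \<open>graph_dist\<close> is the length of an actual path.\<close>
    then have "(\<gamma>, \<delta>) \<in> ?E\<^sup>*" using G.cayley_graph_connected[OF T'(2,3)] by simp
    then have "\<exists>n. (\<gamma>, \<delta>) \<in> ?E ^^ n" by (simp add: rtrancl_power)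
    then have "(\<gamma>, \<delta>) \<in> ?E ^^ graph_dist (cayley_graph ?G T) \<gamma> \<delta>"
      unfolding graph_dist_def by (rule LeastI_ex)
    then show "dist (\<gamma> o') (\<delta> o') \<le> l * real (graph_dist (cayley_graph ?G T) \<gamma> \<delta>)" by (rule path)
  qed
qed

lemma regular_orbit_adjacent:
  fixes G :: "('a, 'b) monoid_scheme" (structure)
  assumes "group G" and gens: "finite_generating_set G S"
    and f: "f \<in> carrier G \<rightarrow> \<Gamma>"
    and \<kappa>: "\<And>x y. x \<in> carrier G \<Longrightarrow> y \<in> carrier G \<Longrightarrow>
      real (graph_dist Y (f x) (f y)) \<le> \<kappa> * (real (graph_dist (cayley_graph G S) x y) + 1)"
    and l: "l \<ge> 0" "\<And>\<gamma> \<delta>. \<gamma> \<in> \<Gamma> \<Longrightarrow> \<delta> \<in> \<Gamma> \<Longrightarrow> dist (\<gamma> o') (\<delta> o') \<le> l * real (graph_dist Y \<gamma> \<delta>)"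
    and x: "x \<in> carrier G" "s \<in> S \<union> m_inv G ` S" and "\<kappa> > 0"
  shows "dist (f x o') (f (x \<otimes>\<^bsub>G\<^esub> s) o') \<le> l * (2 * \<kappa>)"
proof -
  interpret group G by fact
  have s: "s \<in> carrier G" using x(2) gens by (auto simp: finite_generating_set_def)
  let ?X = "cayley_graph G S"
  have "(x, x \<otimes> s) \<in> edges ?X ^^ 1" using x by (simp add: cayley_graph_def) blast
  then have "graph_dist ?X x (x \<otimes> s) \<le> 1" unfolding graph_dist_def by (rule Least_le)
  then have "\<kappa> * (real (graph_dist ?X x (x \<otimes> s)) + 1) \<le> \<kappa> * 2" using \<open>\<kappa> > 0\<close> by simp
  then have "real (graph_dist Y (f x) (f (x \<otimes> s))) \<le> 2 * \<kappa>" using \<kappa>[of x "x \<otimes> s"] x(1) s by simp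
  then have "l * real (graph_dist Y (f x) (f (x \<otimes> s))) \<le> l * (2 * \<kappa>)" using l(1) by (rule mult_left_mono)
  moreover have "f x \<in> \<Gamma>" "f (x \<otimes> s) \<in> \<Gamma>" using f x(1) s by auto
  ultimately show ?thesis using l(2)[of "f x" "f (x \<otimes> s)"] by linarith
qed

theorem regular_map_no_free_semigroup:
  fixes G :: "('a, 'b) monoid_scheme" (structure)
    and \<Gamma> T :: "('n::finite hyperbolic_space \<Rightarrow> 'n hyperbolic_space) set"
  assumes G: "group G" "solvable G" "finite_generating_set G S"
    and \<Gamma>: "subgroup \<Gamma> isometry_group" "subtopology isometry_topology \<Gamma> = discrete_topology \<Gamma>"
    and T: "finite_generating_set (isometry_group\<lparr>carrier := \<Gamma>\<rparr>) T"
    and reg: "regular_map (cayley_graph G S) (cayley_graph (isometry_group\<lparr>carrier := \<Gamma>\<rparr>) T) f"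
  shows "no_free_semigroup G (carrier G)"
proof -
  interpret group G by fact
  let ?Y = "cayley_graph (isometry_group\<lparr>carrier := \<Gamma>\<rparr>) T"
  define S' where "S' = S \<union> m_inv G ` S"
  have S: "finite S" "S \<subseteq> carrier G" "generate G S = carrier G"
    using G(3) by (auto simp: finite_generating_set_def)
  have S'c: "S' \<subseteq> carrier G" using S by (auto simp: S'_def)
  have f: "f \<in> carrier G \<rightarrow> \<Gamma>" using reg by (simp add: regular_map_def cayley_graph_def)
  obtain \<kappa> :: real where \<kappa>: "\<kappa> > 0" "\<And>x y. x \<in> carrier G \<Longrightarrow> y \<in> carrier G \<Longrightarrow>
      real (graph_dist ?Y (f x) (f y)) \<le> \<kappa> * (real (graph_dist (cayley_graph G S) x y) + 1)"
    "\<And>\<gamma>. \<gamma> \<in> \<Gamma> \<Longrightarrow> finite {x \<in> carrier G. f x = \<gamma>} \<and> real (card {x \<in> carrier G. f x = \<gamma>}) \<le> \<kappa>"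
    using reg by (auto simp: regular_map_def cayley_graph_def)
  \<comment> \<open>Any base point will do.\<close>
  define o' :: "'n hyperbolic_space" where "o' = undefined"
  define q where "q x = f x o'" for x
  obtain l where l: "l \<ge> 0" "\<And>\<gamma> \<delta>. \<gamma> \<in> \<Gamma> \<Longrightarrow> \<delta> \<in> \<Gamma> \<Longrightarrow>
      dist (\<gamma> o') (\<delta> o') \<le> l * real (graph_dist ?Y \<gamma> \<delta>)"
    using orbit_lipschitz[OF \<Gamma>(1) T] by blast
  \<comment> \<open>Regularity sends neighbours to graph distance at most
    \<open>2 * \<kappa>\<close>, the orbit map to distance at most
    \<open>l * (2 * \<kappa>)\<close>; \<open>L\<close> bounds the resulting ratios in half-space
    coordinates.\<close>
  define L where "L = 2 * cosh (l * (2 * \<kappa>))"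
  have L: "L \<ge> 1" using cosh_real_ge_1[of "l * (2 * \<kappa>)"] by (simp add: L_def)
  \<comment> \<open>The hyperbolic diameter of the sets in the locale hypothesis
    \<open>mult\<close>, whose coordinates differ by at most \<open>(CARD('n) + 1) * s\<close> in
    norm.\<close>
  define c where "c = 2 * arsinh ((real CARD('n) + 1) / 2)"
  obtain N where N: "\<And>p. finite {\<gamma> \<in> \<Gamma>. dist (\<gamma> o') p \<le> c}" "\<And>p. card {\<gamma> \<in> \<Gamma>. dist (\<gamma> o') p \<le> c} \<le> N"
    using discrete_orbit_bounded_multiplicity[OF \<Gamma>] by blast
  \<comment> \<open>At most \<open>N\<close> lattice elements send the base point into a ball of
    radius \<open>c\<close>, and \<open>f\<close> takes each value at most \<kappa> times.\<close>
  define \<mu> where "\<mu> = real N * \<kappa>"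
  have \<mu>: "\<mu> \<ge> 0" using \<kappa>(1) by (simp add: \<mu>_def)
  have pts: "half_space_points F (\<lambda>x. fst (coords (q x))) (\<lambda>x. height (q x))
      (\<lambda>x y. \<exists>s\<in>S'. y = x \<otimes> s) \<mu> L" if F: "finite F" "F \<subseteq> carrier G" for F
  proof
    show "finite F" "L \<ge> 1" by fact+
    show "height (q x) > 0" for x by simp
  next
    fix B and s :: real
    assume B: "B \<subseteq> F" and s: "s > 0" "\<And>x. x \<in> B \<Longrightarrow> s \<le> height (q x)"
      and close: "\<And>x y. x \<in> B \<Longrightarrow> y \<in> B \<Longrightarrow>
        norm (fst (coords (q x)) - fst (coords (q y))) \<le> real CARD('n) * s \<and> \<bar>height (q x) - height (q y)\<bar> \<le> s"
    show "real (card B) \<le> \<mu>"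
    proof (cases "B = {}")
      case True
      then show ?thesis using \<mu> by simp
    next
      case False
      then obtain y where y: "y \<in> B" by blast
      let ?C = "{\<gamma> \<in> \<Gamma>. dist (\<gamma> o') (q y) \<le> c}"
      have dist: "dist (q x) (q y) \<le> c" if x: "x \<in> B" for x
        unfolding c_def
      proof (rule dist_le_of_norm[OF s(1) s(2)[OF x] s(2)[OF y]])
        show "norm (coords (q x) - coords (q y)) \<le> (real CARD('n) + 1) * s"
          using norm_coords_le[of "q x" "q y"] close[OF x y] by (simp add: distrib_right)
      qed
      have Bc: "B \<subseteq> carrier G" using B F(2) by blast
      have "real (card B) \<le> real (card ?C) * \<kappa>"
      proof (rule card_le_fibres[where c = f])
        show "finite B" using B F(1) finite_subset by blast
        show "finite ?C" by (rule N(1))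
        show "f ` B \<subseteq> ?C" using dist f Bc by (auto simp: q_def)
        fix \<gamma> assume "\<gamma> \<in> ?C"
        then have k: "finite {x \<in> carrier G. f x = \<gamma>}" "real (card {x \<in> carrier G. f x = \<gamma>}) \<le> \<kappa>"
          using \<kappa>(3)[of \<gamma>] by auto
        have "card {x \<in> B. f x = \<gamma>} \<le> card {x \<in> carrier G. f x = \<gamma>}"
          using Bc by (intro card_mono[OF k(1)]) auto
        then show "real (card {x \<in> B. f x = \<gamma>}) \<le> \<kappa>" using k(2) by linarith
      qed
      also have "\<dots> \<le> \<mu>"
        unfolding \<mu>_def using N(2)[of "q y"] \<kappa>(1) by (intro mult_right_mono) auto
      finally show ?thesis .
    qed
  next
    fix x y assume xy: "x \<in> F" "y \<in> F" "\<exists>s\<in>S'. y = x \<otimes> s"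
    then obtain s where s: "s \<in> S \<union> m_inv G ` S" "y = x \<otimes> s" unfolding S'_def by blast
    have d: "dist (q x) (q y) \<le> l * (2 * \<kappa>)"
      unfolding q_def s(2)
      using regular_orbit_adjacent[OF G(1,3) f \<kappa>(2) l _ s(1) \<kappa>(1)] xy(1) F(2) by blast
    then have d': "dist (q y) (q x) \<le> l * (2 * \<kappa>)" by (simp add: dist_commute)
    show "norm (fst (coords (q x)) - fst (coords (q y))) \<le> L * height (q x) \<and>
        norm (fst (coords (q x)) - fst (coords (q y))) \<le> L * height (q y) \<and>
        height (q x) \<le> L * height (q y) \<and> height (q y) \<le> L * height (q x)"
      unfolding L_def using height_le_of_dist[OF d] height_le_of_dist[OF d']
        norm_fst_le_of_dist[OF d] norm_fst_le_of_dist[OF d'] by (simp add: norm_minus_commute)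
  qed
  obtain n where "(derived G ^^ n) (carrier G) = {\<one>}"
    using G(2) solvable_iff_trivial_derived_seq by blast
  then have fol: "folner G (carrier G)" by (rule folner_solvable[OF subgroup_self])
  show ?thesis
  proof (rule no_free_semigroup_of_cuts[OF S S'_def fol])
    let ?n = "CARD('n)"
    show "0 \<le> (12 * (1 + L\<^sup>2) * L + 3) ^ ?n * (6 * L\<^sup>2 + 1) * \<mu>" using L \<mu> by simp
    show "2 \<le> 4 * (8 * real ?n + 3) ^ ?n"
    proof -
      have "1 \<le> (8 * real ?n + 3) ^ ?n" by (intro one_le_power) simp
      then show ?thesis by linarith
    qed
    fix F and M :: nat
    assume F: "finite F" "F \<subseteq> carrier G" "F \<noteq> {}" and large: "20 * 11 ^ ?n * \<mu> \<le> real (card F)" and M: "M \<ge> 1"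
    show "\<exists>A\<subseteq>F. real (card F) \<le> 4 * (8 * real ?n + 3) ^ ?n * real (card A) \<and> 2 * real (card A) \<le> real (card F) \<and>
        real (card {x \<in> F. \<exists>y\<in>F. (\<exists>s\<in>S'. y = x \<otimes> s) \<and> (x \<in> A) \<noteq> (y \<in> A)})
          \<le> (12 * (1 + L\<^sup>2) * L + 3) ^ ?n * (6 * L\<^sup>2 + 1) * \<mu> * real M ^ (?n + 1) + real (card F) / real M"
    proof (rule half_space_points.balanced_cut[OF pts[OF F(1,2)] large F(3) M])
      fix A
      assume "A \<subseteq> F" "real (card F) \<le> 4 * (8 * real ?n + 3) ^ ?n * real (card A)" "2 * real (card A) \<le> real (card F)"
        "real (card {x \<in> F. \<exists>y\<in>F. (\<exists>s\<in>S'. y = x \<otimes> s) \<and> (x \<in> A) \<noteq> (y \<in> A)})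
          \<le> (12 * (1 + L\<^sup>2) * L + 3) ^ ?n * (6 * L\<^sup>2 + 1) * \<mu> * real M ^ (?n + 1) + real (card F) / real M"
      then show ?thesis by (intro exI[of _ A] conjI)
    qed
  qed
qed

theorem corollary1p8:
  fixes G :: "('a, 'b) monoid_scheme"
    and S :: "'a set"
    and d :: nat
    and \<Gamma> T :: "('n::finite hyperbolic_space \<Rightarrow> 'n hyperbolic_space) set"
  assumes "group G" and "solvable G" and "finite_generating_set G S"
    and "d \<ge> 2" and "CARD('n) + 1 = d"
    and "uniform_lattice isometry_group isometry_topology \<Gamma>"
    and "finite_generating_set (isometry_group\<lparr>carrier := \<Gamma>\<rparr>) T"
    and "\<exists>f. regular_map (cayley_graph G S) (cayley_graph (isometry_group\<lparr>carrier := \<Gamma>\<rparr>) T) f"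
  shows "virtually_nilpotent G"
proof -
  obtain f where f: "regular_map (cayley_graph G S) (cayley_graph (isometry_group\<lparr>carrier := \<Gamma>\<rparr>) T) f"
    using assms(8) by blast
  have "subgroup \<Gamma> isometry_group" "subtopology isometry_topology \<Gamma> = discrete_topology \<Gamma>"
    using assms(6) by (auto simp: uniform_lattice_def)
  from regular_map_no_free_semigroup[OF assms(1-3) this assms(7) f]
  show ?thesis by (rule group.solvable_virtually_nilpotent[OF assms(1-3)])
qed

end
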